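(* Let $\mathcal{H}$ be a complex Hilbert space, let $B,C\in\mathcal{B}(\mathcal{H})$, let $p,q\ge1$ with $\frac1p+\frac1q=1$, and let $f,g$ be non-negative continuous functions on $[0,\infty)$ satisfying $f(t)g(t)=t$ for all $t\ge0$. Then for all $n\in\mathbb{N}$ with $n\ge2$, $$\begin{aligned}\omega^{2n}\left(\begin{bmatrix}0&B\\ C&0\end{bmatrix}\right)\le{}&\frac1{2^n}\max\left\{\left\|\tfrac1p|C|^{np}+\tfrac1q|B^*|^{nq}\right\|,\left\|\tfrac1p|B|^{np}+\tfrac1q|C^*|^{nq}\right\|\right\}\\&+\frac1{2^n}\max\left\{\left\|\tfrac1p f^{np}(|BC|)+\tfrac1q g^{nq}(|(BC)^*|)\right\|,\left\|\tfrac1p f^{np}(|CB|)+\tfrac1q g^{nq}(|(CB)^*|)\right\|\right\}\\&+\frac1{2^n}\sum_{k=1}^{n-1}\binom nk\max\left\{\left\|\tfrac1p|C|^{kp}+\tfrac1q|B^*|^{kq}\right\|,\left\|\tfrac1p|B|^{kp}+\tfrac1q|C^*|^{kq}\right\|\right\}\\&\qquad\times\max\left\{\left\|\tfrac1p f^{(n-k)p}(|BC|)+\tfrac1q g^{(n-k)q}(|(BC)^*|)\right\|,\left\|\tfrac1p f^{(n-k)p}(|CB|)+\tfrac1q g^{(n-k)q}(|(CB)^*|)\right\|\right\}.\end{aligned}$$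
   Context: $\mathcal{B}(\mathcal{H})$ is the algebra of bounded linear operators on $\mathcal{H}$, $\|\cdot\|$ is the operator norm, and $2\times2$ operator matrices act on $\mathcal{H}\oplus\mathcal{H}$. The numerical radius of a bounded operator $A$ on a complex Hilbert space is $\omega(A)=\sup_{\|x\|=1}|\langle Ax,x\rangle|$, and $\omega^s(A)=(\omega(A))^s$. $|A|=(A^*A)^{1/2}$. For a positive operator $P$, $f^{s}(P)=(f(P))^{s}$ is defined by the continuous functional calculus. *)

theory Defs
  imports "HOL-Analysis.Analysis" "HOL-Computational_Algebra.Polynomial"
begin

section \<open>Complex Hilbert spaces\<close>

text \<open>The inner product is linear in its first argument. The real norm structure inherited from
  the library is the one induced by the inner product.\<close>

class complex_inner = real_normed_vector +
  fixes scaleC :: "complex \<Rightarrow> 'a \<Rightarrow> 'a" (infixr "*\<^sub>C" 75)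
    and cinner :: "'a \<Rightarrow> 'a \<Rightarrow> complex"
  assumes scaleC_add_right: "c *\<^sub>C (x + y) = c *\<^sub>C x + c *\<^sub>C y"
    and scaleC_add_left: "(c + d) *\<^sub>C x = c *\<^sub>C x + d *\<^sub>C x"
    and scaleC_scaleC: "c *\<^sub>C (d *\<^sub>C x) = (c * d) *\<^sub>C x"
    and scaleC_of_real: "complex_of_real r *\<^sub>C x = r *\<^sub>R x"
    and cinner_commute: "cinner x y = cnj (cinner y x)"
    and cinner_add_left: "cinner (x + y) z = cinner x z + cinner y z"
    and cinner_scaleC_left: "cinner (c *\<^sub>C x) y = c * cinner x y"
    and cinner_self_nonneg: "0 \<le> Re (cinner x x)"
    and norm_eq_sqrt_cinner: "norm x = sqrt (Re (cinner x x))"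

class chilbert_space = complex_inner + complete_space

instantiation complex :: chilbert_space
begin

definition "scaleC_complex (c::complex) (x::complex) = c * x"
definition "cinner_complex (x::complex) (y::complex) = x * cnj y"

instance
  by standard
    (auto simp: scaleC_complex_def cinner_complex_def algebra_simps scaleR_conv_of_real
      cmod_def power2_eq_square)

end

text \<open>The library norm on \<open>'a \<times> 'b\<close> is the square root of the sum of the squared norms, so the product
  type is the Hilbert space direct sum.\<close>

instantiation prod :: (complex_inner, complex_inner) complex_inner
begin

definition "scaleC_prod c (x :: 'a \<times> 'b) = (c *\<^sub>C fst x, c *\<^sub>C snd x)"
definition "cinner_prod (x :: 'a \<times> 'b) y = cinner (fst x) (fst y) + cinner (snd x) (snd y)"

instance
proof
  fix x y z :: "'a \<times> 'b" and c d :: complex and r :: real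
  show "c *\<^sub>C (x + y) = c *\<^sub>C x + c *\<^sub>C y"
    by (simp add: scaleC_prod_def scaleC_add_right)
  show "(c + d) *\<^sub>C x = c *\<^sub>C x + d *\<^sub>C x"
    by (simp add: scaleC_prod_def scaleC_add_left)
  show "c *\<^sub>C (d *\<^sub>C x) = (c * d) *\<^sub>C x"
    by (simp add: scaleC_prod_def scaleC_scaleC)
  show "complex_of_real r *\<^sub>C x = r *\<^sub>R x"
    by (simp add: scaleC_prod_def scaleC_of_real scaleR_prod_def)
  show "cinner x y = cnj (cinner y x)"
    by (simp add: cinner_prod_def cinner_commute[symmetric])
  show "cinner (x + y) z = cinner x z + cinner y z"
    by (simp add: cinner_prod_def cinner_add_left)
  show "cinner (c *\<^sub>C x) y = c * cinner x y"
    by (simp add: cinner_prod_def scaleC_prod_def cinner_scaleC_left algebra_simps)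
  show "0 \<le> Re (cinner x x)"
    by (simp add: cinner_prod_def cinner_self_nonneg)
  show "norm x = sqrt (Re (cinner x x))"
    by (simp add: cinner_prod_def norm_prod_def norm_eq_sqrt_cinner cinner_self_nonneg)
qed

end

instance prod :: (chilbert_space, chilbert_space) chilbert_space ..

lemma scaleC_eq: "c *\<^sub>C (x :: 'a :: complex_inner) = Re c *\<^sub>R x + Im c *\<^sub>R (\<i> *\<^sub>C x)"
proof -
  have "c *\<^sub>C x = (of_real (Re c) + of_real (Im c) * \<i>) *\<^sub>C x"
    using complex_eq[of c] by (simp add: mult.commute)
  also have "\<dots> = Re c *\<^sub>R x + Im c *\<^sub>R (\<i> *\<^sub>C x)"
    by (simp only: scaleC_add_left scaleC_of_real flip: scaleC_scaleC)
  finally show ?thesis .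
qed

lemma norm_scaleC: "norm (c *\<^sub>C (x :: 'a :: complex_inner)) = cmod c * norm x"
proof -
  have "cinner (c *\<^sub>C x) (c *\<^sub>C x) = c * cnj c * cinner x x"
    using cinner_commute[of x "c *\<^sub>C x"] cinner_commute[of x x]
    by (simp add: cinner_scaleC_left)
  also have "\<dots> = of_real ((cmod c)\<^sup>2) * cinner x x"
    using complex_norm_square[of c] by simp
  finally have "Re (cinner (c *\<^sub>C x) (c *\<^sub>C x)) = (cmod c)\<^sup>2 * Re (cinner x x)"
    by (simp only: Re_complex_of_real Im_complex_of_real times_complex.sel)
  then show ?thesis
    by (simp add: norm_eq_sqrt_cinner[where 'a = 'a] real_sqrt_mult)
qed

lemma bounded_linear_scaleC: "bounded_linear (\<lambda>x :: 'a :: complex_inner. c *\<^sub>C x)"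
proof (rule bounded_linear_intro[where K = "cmod c"])
  show "c *\<^sub>C (r *\<^sub>R x) = r *\<^sub>R (c *\<^sub>C x)" for r and x :: 'a
    by (simp add: scaleC_scaleC mult.commute flip: scaleC_of_real)
qed (simp_all add: scaleC_add_right norm_scaleC mult.commute)


section \<open>Bounded operators\<close>

text \<open>\<open>'a \<Rightarrow>\<^sub>L 'a\<close> contains all bounded real-linear maps; the algebra of bounded operators on the
  complex space consists of the complex-linear ones. The library norm on \<open>'a \<Rightarrow>\<^sub>L 'a\<close> is the
  operator norm.\<close>

definition bounded_operators :: "('a::complex_inner \<Rightarrow>\<^sub>L 'a) set" where
  "bounded_operators = {A. \<forall>c x. blinfun_apply A (c *\<^sub>C x) = c *\<^sub>C blinfun_apply A x}"

definition adj :: "('a::chilbert_space \<Rightarrow>\<^sub>L 'a) \<Rightarrow> ('a \<Rightarrow>\<^sub>L 'a)" where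
  "adj A = (THE D. \<forall>x y. cinner (blinfun_apply A x) y = cinner x (blinfun_apply D y))"

lift_definition block_op :: "('a::complex_inner \<Rightarrow>\<^sub>L 'a) \<Rightarrow> ('a \<Rightarrow>\<^sub>L 'a) \<Rightarrow> ('a \<Rightarrow>\<^sub>L 'a) \<Rightarrow> ('a \<Rightarrow>\<^sub>L 'a)
    \<Rightarrow> (('a \<times> 'a) \<Rightarrow>\<^sub>L ('a \<times> 'a))"
  is "\<lambda>A B C D z. (A (fst z) + B (snd z), C (fst z) + D (snd z))"
  by (intro bounded_linear_Pair bounded_linear_add)
    (auto intro: bounded_linear_compose bounded_linear_fst bounded_linear_snd)

text \<open>Inserting \<open>0\<close> only matters on the zero space, which has no unit vectors: there the numerical
  radius is \<open>0\<close>.\<close>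

definition numerical_radius :: "('a::complex_inner \<Rightarrow>\<^sub>L 'a) \<Rightarrow> real" where
  "numerical_radius A = Sup (insert 0 {cmod (cinner (blinfun_apply A x) x) | x. norm x = 1})"


section \<open>Continuous functional calculus\<close>

lift_definition scalar_op :: "complex \<Rightarrow> ('a::complex_inner \<Rightarrow>\<^sub>L 'a)" is "\<lambda>c x. c *\<^sub>C x"
  by (rule bounded_linear_scaleC)

text \<open>A real-linear inverse of a complex-linear map is complex-linear, so for complex-linear \<open>A\<close>
  the inverse may be sought in \<open>'a \<Rightarrow>\<^sub>L 'a\<close>.\<close>

definition op_spectrum :: "('a::complex_inner \<Rightarrow>\<^sub>L 'a) \<Rightarrow> complex set" where
  "op_spectrum A =
    {c. \<not> (\<exists>S. S o\<^sub>L (A - scalar_op c) = id_blinfun \<and> (A - scalar_op c) o\<^sub>L S = id_blinfun)}"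

definition poly_op :: "real poly \<Rightarrow> ('a::complex_inner \<Rightarrow>\<^sub>L 'a) \<Rightarrow> ('a \<Rightarrow>\<^sub>L 'a)" where
  "poly_op r A = (\<Sum>i\<le>degree r. coeff r i *\<^sub>R (((o\<^sub>L) A ^^ i) id_blinfun))"

text \<open>For self-adjoint \<open>P\<close> and real-valued \<open>f\<close> continuous on the spectrum of \<open>P\<close>, \<open>f(P)\<close> is the
  common norm limit of \<open>r\<^sub>m(P)\<close> over all sequences of real polynomials \<open>r\<^sub>m\<close> converging to \<open>f\<close>
  uniformly on the spectrum. The values of \<open>f\<close> off the spectrum are irrelevant.\<close>

definition cfc :: "(real \<Rightarrow> real) \<Rightarrow> ('a::complex_inner \<Rightarrow>\<^sub>L 'a) \<Rightarrow> ('a \<Rightarrow>\<^sub>L 'a)" where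
  "cfc f P = (THE T. \<forall>r :: nat \<Rightarrow> real poly.
      uniform_limit {t. complex_of_real t \<in> op_spectrum P} (\<lambda>m. poly (r m)) f sequentially
      \<longrightarrow> (\<lambda>m. poly_op (r m) P) \<longlonglongrightarrow> T)"

text \<open>For positive \<open>P\<close> and \<open>s > 0\<close>; note \<open>0 powr s = 0\<close>.\<close>

definition op_powr :: "('a::complex_inner \<Rightarrow>\<^sub>L 'a) \<Rightarrow> real \<Rightarrow> ('a \<Rightarrow>\<^sub>L 'a)" where
  "op_powr P s = cfc (\<lambda>t. t powr s) P"

definition abs_op :: "('a::chilbert_space \<Rightarrow>\<^sub>L 'a) \<Rightarrow> ('a \<Rightarrow>\<^sub>L 'a)" where
  "abs_op A = op_powr (adj A o\<^sub>L A) (1/2)"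

end

theory Submission
  imports Defs "HOL-Computational_Algebra.Fundamental_Theorem_Algebra"
begin

text \<open>Put \<open>T = [[0, B], [C, 0]]\<close> and \<open>S = T\<^sup>2\<close>. Both \<open>T\<^sup>*T\<close> and \<open>S\<close> are block diagonal, so the maxima in the
  statement dominate the norms \<open>M k = \<parallel>|T|\<^sup>k\<^sup>p/p + |T\<^sup>*|\<^sup>k\<^sup>q/q\<parallel>\<close> and
  \<open>N k = \<parallel>f(|S|)\<^sup>k\<^sup>p/p + g(|S\<^sup>*|)\<^sup>k\<^sup>q/q\<parallel>\<close>. For a unit vector \<open>x\<close> let \<open>a = \<parallel>T x\<parallel> \<parallel>T\<^sup>*x\<parallel>\<close> and
  \<open>b = |\<langle>S x, x\<rangle>|\<close>. Buzano's inequality gives \<open>|\<langle>T x, x\<rangle>|\<^sup>2 \<le> (a + b)/2\<close>, and one expands \<open>(a + b)\<^sup>n\<close>.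

  Jensen's inequality gives \<open>a\<^sup>k \<le> M k\<close> and \<open>b\<^sup>k \<le> N k\<close> for \<open>k \<ge> 2\<close>, but for \<open>k = 1\<close> these may fail when
  \<open>p \<noteq> 2\<close>, since one of \<open>p/2\<close>, \<open>q/2\<close> is then below \<open>1\<close>. The failure is compensated: one has
  \<open>10 a M 1 \<le> M 2 + 9 (M 1)\<^sup>2\<close> and the same for \<open>b\<close> and \<open>N\<close>, so a defect at \<open>k = 1\<close> forces a surplus at
  \<open>k = 2\<close>. If \<open>a\<close> is much larger than \<open>N 1\<close>, then \<open>\<parallel>S\<parallel> \<le> 2 N 1\<close> is small and
  \<open>2 a \<le> \<parallel>T\<parallel>\<^sup>2 + \<parallel>S\<parallel>\<close> together with \<open>\<parallel>T\<parallel>\<^sup>4 \<le> 2 M 2\<close> yields \<open>M 2 \<ge> 2 (a - N 1)\<^sup>2\<close>, which pays for the defect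
  of \<open>b\<close>.\<close>

section \<open>Inner products and adjoints\<close>

text \<open>The compensating inequality is equivalent to M 2 - a^2 >= (a - M 1)(9 M 1 - a). Since a
  <= 2 M 1, the second factor is at least 7 M 1, so a defect d = a - M 1 > 0 earns a surplus of 7/2
  a d. Likewise e = b - N 1 > 0 earns 7 e N 1. Replacing a b by M 1 * N 1 costs at most d b + e a.
  The term d b is harmless because b = |<T x, adj T x>| <= a. The term e a is the obstacle: when a
  is far above N 1, a surplus proportional to e N 1 cannot pay for it. No argument that treats the
  two families separately can succeed there, hence the estimate linking the norms of T and of T o T.
  Surpluses live at index 2, whereas the theorem concerns every n. They are carried upward by
  tangent lines of t^(n/2), taken at a fixed scalar and applied to the operators themselves, so that
  the result speaks of the norms M 2 and M n and not of values at one vector. All operator estimates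
  come from scalar ones through \<open>cfc_mono\<close>. The calculus itself rests on a single
  bound: a real polynomial in a self-adjoint operator has norm at most its supremum on the
  spectrum.\<close>

lemma cinner_add_right: "cinner x (y + z) = cinner x y + cinner x (z :: 'a :: complex_inner)"
  by (simp only: cinner_commute[of x] cinner_add_left complex_cnj_add)

lemma cinner_scaleC_right: "cinner x (c *\<^sub>C y) = cnj c * cinner x (y :: 'a :: complex_inner)"
  by (simp only: cinner_commute[of x] cinner_scaleC_left complex_cnj_mult)

lemma cinner_scaleR_left: "cinner (r *\<^sub>R x) y = of_real r * cinner x (y :: 'a :: complex_inner)"
  by (metis cinner_scaleC_left scaleC_of_real)

lemma cinner_scaleR_right: "cinner x (r *\<^sub>R y) = of_real r * cinner x (y :: 'a :: complex_inner)"
  by (metis cinner_scaleC_right scaleC_of_real complex_cnj_complex_of_real)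

lemma cinner_zero_left [simp]: "cinner 0 (y :: 'a :: complex_inner) = 0"
  using cinner_scaleR_left[of 0 0 y] by simp

lemma cinner_zero_right [simp]: "cinner (y :: 'a :: complex_inner) 0 = 0"
  using cinner_scaleR_right[of y 0 0] by simp

lemma cinner_minus_left: "cinner (- x) y = - cinner x (y :: 'a :: complex_inner)"
  using cinner_scaleR_left[of "-1" x y] by simp

lemma cinner_minus_right: "cinner x (- y) = - cinner x (y :: 'a :: complex_inner)"
  using cinner_scaleR_right[of x "-1" y] by simp

lemma cinner_diff_left: "cinner (x - y) z = cinner x z - cinner y (z :: 'a :: complex_inner)"
  by (simp only: diff_conv_add_uminus cinner_add_left cinner_minus_left)

lemma cinner_diff_right: "cinner x (y - z) = cinner x y - cinner x (z :: 'a :: complex_inner)"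
  by (simp only: diff_conv_add_uminus cinner_add_right cinner_minus_right)

lemmas cinner_simps = cinner_add_left cinner_add_right cinner_scaleC_left cinner_scaleC_right
  cinner_scaleR_left cinner_scaleR_right cinner_minus_left cinner_minus_right
  cinner_diff_left cinner_diff_right

lemma norm_power2_cinner: "(norm (x :: 'a :: complex_inner))\<^sup>2 = Re (cinner x x)"
  by (simp add: norm_eq_sqrt_cinner[of x] cinner_self_nonneg)

lemma cinner_self: "cinner x x = complex_of_real ((norm (x :: 'a :: complex_inner))\<^sup>2)"
proof (rule complex_eqI)
  have "Im (cinner x x) = - Im (cinner x x)"
    by (subst cinner_commute) simp
  then show "Im (cinner x x) = Im (complex_of_real ((norm x)\<^sup>2))" by simp
qed (simp add: norm_power2_cinner)

lemma Re_cinner_commute: "Re (cinner x y) = Re (cinner y (x :: 'a :: complex_inner))"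
  by (subst cinner_commute) simp

lemma norm_add_power2:
  "(norm (x + y :: 'a :: complex_inner))\<^sup>2 = (norm x)\<^sup>2 + (norm y)\<^sup>2 + 2 * Re (cinner x y)"
  using Re_cinner_commute[of x y] by (simp add: norm_power2_cinner cinner_simps)

lemma norm_diff_power2:
  "(norm (x - y :: 'a :: complex_inner))\<^sup>2 = (norm x)\<^sup>2 + (norm y)\<^sup>2 - 2 * Re (cinner x y)"
  using Re_cinner_commute[of x y] by (simp add: norm_power2_cinner cinner_simps)

lemma bounded_operators_scaleC:
  "A \<in> bounded_operators \<Longrightarrow> blinfun_apply A (c *\<^sub>C x) = c *\<^sub>C blinfun_apply A x"
  by (simp add: bounded_operators_def)

lemma bounded_operators_id [simp, intro]: "id_blinfun \<in> bounded_operators"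
  by (simp add: bounded_operators_def)

lemma scaleC_scaleR_commute: "c *\<^sub>C (r *\<^sub>R x) = r *\<^sub>R (c *\<^sub>C (x :: 'a :: complex_inner))"
  by (rule linear_cmul[OF bounded_linear.linear[OF bounded_linear_scaleC]])

lemma bounded_operators_add [simp, intro]:
  "A \<in> bounded_operators \<Longrightarrow> B \<in> bounded_operators \<Longrightarrow> A + B \<in> bounded_operators"
  by (simp add: bounded_operators_def plus_blinfun.rep_eq scaleC_add_right)

lemma bounded_operators_scaleR [simp, intro]:
  "A \<in> bounded_operators \<Longrightarrow> r *\<^sub>R A \<in> bounded_operators"
  by (simp add: bounded_operators_def scaleR_blinfun.rep_eq scaleC_scaleR_commute)

lemma bounded_operators_diff [simp, intro]:
  "A \<in> bounded_operators \<Longrightarrow> B \<in> bounded_operators \<Longrightarrow> A - B \<in> bounded_operators"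
  using bounded_operators_add[OF _ bounded_operators_scaleR[of B "-1"], of A] by simp

lemma bounded_operators_compose [simp, intro]:
  "A \<in> bounded_operators \<Longrightarrow> B \<in> bounded_operators \<Longrightarrow> A o\<^sub>L B \<in> bounded_operators"
  by (simp add: bounded_operators_def)

section \<open>Self-adjoint and positive operators, Cauchy-Schwarz for positive forms\<close>

definition self_adjoint :: "('a::complex_inner \<Rightarrow>\<^sub>L 'a) \<Rightarrow> bool" where
  "self_adjoint A \<longleftrightarrow> A \<in> bounded_operators \<and> (\<forall>x y. cinner (A x) y = cinner x (A y))"

definition positive_op :: "('a::complex_inner \<Rightarrow>\<^sub>L 'a) \<Rightarrow> bool" where
  "positive_op A \<longleftrightarrow> self_adjoint A \<and> (\<forall>x. 0 \<le> Re (cinner (A x) x))"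

lemma self_adjointD: "self_adjoint A \<Longrightarrow> cinner (blinfun_apply A x) y = cinner x (blinfun_apply A y)"
  by (simp add: self_adjoint_def)

lemma self_adjoint_bounded: "self_adjoint A \<Longrightarrow> A \<in> bounded_operators"
  by (simp add: self_adjoint_def)

lemma positive_op_self_adjoint: "positive_op A \<Longrightarrow> self_adjoint A"
  by (simp add: positive_op_def)

lemma positive_opD: "positive_op A \<Longrightarrow> 0 \<le> Re (cinner (blinfun_apply A x) x)"
  by (simp add: positive_op_def)

lemma self_adjoint_id [simp]: "self_adjoint id_blinfun"
  by (simp add: self_adjoint_def)

lemma positive_op_id [simp]: "positive_op id_blinfun"
  by (simp add: positive_op_def cinner_self_nonneg)

lemma self_adjoint_add: "self_adjoint A \<Longrightarrow> self_adjoint B \<Longrightarrow> self_adjoint (A + B)"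
  by (simp add: self_adjoint_def plus_blinfun.rep_eq cinner_simps)

lemma self_adjoint_diff: "self_adjoint A \<Longrightarrow> self_adjoint B \<Longrightarrow> self_adjoint (A - B)"
  by (simp add: self_adjoint_def minus_blinfun.rep_eq cinner_simps)

lemma self_adjoint_scaleR: "self_adjoint A \<Longrightarrow> self_adjoint (r *\<^sub>R A)"
  by (simp add: self_adjoint_def scaleR_blinfun.rep_eq cinner_simps)

lemma positive_op_add: "positive_op A \<Longrightarrow> positive_op B \<Longrightarrow> positive_op (A + B)"
  by (simp add: positive_op_def self_adjoint_add plus_blinfun.rep_eq cinner_simps)

lemma positive_op_scaleR: "positive_op A \<Longrightarrow> 0 \<le> r \<Longrightarrow> positive_op (r *\<^sub>R A)"
  by (simp add: positive_op_def self_adjoint_scaleR scaleR_blinfun.rep_eq cinner_simps)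

lemma positive_op_square: "self_adjoint A \<Longrightarrow> positive_op (A o\<^sub>L A)"
proof -
  assume A: "self_adjoint A"
  then have "self_adjoint (A o\<^sub>L A)" by (simp add: self_adjoint_def)
  moreover have "cinner ((A o\<^sub>L A) x) x = cinner (A x) (A x)" for x
    by (simp add: self_adjointD[OF A])
  ultimately show ?thesis by (simp add: positive_op_def cinner_self_nonneg)
qed

lemma positive_op_Cauchy_Schwarz:
  assumes "positive_op A"
  shows "(cmod (cinner (blinfun_apply A x) y))\<^sup>2 \<le> Re (cinner (A x) x) * Re (cinner (A y) y)"
proof -
  define a b c where "a = Re (cinner (A x) x)" and "b = Re (cinner (A y) y)"
    and "c = cinner (A x) y"
  have sa: "self_adjoint A" using assms by (rule positive_op_self_adjoint)
  have yx: "cinner (A y) x = cnj c"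
    unfolding c_def by (subst cinner_commute) (simp add: self_adjointD[OF sa])
  have expand: "0 \<le> a + 2 * Re (cnj s * c) + (cmod s)\<^sup>2 * b" for s
  proof -
    have "A (x + s *\<^sub>C y) = A x + s *\<^sub>C A y"
      using sa by (simp add: blinfun.add_right bounded_operators_scaleC self_adjoint_bounded)
    then have "cinner (A (x + s *\<^sub>C y)) (x + s *\<^sub>C y)
        = cinner (A x) x + cnj s * c + s * cnj c + (s * cnj s) * cinner (A y) y"
      by (simp add: cinner_simps yx c_def[symmetric] algebra_simps)
    also have "Re \<dots> = a + 2 * Re (cnj s * c) + (cmod s)\<^sup>2 * b"
      by (simp add: a_def b_def complex_norm_square[symmetric] del: of_real_power)
    finally show ?thesis using positive_opD[OF assms, of "x + s *\<^sub>C y"] by simp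
  qed
  have b0: "0 \<le> b" unfolding b_def by (rule positive_opD[OF assms])
  have cc: "Re (cnj c * c) = (cmod c)\<^sup>2"
    by (simp only: mult.commute[of "cnj c"] complex_norm_square[symmetric] Re_complex_of_real)
  have "(cmod c)\<^sup>2 \<le> a * b"
  proof (cases "b = 0")
    case True
    \<comment> \<open>With b = 0 the quadratic in \<open>expand\<close> is affine along s = - t c
      and bounded below for every real t, which forces c = 0. For b > 0 the minimiser s = - c / b is
      inserted instead.\<close>
    have *: "2 * t * (cmod c)\<^sup>2 \<le> a" for t :: real
    proof -
      have "Re (cnj (- of_real t * c) * c) = - t * (cmod c)\<^sup>2"
        unfolding cc[symmetric] by (simp add: algebra_simps)
      with expand[of "- of_real t * c"] True show ?thesis by simp
    qed
    have "(cmod c)\<^sup>2 \<le> 0"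
    proof (rule ccontr)
      assume "\<not> (cmod c)\<^sup>2 \<le> 0"
      then show False using *[of "(a + 1) / (2 * (cmod c)\<^sup>2)"] by (simp add: field_simps)
    qed
    then show ?thesis using True by simp
  next
    case False
    then have "0 < b" using b0 by simp
    have "Re (cnj (- c / of_real b) * c) = - (cmod c)\<^sup>2 / b"
      using cc by (simp add: Re_divide_of_real)
    moreover have "(cmod (- c / of_real b))\<^sup>2 * b = (cmod c)\<^sup>2 / b"
      using \<open>0 < b\<close> by (simp add: norm_divide power2_eq_square)
    ultimately have "0 \<le> a + 2 * (- (cmod c)\<^sup>2 / b) + (cmod c)\<^sup>2 / b"
      using expand[of "- c / of_real b"] by (simp only:)
    then have "0 \<le> a - (cmod c)\<^sup>2 / b" by simp
    then show ?thesis using \<open>0 < b\<close> by (simp add: field_simps)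
  qed
  then show ?thesis by (simp add: a_def b_def c_def)
qed

lemma cinner_Cauchy_Schwarz: "cmod (cinner x y) \<le> norm x * norm (y :: 'a :: complex_inner)"
proof -
  have "(cmod (cinner x y))\<^sup>2 \<le> (norm x * norm y)\<^sup>2"
    using positive_op_Cauchy_Schwarz[OF positive_op_id, of x y]
    by (simp add: power_mult_distrib norm_power2_cinner)
  then show ?thesis by (rule power2_le_imp_le) simp
qed

lemma Re_cinner_le: "Re (cinner x y) \<le> norm x * norm (y :: 'a :: complex_inner)"
  using cinner_Cauchy_Schwarz[of x y] complex_Re_le_cmod[of "cinner x y"] by simp

lemma bounded_bilinear_cinner:
  "bounded_bilinear (cinner :: 'a::complex_inner \<Rightarrow> 'a \<Rightarrow> complex)"
proof
  show "\<exists>K. \<forall>a b :: 'a. norm (cinner a b) \<le> norm a * norm b * K"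
    by (rule exI[of _ 1]) (simp add: cinner_Cauchy_Schwarz)
qed (simp_all add: cinner_simps scaleR_conv_of_real)

text \<open>Cauchy-Schwarz for the form of A with second vector A x, one factor of norm (A x)
  squared being cancelled. For 0 <= A <= 1 it gives A^2 <= A; this form, sharper than a norm bound,
  is what controls the defect operator Z later.\<close>

lemma positive_op_norm_apply:
  assumes A: "positive_op A" and c: "\<And>y. Re (cinner (blinfun_apply A y) y) \<le> c * (norm y)\<^sup>2"
  shows "(norm (A x))\<^sup>2 \<le> c * Re (cinner (A x) x)"
proof (cases "A x = 0")
  case False
  have "((norm (A x))\<^sup>2)\<^sup>2 = (cmod (cinner (A x) (A x)))\<^sup>2"
    by (simp only: cinner_self norm_of_real abs_power2)
  also have "\<dots> \<le> Re (cinner (A x) x) * Re (cinner (A (A x)) (A x))"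
    by (rule positive_op_Cauchy_Schwarz[OF A])
  also have "\<dots> \<le> Re (cinner (A x) x) * (c * (norm (A x))\<^sup>2)"
    by (intro mult_left_mono c positive_opD[OF A])
  finally show ?thesis using False by (simp add: power2_eq_square mult.commute)
qed simp

lemma positive_op_norm_le:
  assumes A: "positive_op A" and "0 \<le> c"
    and c: "\<And>y. Re (cinner (blinfun_apply A y) y) \<le> c * (norm y)\<^sup>2"
  shows "norm A \<le> c"
proof (rule norm_blinfun_bound)
  fix x
  have "(norm (A x))\<^sup>2 \<le> c * Re (cinner (A x) x)" by (rule positive_op_norm_apply[OF A c])
  also have "\<dots> \<le> c * (c * (norm x)\<^sup>2)" by (intro mult_left_mono c \<open>0 \<le> c\<close>)
  also have "\<dots> = (c * norm x)\<^sup>2" by (simp add: power2_eq_square)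
  finally show "norm (A x) \<le> c * norm x" by (rule power2_le_imp_le) (simp add: \<open>0 \<le> c\<close>)
qed fact

lemma Re_cinner_blinfun_le: "Re (cinner (blinfun_apply A x) x) \<le> norm A * (norm x)\<^sup>2"
proof -
  have "Re (cinner (A x) x) \<le> norm (A x) * norm x" by (rule Re_cinner_le)
  also have "\<dots> \<le> norm A * norm x * norm x" by (intro mult_right_mono norm_blinfun) simp
  finally show ?thesis by (simp add: power2_eq_square mult.assoc)
qed

lemma cinner_extensionality: "(\<And>x. cinner x y = cinner x (z :: 'a :: complex_inner)) \<Longrightarrow> y = z"
proof -
  assume *: "\<And>x. cinner x y = cinner x z"
  have "cinner (y - z) (y - z) = 0" using *[of "y - z"] by (simp add: cinner_diff_right)
  then show "y = z" by (simp add: cinner_self)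
qed

text \<open>Variational proof: J is bounded below, the parallelogram law makes a minimising sequence
  Cauchy, and perturbing the minimiser z along a real multiple of v shows that z represents the real
  part of the functional. Replacing v by i v recovers the imaginary part.\<close>

lemma Riesz_representation:
  fixes \<phi> :: "'a::chilbert_space \<Rightarrow> complex"
  assumes add: "\<And>x y. \<phi> (x + y) = \<phi> x + \<phi> y" and scale: "\<And>c x. \<phi> (c *\<^sub>C x) = c * \<phi> x"
    and bound: "\<And>x. cmod (\<phi> x) \<le> K * norm x"
  shows "\<exists>z. \<forall>x. \<phi> x = cinner x z"
proof -
  define J where "J x = (norm x)\<^sup>2 - 2 * Re (\<phi> x)" for x
  have scaleR: "\<phi> (r *\<^sub>R x) = of_real r * \<phi> x" for r x
    by (metis scale scaleC_of_real)
  have lin: "bounded_linear \<phi>"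
    by (rule bounded_linear_intro[where K = K])
      (simp_all add: add scaleR scaleR_conv_of_real bound mult.commute)
  have lower: "- (K\<^sup>2) \<le> J x" for x
  proof -
    have "Re (\<phi> x) \<le> K * norm x" using bound[of x] complex_Re_le_cmod[of "\<phi> x"] by simp
    moreover have "0 \<le> (norm x - K)\<^sup>2" by simp
    ultimately show ?thesis by (simp add: J_def power2_diff algebra_simps)
  qed
  then have bdd: "bdd_below (range J)" by (rule bdd_belowI2)
  define I where "I = Inf (range J)"
  have I_le: "I \<le> J x" for x unfolding I_def by (rule cInf_lower[OF _ bdd]) simp
  have "\<exists>x. J x < I + inverse (real (Suc n))" for n
  proof -
    have "\<exists>y \<in> range J. y < I + inverse (real (Suc n))"
      by (rule cInf_lessD) (simp_all add: I_def[symmetric])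
    then show ?thesis by auto
  qed
  then obtain X where X: "\<And>n. J (X n) < I + inverse (real (Suc n))" by metis
  have half: "J ((1/2) *\<^sub>R u) = (norm u)\<^sup>2 / 4 - Re (\<phi> u)" for u
    by (simp add: J_def scaleR power_divide)
  have para: "(norm (x - y))\<^sup>2 = 2 * J x + 2 * J y - 4 * J ((1/2) *\<^sub>R (x + y))" for x y
    using norm_add_power2[of x y] norm_diff_power2[of x y]
    unfolding half by (simp add: J_def add field_simps)
  have dist_le: "(norm (X m - X n))\<^sup>2 \<le> 4 * inverse (real (Suc N))" if "N \<le> m" "N \<le> n" for m n N
  proof -
    have "inverse (real (Suc m)) \<le> inverse (real (Suc N))"
      "inverse (real (Suc n)) \<le> inverse (real (Suc N))"
      using that by (auto intro!: le_imp_inverse_le)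
    then show ?thesis
      using para[of "X m" "X n"] I_le[of "(1/2) *\<^sub>R (X m + X n)"] X[of m] X[of n] by linarith
  qed
  have "Cauchy X"
  proof (rule metric_CauchyI)
    fix e :: real assume e: "0 < e"
    then obtain N where N: "inverse (real (Suc N)) < e\<^sup>2 / 4"
      using reals_Archimedean[of "e\<^sup>2 / 4"] by auto
    have "dist (X m) (X n) < e" if "N \<le> m" "N \<le> n" for m n
    proof -
      have "(norm (X m - X n))\<^sup>2 < e\<^sup>2" using dist_le[OF that] N by simp
      then show ?thesis using e by (simp add: dist_norm power_less_imp_less_base)
    qed
    then show "\<exists>M. \<forall>m\<ge>M. \<forall>n\<ge>M. dist (X m) (X n) < e" by blast
  qed
  then obtain z where z: "X \<longlonglongrightarrow> z" using Cauchy_convergent convergent_def by blast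
  have "(\<lambda>n. J (X n)) \<longlonglongrightarrow> J z"
    unfolding J_def by (intro tendsto_intros z bounded_linear.tendsto[OF lin])
  moreover have "(\<lambda>n. I + inverse (real (Suc n))) \<longlonglongrightarrow> I + 0"
    by (intro tendsto_intros LIMSEQ_inverse_real_of_nat)
  ultimately have "J z \<le> I + 0"
    by (rule LIMSEQ_le) (use X in \<open>auto intro!: exI[of _ 0] less_imp_le\<close>)
  then have min: "J z \<le> J x" for x using I_le[of x] by simp
  have re: "Re (\<phi> v) = Re (cinner v z)" for v
  proof (rule ccontr)
    assume ne: "Re (\<phi> v) \<noteq> Re (cinner v z)"
    define d where "d = Re (\<phi> v) - Re (cinner v z)"
    have ineq: "0 \<le> t\<^sup>2 * (norm v)\<^sup>2 - 2 * t * d" for t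
    proof -
      have "J (z + t *\<^sub>R v) = J z + t\<^sup>2 * (norm v)\<^sup>2 - 2 * t * d"
        by (simp add: J_def d_def norm_add_power2 add scaleR cinner_simps power_mult_distrib
            Re_cinner_commute[of z v] algebra_simps)
      then show ?thesis using min[of "z + t *\<^sub>R v"] by linarith
    qed
    show False
    proof (cases "v = 0")
      case True
      then show False using ne scaleR[of 0 0] by simp
    next
      case False
      have "0 \<le> (d / (norm v)\<^sup>2)\<^sup>2 * (norm v)\<^sup>2 - 2 * (d / (norm v)\<^sup>2) * d" by (rule ineq)
      also have "\<dots> = - (d\<^sup>2 / (norm v)\<^sup>2)" using False by (simp add: field_simps power2_eq_square)
      finally show False using False ne by (simp add: d_def divide_le_0_iff)
    qed
  qed
  have "\<phi> v = cinner v z" for v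
  proof (rule complex_eqI)
    show "Im (\<phi> v) = Im (cinner v z)" using re[of "\<i> *\<^sub>C v"] by (simp add: scale cinner_simps)
  qed (rule re)
  then show ?thesis by blast
qed

section \<open>Existence and basic properties of the adjoint\<close>

lemma adj_exists:
  fixes A :: "'a::chilbert_space \<Rightarrow>\<^sub>L 'a"
  assumes A: "A \<in> bounded_operators"
  shows "\<exists>D :: 'a \<Rightarrow>\<^sub>L 'a. \<forall>x y. cinner (A x) y = cinner x (D y)"
proof -
  have "\<exists>z. \<forall>x. cinner (A x) y = cinner x z" for y
  proof (rule Riesz_representation)
    show "cmod (cinner (A x) y) \<le> (norm A * norm y) * norm x" for x
    proof -
      have "cmod (cinner (A x) y) \<le> norm (A x) * norm y" by (rule cinner_Cauchy_Schwarz)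
      also have "\<dots> \<le> norm A * norm x * norm y" by (intro mult_right_mono norm_blinfun) simp
      finally show ?thesis by (simp add: mult_ac)
    qed
  qed (simp_all add: A bounded_operators_scaleC blinfun.add_right cinner_simps)
  then obtain D where D: "\<And>x y. cinner (A x) y = cinner x (D y)" by metis
  have "bounded_linear D"
  proof (rule bounded_linear_intro[where K = "norm A"])
    show "D (x + y) = D x + D y" for x y
      by (rule cinner_extensionality) (simp add: cinner_simps flip: D)
    show "D (r *\<^sub>R x) = r *\<^sub>R D x" for r x
      by (rule cinner_extensionality) (simp add: cinner_simps flip: D)
    show "norm (D y) \<le> norm y * norm A" for y
    proof (cases "D y = 0")
      case False
      have "(norm (D y))\<^sup>2 = Re (cinner (A (D y)) y)" by (simp add: D norm_power2_cinner)
      also have "\<dots> \<le> norm (A (D y)) * norm y" by (rule Re_cinner_le)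
      also have "\<dots> \<le> norm A * norm (D y) * norm y" by (intro mult_right_mono norm_blinfun) simp
      finally show ?thesis using False by (simp add: power2_eq_square mult_ac)
    qed simp
  qed
  then show ?thesis
    by (intro exI[of _ "Blinfun D"]) (simp add: bounded_linear_Blinfun_apply D)
qed

lemma adj_eqI:
  fixes A D :: "'a::chilbert_space \<Rightarrow>\<^sub>L 'a"
  assumes "\<And>x y. cinner (A x) y = cinner x (D y)"
  shows "adj A = D"
  unfolding adj_def
proof (rule the_equality)
  show "\<forall>x y. cinner (A x) y = cinner x (D y)" using assms by blast
next
  fix D' :: "'a \<Rightarrow>\<^sub>L 'a"
  assume "\<forall>x y. cinner (A x) y = cinner x (D' y)"
  with assms have "\<And>x y. cinner x (D' y) = cinner x (D y)" by metis
  then show "D' = D" by (simp add: blinfun_eqI cinner_extensionality)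
qed

lemma cinner_adj_right:
  fixes A :: "'a::chilbert_space \<Rightarrow>\<^sub>L 'a"
  assumes "A \<in> bounded_operators"
  shows "cinner x (adj A y) = cinner (A x) y"
proof -
  obtain D :: "'a \<Rightarrow>\<^sub>L 'a" where D: "\<And>x y. cinner (A x) y = cinner x (D y)"
    using adj_exists[OF assms] by blast
  then have "adj A = D" by (rule adj_eqI)
  then show ?thesis by (simp add: D)
qed

lemma cinner_adj_left:
  fixes A :: "'a::chilbert_space \<Rightarrow>\<^sub>L 'a"
  assumes "A \<in> bounded_operators"
  shows "cinner (adj A y) x = cinner y (A x)"
  by (subst (1 2) cinner_commute) (simp add: cinner_adj_right[OF assms])

lemma adj_bounded_operators [simp, intro]:
  "A \<in> bounded_operators \<Longrightarrow> adj A \<in> bounded_operators"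
proof -
  assume A: "A \<in> bounded_operators"
  have "adj A (c *\<^sub>C y) = c *\<^sub>C adj A y" for c y
    by (rule cinner_extensionality) (simp add: cinner_adj_right[OF A] cinner_scaleC_right)
  then show ?thesis by (simp add: bounded_operators_def)
qed

lemma adj_adj: "A \<in> bounded_operators \<Longrightarrow> adj (adj A) = A"
  by (rule adj_eqI) (simp add: cinner_adj_left[of A])

lemma positive_op_adj_compose:
  "A \<in> bounded_operators \<Longrightarrow> positive_op (adj A o\<^sub>L A)"
  by (auto simp: positive_op_def self_adjoint_def cinner_adj_left[of A] cinner_adj_right[of A]
      cinner_self_nonneg)

lemma positive_op_compose_adj:
  "A \<in> bounded_operators \<Longrightarrow> positive_op (A o\<^sub>L adj A)"
  using positive_op_adj_compose[of "adj A"] by (simp add: adj_adj)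

lemma Re_cinner_adj_compose:
  "A \<in> bounded_operators \<Longrightarrow> Re (cinner (blinfun_apply (adj A o\<^sub>L A) x) x) = (norm (A x))\<^sup>2"
  by (simp add: cinner_adj_left[of A] norm_power2_cinner)

lemma norm_adj_le:
  assumes A: "A \<in> bounded_operators"
  shows "norm (adj A) \<le> norm A"
proof (rule norm_blinfun_bound)
  fix y
  show "norm (adj A y) \<le> norm A * norm y"
  proof (cases "adj A y = 0")
    case False
    have "(norm (adj A y))\<^sup>2 = Re (cinner (A (adj A y)) y)"
      by (simp add: norm_power2_cinner cinner_adj_right[OF A])
    also have "\<dots> \<le> norm (A (adj A y)) * norm y" by (rule Re_cinner_le)
    also have "\<dots> \<le> norm A * norm (adj A y) * norm y" by (intro mult_right_mono norm_blinfun) simp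
    finally show ?thesis using False by (simp add: power2_eq_square mult_ac)
  qed simp
qed simp

section \<open>Polynomials of operators and their norms\<close>

lemmas compose_add_left = bounded_bilinear.add_left[OF bounded_bilinear_blinfun_compose]
lemmas compose_add_right = bounded_bilinear.add_right[OF bounded_bilinear_blinfun_compose]
lemmas compose_diff_left = bounded_bilinear.diff_left[OF bounded_bilinear_blinfun_compose]
lemmas compose_diff_right = bounded_bilinear.diff_right[OF bounded_bilinear_blinfun_compose]
lemmas compose_scaleR_left = bounded_bilinear.scaleR_left[OF bounded_bilinear_blinfun_compose]
lemmas compose_scaleR_right = bounded_bilinear.scaleR_right[OF bounded_bilinear_blinfun_compose]
lemmas compose_zero_left = bounded_bilinear.zero_left[OF bounded_bilinear_blinfun_compose]
lemmas compose_zero_right = bounded_bilinear.zero_right[OF bounded_bilinear_blinfun_compose]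
lemmas compose_simps = compose_add_left compose_add_right compose_diff_left compose_diff_right
  compose_scaleR_left compose_scaleR_right compose_zero_left compose_zero_right

lemma compose_id_left [simp]: "id_blinfun o\<^sub>L A = A"
  by (rule blinfun_eqI) simp

lemma compose_id_right [simp]: "A o\<^sub>L id_blinfun = A"
  by (rule blinfun_eqI) simp

lemma compose_assoc: "(A o\<^sub>L B) o\<^sub>L C = A o\<^sub>L (B o\<^sub>L C)"
  by (rule blinfun_eqI) simp

lemma poly_op_0 [simp]: "poly_op 0 A = 0"
  by (simp add: poly_op_def)

lemma poly_op_pCons [simp]: "poly_op (pCons a r) A = a *\<^sub>R id_blinfun + (A o\<^sub>L poly_op r A)"
proof (cases "r = 0")
  case True
  then show ?thesis by (simp add: poly_op_def compose_simps)
next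
  case False
  have "poly_op (pCons a r) A
      = a *\<^sub>R id_blinfun + (\<Sum>i\<le>degree r. coeff r i *\<^sub>R (A o\<^sub>L (((o\<^sub>L) A ^^ i) id_blinfun)))"
    using False by (simp add: poly_op_def sum.atMost_Suc_shift del: sum.atMost_Suc)
  also have "(\<Sum>i\<le>degree r. coeff r i *\<^sub>R (A o\<^sub>L (((o\<^sub>L) A ^^ i) id_blinfun))) = A o\<^sub>L poly_op r A"
    unfolding poly_op_def bounded_bilinear.sum_right[OF bounded_bilinear_blinfun_compose]
    by (simp add: compose_simps)
  finally show ?thesis .
qed

lemma poly_op_add: "poly_op (r + s) A = poly_op r A + poly_op s A"
  by (induction r s rule: poly_induct2) (simp_all add: compose_simps scaleR_left_distrib)

lemma poly_op_smult: "poly_op (smult c r) A = c *\<^sub>R poly_op r A"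
  by (induction r) (simp_all add: compose_simps scaleR_right_distrib)

lemma poly_op_diff: "poly_op (r - s) A = poly_op r A - poly_op s A"
  using poly_op_add[of r "- s" A] poly_op_smult[of "-1" s A] by simp

lemma poly_op_mult: "poly_op (r * s) A = poly_op r A o\<^sub>L poly_op s A"
  by (induction r) (simp_all add: poly_op_add poly_op_smult compose_simps compose_assoc)

lemma poly_op_commute: "A o\<^sub>L poly_op r A = poly_op r A o\<^sub>L A"
  using poly_op_mult[of "[:0, 1:]" r A] poly_op_mult[of r "[:0, 1:]" A]
  by (simp add: mult.commute compose_simps)

lemma intertwine_poly_op:
  assumes "S o\<^sub>L A = B o\<^sub>L S"
  shows "S o\<^sub>L poly_op r A = poly_op r B o\<^sub>L S"
proof (induction r)
  case (pCons a r)
  have "S o\<^sub>L (A o\<^sub>L poly_op r A) = B o\<^sub>L (S o\<^sub>L poly_op r A)"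
    by (simp add: assms flip: compose_assoc)
  then show ?case by (simp add: compose_simps pCons.IH compose_assoc)
qed (simp add: compose_simps)

lemma poly_op_bounded_operators: "A \<in> bounded_operators \<Longrightarrow> poly_op r A \<in> bounded_operators"
proof (induction r)
  case 0
  show ?case using bounded_operators_scaleR[OF bounded_operators_id, of 0] by simp
qed simp

lemma self_adjoint_poly_op: "self_adjoint A \<Longrightarrow> self_adjoint (poly_op r A)"
proof (induction r)
  case 0
  show ?case using self_adjoint_scaleR[OF self_adjoint_id, of 0] by simp
next
  case (pCons a r)
  have "self_adjoint (A o\<^sub>L poly_op r A)"
    unfolding self_adjoint_def
  proof (intro conjI allI)
    show "A o\<^sub>L poly_op r A \<in> bounded_operators"
      using pCons by (simp add: self_adjoint_bounded poly_op_bounded_operators)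
    show "cinner ((A o\<^sub>L poly_op r A) x) y = cinner x ((A o\<^sub>L poly_op r A) y)" for x y
      by (subst (2) poly_op_commute) (use pCons in \<open>simp add: self_adjointD\<close>)
  qed
  then show ?case using self_adjoint_add[OF self_adjoint_scaleR[OF self_adjoint_id]] by simp
qed

section \<open>Invertibility, real spectrum, and the norm of a polynomial in an operator\<close>

definition invertible_op :: "('a::complex_inner \<Rightarrow>\<^sub>L 'a) \<Rightarrow> bool" where
  "invertible_op A \<longleftrightarrow> (\<exists>S. S o\<^sub>L A = id_blinfun \<and> A o\<^sub>L S = id_blinfun)"

definition real_spectrum :: "('a::complex_inner \<Rightarrow>\<^sub>L 'a) \<Rightarrow> real set" where
  "real_spectrum A = {t. complex_of_real t \<in> op_spectrum A}"

lemma scalar_op_of_real: "scalar_op (complex_of_real t) = t *\<^sub>R id_blinfun"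
  by (rule blinfun_eqI) (simp add: scalar_op.rep_eq scaleC_of_real scaleR_blinfun.rep_eq)

lemma real_spectrum_iff: "t \<in> real_spectrum A \<longleftrightarrow> \<not> invertible_op (A - t *\<^sub>R id_blinfun)"
  by (simp add: real_spectrum_def op_spectrum_def invertible_op_def scalar_op_of_real)

lemma invertible_op_compose:
  assumes "invertible_op A" "invertible_op B"
  shows "invertible_op (A o\<^sub>L B)"
proof -
  obtain S T where S: "S o\<^sub>L A = id_blinfun" "A o\<^sub>L S = id_blinfun"
    and T: "T o\<^sub>L B = id_blinfun" "B o\<^sub>L T = id_blinfun"
    using assms by (auto simp: invertible_op_def)
  have "(T o\<^sub>L S) o\<^sub>L (A o\<^sub>L B) = T o\<^sub>L ((S o\<^sub>L A) o\<^sub>L B)" by (simp only: compose_assoc)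
  moreover have "(A o\<^sub>L B) o\<^sub>L (T o\<^sub>L S) = A o\<^sub>L ((B o\<^sub>L T) o\<^sub>L S)" by (simp only: compose_assoc)
  ultimately show ?thesis unfolding invertible_op_def using S T by (metis compose_id_left)
qed

lemma invertible_op_scaleR:
  assumes "invertible_op A" "c \<noteq> 0"
  shows "invertible_op (c *\<^sub>R A)"
proof -
  obtain S where "S o\<^sub>L A = id_blinfun" "A o\<^sub>L S = id_blinfun"
    using assms by (auto simp: invertible_op_def)
  then show ?thesis unfolding invertible_op_def
    by (intro exI[of _ "inverse c *\<^sub>R S"]) (simp add: compose_simps assms(2))
qed

text \<open>In place of summing the Neumann series, x = y + Z x is solved by Banach's fixed point
  theorem. Uniqueness of the fixed point makes the solution map linear, and the triangle inequality
  makes it bounded.\<close>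

lemma invertible_op_id_diff:
  fixes Z :: "'a::chilbert_space \<Rightarrow>\<^sub>L 'a"
  assumes Z: "norm Z < 1"
  shows "invertible_op (id_blinfun - Z)"
proof -
  have ex1: "\<exists>!x. y + Z x = x" for y
  proof (rule banach_fix_type[where c = "norm Z"])
    show "\<forall>u v. dist (y + Z u) (y + Z v) \<le> norm Z * dist u v"
      using norm_blinfun[of Z] by (simp add: dist_norm flip: blinfun.diff_right)
  qed (simp_all add: Z)
  define S where "S y = (THE x. y + Z x = x)" for y
  have S: "y + Z (S y) = S y" for y unfolding S_def by (rule theI'[OF ex1])
  have S_eq: "y + Z x = x \<Longrightarrow> S y = x" for x y using ex1[of y] S[of y] by blast
  have "bounded_linear S"
  proof (rule bounded_linear_intro[where K = "1 / (1 - norm Z)"])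
    show "S (x + y) = S x + S y" for x y
    proof (rule S_eq)
      have "x + y + Z (S x + S y) = (x + Z (S x)) + (y + Z (S y))"
        by (simp add: blinfun.add_right add_ac)
      then show "x + y + Z (S x + S y) = S x + S y" by (simp only: S)
    qed
    show "S (r *\<^sub>R x) = r *\<^sub>R S x" for r x
      by (rule S_eq) (simp add: blinfun.scaleR_right S flip: scaleR_right_distrib)
    show "norm (S y) \<le> norm y * (1 / (1 - norm Z))" for y
    proof -
      have "norm (S y) \<le> norm y + norm (Z (S y))" by (metis S norm_triangle_ineq)
      also have "\<dots> \<le> norm y + norm Z * norm (S y)" by (intro add_left_mono norm_blinfun)
      finally show ?thesis using Z by (simp add: field_simps)
    qed
  qed
  note B = bounded_linear_Blinfun_apply[OF this]
  have "S (x - Z x) = x" for x by (rule S_eq) simp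
  moreover have "S x - Z (S x) = x" for x using S[of x] by (metis add_diff_cancel_right')
  ultimately show ?thesis unfolding invertible_op_def
    by (intro exI[of _ "Blinfun S"]) (auto intro!: blinfun_eqI simp: B minus_blinfun.rep_eq)
qed

text \<open>Rescaling by M = norm B + c puts Z = 1 - B / M between 0 and 1 - c / M, so norm Z < 1
  and B = M (1 - Z) is invertible.\<close>

lemma invertible_op_bounded_below:
  fixes B :: "'a::chilbert_space \<Rightarrow>\<^sub>L 'a"
  assumes B: "self_adjoint B" and c: "0 < c"
    and below: "\<And>x. c * (norm x)\<^sup>2 \<le> Re (cinner (B x) x)"
  shows "invertible_op B"
proof -
  define M where "M = norm B + c"
  have M: "0 < M" using c by (simp add: M_def add_nonneg_pos)
  define Z where "Z = id_blinfun - (1 / M) *\<^sub>R B"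
  have quad: "Re (cinner (Z x) x) = (norm x)\<^sup>2 - Re (cinner (B x) x) / M" for x
    by (simp add: Z_def minus_blinfun.rep_eq scaleR_blinfun.rep_eq cinner_simps cinner_self)
  have "Re (cinner (B x) x) \<le> M * (norm x)\<^sup>2" for x
  proof -
    have "Re (cinner (B x) x) \<le> norm B * (norm x)\<^sup>2" by (rule Re_cinner_blinfun_le)
    also have "\<dots> \<le> M * (norm x)\<^sup>2" using c by (intro mult_right_mono) (auto simp: M_def)
    finally show ?thesis .
  qed
  then have "0 \<le> Re (cinner (Z x) x)" for x
    using M by (simp add: quad field_simps)
  moreover have "self_adjoint Z"
    unfolding Z_def by (intro self_adjoint_diff self_adjoint_scaleR self_adjoint_id B)
  ultimately have "positive_op Z" by (simp add: positive_op_def)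
  moreover have "Re (cinner (Z x) x) \<le> (1 - c / M) * (norm x)\<^sup>2" for x
    using below[of x] M by (simp add: quad field_simps)
  moreover have "0 \<le> 1 - c / M" using c M by (simp add: M_def field_simps)
  ultimately have "norm Z \<le> 1 - c / M" by (intro positive_op_norm_le)
  then have "norm Z < 1" using c M by (smt (verit) divide_pos_pos)
  then have "invertible_op (M *\<^sub>R (id_blinfun - Z))"
    using M by (intro invertible_op_scaleR invertible_op_id_diff) auto
  then show ?thesis using M by (simp add: Z_def)
qed

text \<open>Put L = norm S. Expanding norm (Q x)^2 bounds it by L^2 (L^2 norm x^2 - norm (S x)^2),
  so a left inverse of Q keeps norm (S x)^2 below L^2 norm x^2 by a uniform proportion. Then S would
  have norm less than L. No approximate eigenvectors have to be chosen.\<close>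

lemma norm_self_adjoint_not_invertible:
  assumes S: "self_adjoint S" and nontrivial: "(v :: 'a::complex_inner) \<noteq> 0"
  shows "\<not> invertible_op ((S o\<^sub>L S) - (norm S)\<^sup>2 *\<^sub>R id_blinfun :: 'a \<Rightarrow>\<^sub>L 'a)"
proof
  define L where "L = norm S"
  define Q where "Q = (S o\<^sub>L S) - L\<^sup>2 *\<^sub>R id_blinfun"
  assume "invertible_op ((S o\<^sub>L S) - (norm S)\<^sup>2 *\<^sub>R id_blinfun)"
  then obtain V where V: "V o\<^sub>L Q = id_blinfun" by (auto simp: invertible_op_def Q_def L_def)
  define K where "K = (norm V)\<^sup>2 * L\<^sup>2"
  have below: "(norm x)\<^sup>2 \<le> K * (L\<^sup>2 * (norm x)\<^sup>2 - (norm (S x))\<^sup>2)" for x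
  proof -
    have "cinner (S (S x)) x = cinner (S x) (S x)" by (simp add: self_adjointD[OF S])
    then have "(norm (Q x))\<^sup>2 = (norm (S (S x)))\<^sup>2 + L ^ 4 * (norm x)\<^sup>2 - 2 * L\<^sup>2 * (norm (S x))\<^sup>2"
      by (simp add: Q_def minus_blinfun.rep_eq scaleR_blinfun.rep_eq norm_diff_power2
          cinner_simps norm_power2_cinner[of "S x"] power_mult_distrib flip: power_mult)
    moreover have "(norm (S (S x)))\<^sup>2 \<le> (L * norm (S x))\<^sup>2"
      unfolding L_def by (intro power_mono norm_blinfun) simp
    ultimately have Q: "(norm (Q x))\<^sup>2 \<le> L\<^sup>2 * (L\<^sup>2 * (norm x)\<^sup>2 - (norm (S x))\<^sup>2)"
      by (simp add: power_mult_distrib algebra_simps power4_eq_xxxx power2_eq_square)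
    have "x = V (Q x)" by (metis V blinfun_apply_blinfun_compose id_blinfun.rep_eq id_apply)
    then have "norm x \<le> norm V * norm (Q x)" by (metis norm_blinfun)
    then have "(norm x)\<^sup>2 \<le> (norm V)\<^sup>2 * (norm (Q x))\<^sup>2"
      by (metis norm_ge_zero power_mono power_mult_distrib)
    also have "\<dots> \<le> (norm V)\<^sup>2 * (L\<^sup>2 * (L\<^sup>2 * (norm x)\<^sup>2 - (norm (S x))\<^sup>2))"
      by (intro mult_left_mono Q) simp
    finally show ?thesis by (simp add: K_def mult.assoc)
  qed
  have "0 < (norm v)\<^sup>2" using nontrivial by simp
  with below[of v] have "K \<noteq> 0" by auto
  then have K: "0 < K" by (simp add: K_def less_le)
  have upper: "(norm (S x))\<^sup>2 \<le> (L\<^sup>2 - 1 / K) * (norm x)\<^sup>2" for x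
    using below[of x] K by (simp add: field_simps)
  have "0 \<le> L\<^sup>2 - 1 / K"
    using upper[of v] \<open>0 < (norm v)\<^sup>2\<close> by (metis order_trans zero_le_mult_iff zero_le_power2 not_le)
  then have "norm S \<le> sqrt (L\<^sup>2 - 1 / K)"
  proof (intro norm_blinfun_bound)
    fix x
    have "norm (S x) = sqrt ((norm (S x))\<^sup>2)" by simp
    also have "\<dots> \<le> sqrt ((L\<^sup>2 - 1 / K) * (norm x)\<^sup>2)" by (intro real_sqrt_le_mono upper)
    finally show "norm (S x) \<le> sqrt (L\<^sup>2 - 1 / K) * norm x" by (simp add: real_sqrt_mult)
  qed simp
  also have "\<dots> < sqrt (L\<^sup>2)" using K by (intro real_sqrt_less_mono) simp
  finally show False by (simp add: L_def)
qed

lemma poly_of_real_add: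
  "poly (map_poly complex_of_real (p + q)) z
    = poly (map_poly complex_of_real p) z + poly (map_poly complex_of_real q) z"
  by (induction p q rule: poly_induct2) (simp_all add: map_poly_pCons algebra_simps)

lemma poly_of_real_smult:
  "poly (map_poly complex_of_real (smult c p)) z = of_real c * poly (map_poly complex_of_real p) z"
  by (induction p) (simp_all add: map_poly_pCons algebra_simps)

lemma poly_of_real_mult:
  "poly (map_poly complex_of_real (p * q)) z
    = poly (map_poly complex_of_real p) z * poly (map_poly complex_of_real q) z"
  by (induction p) (simp_all add: map_poly_pCons poly_of_real_add poly_of_real_smult algebra_simps)

lemma poly_of_real_of_real:
  "poly (map_poly complex_of_real p) (of_real x) = of_real (poly p x)"
  by (induction p) (simp_all add: map_poly_pCons)

text \<open>The half of spectral mapping that is required, by splitting off real factors. A linear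
  factor is invertible because its root lies off the spectrum. A factor with roots a +- i b, b
  nonzero, becomes (A - a)^2 + b^2, which is bounded below by b^2.\<close>

lemma invertible_poly_op:
  fixes A :: "'a::chilbert_space \<Rightarrow>\<^sub>L 'a"
  assumes A: "self_adjoint A"
  shows "q \<noteq> 0 \<Longrightarrow> (\<And>t. t \<in> real_spectrum A \<Longrightarrow> poly q t \<noteq> 0) \<Longrightarrow> invertible_op (poly_op q A)"
proof (induction "degree q" arbitrary: q rule: less_induct)
  case less
  have factor: "invertible_op (poly_op q A)"
    if w: "w dvd q" "0 < degree w" "invertible_op (poly_op w A)" for w
  proof -
    obtain s where s: "q = w * s" using w by blast
    then have "s \<noteq> 0" "w \<noteq> 0" using less.prems by auto
    then have "degree s < degree q" using w by (simp add: s degree_mult_eq)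
    moreover have "poly s t \<noteq> 0" if "t \<in> real_spectrum A" for t
      using less.prems(2)[OF that] by (auto simp: s)
    ultimately have "invertible_op (poly_op s A)" using \<open>s \<noteq> 0\<close> by (intro less.hyps)
    then show ?thesis using w by (simp add: s poly_op_mult invertible_op_compose)
  qed
  show ?case
  proof (cases "degree q = 0")
    case True
    then obtain c where c: "q = [:c:]" using degree_eq_zeroE by blast
    have "invertible_op (id_blinfun :: 'a \<Rightarrow>\<^sub>L 'a)" by (auto simp: invertible_op_def)
    then show ?thesis
      using less.prems(1) by (simp add: c compose_simps invertible_op_scaleR)
  next
    case False
    define qc where "qc = map_poly complex_of_real q"
    have "degree qc \<noteq> 0" using False by (simp add: qc_def degree_map_poly)
    then obtain z where z: "poly qc z = 0"
      using fundamental_theorem_of_algebra constant_degree by metis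
    show ?thesis
    proof (cases "Im z = 0")
      case True
      then have "z = complex_of_real (Re z)" by (simp add: complex_eq_iff)
      then have "poly q (Re z) = 0" using z
        by (metis of_real_eq_0_iff poly_of_real_of_real qc_def)
      then have "[:- Re z, 1:] dvd q" and "Re z \<notin> real_spectrum A"
        using less.prems(2) by (auto simp: poly_eq_0_iff_dvd)
      then show ?thesis
        by (intro factor[of "[:- Re z, 1:]"]) (auto simp: real_spectrum_iff compose_simps)
    next
      case Im: False
      define a b where "a = Re z" and "b = Im z"
      define w where "w = [:a\<^sup>2 + b\<^sup>2, - 2 * a, 1:]"
      have wz: "poly (map_poly complex_of_real w) z = 0"
        by (simp add: w_def a_def b_def complex_eq_iff map_poly_pCons power2_eq_square algebra_simps)
      have "degree (q mod w) < 2"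
        using degree_mod_less[of w q] by (auto simp: w_def)
      define c d where "c = coeff (q mod w) 0" and "d = coeff (q mod w) 1"
      have cd: "q mod w = [:c, d:]"
        using \<open>degree (q mod w) < 2\<close>
        by (intro poly_eqI) (auto simp: c_def d_def coeff_pCons coeff_eq_0 split: nat.split)
      \<comment> \<open>The remainder c + d X has real coefficients and vanishes at the nonreal
        point z, so it is zero and w divides q.\<close>
      have "poly qc z = poly (map_poly complex_of_real (w * (q div w) + q mod w)) z"
        by (simp add: qc_def)
      then have "complex_of_real c + z * complex_of_real d = 0"
        unfolding poly_of_real_add poly_of_real_mult using z wz by (simp add: cd map_poly_pCons)
      then have "d = 0" "c = 0" using Im by (auto simp: complex_eq_iff)
      then have "w dvd q" using cd by (simp add: mod_eq_0_iff_dvd)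
      define E where "E = A - a *\<^sub>R id_blinfun"
      have E: "self_adjoint E" using A by (simp add: E_def self_adjoint_diff self_adjoint_scaleR)
      have pw: "poly_op w A = (E o\<^sub>L E) + b\<^sup>2 *\<^sub>R id_blinfun"
        by (rule blinfun_eqI)
          (simp add: w_def E_def plus_blinfun.rep_eq minus_blinfun.rep_eq scaleR_blinfun.rep_eq
            uminus_blinfun.rep_eq blinfun.diff_right blinfun.add_right blinfun.scaleR_right
            algebra_simps power2_eq_square scaleR_2 flip: scaleR_scaleR)
      have "invertible_op (poly_op w A)"
      proof (rule invertible_op_bounded_below)
        show "self_adjoint (poly_op w A)" by (rule self_adjoint_poly_op[OF A])
        show "0 < b\<^sup>2" using Im by (simp add: b_def)
        fix x
        have "cinner (E (E x)) x = cinner (E x) (E x)" by (simp add: self_adjointD[OF E])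
        then show "b\<^sup>2 * (norm x)\<^sup>2 \<le> Re (cinner (poly_op w A x) x)"
          by (simp add: pw plus_blinfun.rep_eq scaleR_blinfun.rep_eq cinner_simps cinner_self)
      qed
      then show ?thesis by (intro factor[OF \<open>w dvd q\<close>]) (simp_all add: w_def)
    qed
  qed
qed

text \<open>Without spectrum, X^2 - (norm A)^2 would have no root there and would give an invertible
  operator. The lemma serves to exclude the zero polynomial in the next proof.\<close>

lemma real_spectrum_nonempty:
  fixes A :: "'a::chilbert_space \<Rightarrow>\<^sub>L 'a"
  assumes A: "self_adjoint A" and "(v::'a) \<noteq> 0"
  shows "real_spectrum A \<noteq> {}"
proof
  assume "real_spectrum A = {}"
  then have "invertible_op (poly_op [:- (norm A)\<^sup>2, 0, 1:] A)"
    by (intro invertible_poly_op[OF A]) auto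
  then show False
    using norm_self_adjoint_not_invertible[OF assms] by (simp add: compose_simps)
qed

text \<open>If S = r(A) had norm above e, the polynomial r^2 - (norm S)^2 would have no root on the
  spectrum. Then S^2 - (norm S)^2 would be invertible, which
  \<open>norm_self_adjoint_not_invertible\<close> excludes.\<close>

lemma norm_poly_op_le:
  fixes A :: "'a::chilbert_space \<Rightarrow>\<^sub>L 'a"
  assumes A: "self_adjoint A" and e: "0 \<le> e"
    and le: "\<And>t. t \<in> real_spectrum A \<Longrightarrow> \<bar>poly r t\<bar> \<le> e"
  shows "norm (poly_op r A) \<le> e"
proof (rule ccontr)
  define S where "S = poly_op r A"
  assume "\<not> norm (poly_op r A) \<le> e"
  then have S: "e < norm S" by (simp add: S_def)
  then have "S \<noteq> 0" using e by auto
  have "\<exists>v :: 'a. v \<noteq> 0"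
  proof (rule ccontr)
    assume "\<not> (\<exists>v :: 'a. v \<noteq> 0)"
    then have "S = 0" by (intro blinfun_eqI) simp
    then show False using \<open>S \<noteq> 0\<close> by simp
  qed
  then obtain v :: 'a where v: "v \<noteq> 0" by blast
  define q where "q = r * r - [:(norm S)\<^sup>2:]"
  have qS: "poly_op q A = (S o\<^sub>L S) - (norm S)\<^sup>2 *\<^sub>R id_blinfun"
    by (simp add: q_def poly_op_diff poly_op_mult S_def compose_simps)
  have no_root: "poly q t \<noteq> 0" if "t \<in> real_spectrum A" for t
  proof
    assume "poly q t = 0"
    then have "\<bar>poly r t\<bar>\<^sup>2 = (norm S)\<^sup>2" by (simp add: q_def power2_eq_square)
    then have "\<bar>poly r t\<bar> = norm S" by (rule power2_eq_imp_eq) simp_all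
    then show False using le[OF that] S by simp
  qed
  obtain t where "t \<in> real_spectrum A" using real_spectrum_nonempty[OF A v] by blast
  then have "q \<noteq> 0" using no_root by auto
  then have "invertible_op (poly_op q A)" using no_root by (rule invertible_poly_op[OF A])
  moreover have "self_adjoint S" unfolding S_def by (rule self_adjoint_poly_op[OF A])
  ultimately show False using norm_self_adjoint_not_invertible[OF _ v] by (simp add: qS)
qed

lemma real_spectrum_positive_op:
  fixes P :: "'a::chilbert_space \<Rightarrow>\<^sub>L 'a"
  assumes P: "positive_op P"
  shows "real_spectrum P \<subseteq> {0..norm P}"
proof
  fix t assume t: "t \<in> real_spectrum P"
  have sa: "self_adjoint (P - s *\<^sub>R id_blinfun)" for s
    using P by (simp add: positive_op_self_adjoint self_adjoint_diff self_adjoint_scaleR)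
  have quad: "Re (cinner ((P - s *\<^sub>R id_blinfun) x) x) = Re (cinner (P x) x) - s * (norm x)\<^sup>2" for s x
    by (simp add: minus_blinfun.rep_eq scaleR_blinfun.rep_eq cinner_simps cinner_self)
  have "0 \<le> t"
  proof (rule ccontr)
    assume "\<not> 0 \<le> t"
    then have "invertible_op (P - t *\<^sub>R id_blinfun)"
      using positive_opD[OF P] by (intro invertible_op_bounded_below[OF sa, of "- t"]) (simp_all add: quad)
    then show False using t by (simp add: real_spectrum_iff)
  qed
  moreover have "t \<le> norm P"
  proof (rule ccontr)
    assume "\<not> t \<le> norm P"
    have "invertible_op ((-1) *\<^sub>R (P - t *\<^sub>R id_blinfun))"
    proof (rule invertible_op_bounded_below[OF self_adjoint_scaleR[OF sa]])
      show "0 < t - norm P" using \<open>\<not> t \<le> norm P\<close> by simp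
      show "(t - norm P) * (norm x)\<^sup>2 \<le> Re (cinner (((-1) *\<^sub>R (P - t *\<^sub>R id_blinfun)) x) x)" for x
        unfolding scaleR_blinfun.rep_eq cinner_scaleR_left
        using Re_cinner_blinfun_le[of P x] quad[of t x] by (simp add: left_diff_distrib)
    qed
    from invertible_op_scaleR[OF this, of "-1"] show False using t by (simp add: real_spectrum_iff)
  qed
  ultimately show "t \<in> {0..norm P}" by simp
qed

section \<open>Functional calculus of positive operators\<close>

instance chilbert_space \<subseteq> banach ..

lemma polynomial_uniform_limit:
  fixes f :: "real \<Rightarrow> real"
  assumes "continuous_on {0..b} f"
  obtains r :: "nat \<Rightarrow> real poly" where "uniform_limit {0..b} (\<lambda>m. poly (r m)) f sequentially"
proof -
  obtain g where g: "uniform_limit {0..b} g f sequentially" "\<And>n. polynomial_function (g n)"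
    using Stone_Weierstrass_uniform_limit[OF _ assms] by blast
  have "\<exists>r. poly r = g n" for n
  proof -
    obtain a N where "g n = (\<lambda>x. \<Sum>i\<le>N. a i * x ^ i)"
      using g(2)[of n] by (auto simp flip: real_polynomial_function_eq
          simp: real_polynomial_function_iff_sum)
    then have "poly (\<Sum>i\<le>N. monom (a i) i) = g n" by (auto simp: poly_sum poly_monom)
    then show ?thesis by blast
  qed
  then obtain r where "\<And>n. poly (r n) = g n" by metis
  with g(1) that[of r] show thesis by simp
qed

text \<open>This is the well-definedness of \<open>cfc\<close>. By \<open>norm_poly_op_le\<close>
  one approximating sequence yields a Cauchy sequence of operators, and any two yield the same
  limit. The sequence r also keeps the condition under THE from being vacuous, which gives
  uniqueness.\<close>

lemma cfc_tendsto_spectrum: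
  fixes P :: "'a::chilbert_space \<Rightarrow>\<^sub>L 'a"
  assumes P: "positive_op P"
    and r: "uniform_limit (real_spectrum P) (\<lambda>m. poly (r m)) f sequentially"
  shows "(\<lambda>m. poly_op (r m) P) \<longlonglongrightarrow> cfc f P"
proof -
  have sa: "self_adjoint P" by (rule positive_op_self_adjoint[OF P])
  have close: "(\<lambda>m. poly_op (s m) P - poly_op (r m) P) \<longlonglongrightarrow> 0"
    if s: "uniform_limit (real_spectrum P) (\<lambda>m. poly (s m)) f sequentially" for s
  proof (rule tendstoI)
    fix e :: real assume e: "0 < e"
    have "\<forall>\<^sub>F m in sequentially. \<forall>t\<in>real_spectrum P. dist (poly (s m) t) (f t) < e / 4"
      "\<forall>\<^sub>F m in sequentially. \<forall>t\<in>real_spectrum P. dist (poly (r m) t) (f t) < e / 4"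
      using uniform_limitD[OF s, of "e / 4"] uniform_limitD[OF r, of "e / 4"] e by simp_all
    then show "\<forall>\<^sub>F m in sequentially. dist (poly_op (s m) P - poly_op (r m) P) 0 < e"
    proof eventually_elim
      case (elim m)
      have "norm (poly_op (s m - r m) P) \<le> e / 2"
      proof (rule norm_poly_op_le[OF sa])
        fix t assume "t \<in> real_spectrum P"
        with elim have "\<bar>poly (s m) t - f t\<bar> < e / 4" "\<bar>poly (r m) t - f t\<bar> < e / 4"
          by (auto simp: dist_real_def)
        then show "\<bar>poly (s m - r m) t\<bar> \<le> e / 2" unfolding poly_diff by linarith
      qed (use e in simp)
      then show ?case using e by (simp add: poly_op_diff)
    qed
  qed
  have "Cauchy (\<lambda>m. poly_op (r m) P)"
  proof (rule metric_CauchyI)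
    fix e :: real assume e: "0 < e"
    obtain N where N: "\<And>m t. N \<le> m \<Longrightarrow> t \<in> real_spectrum P \<Longrightarrow> dist (poly (r m) t) (f t) < e / 4"
      using uniform_limitD[OF r, of "e / 4"] e by (auto simp: eventually_sequentially)
    have "dist (poly_op (r m) P) (poly_op (r n) P) < e" if "N \<le> m" "N \<le> n" for m n
    proof -
      have "norm (poly_op (r m - r n) P) \<le> e / 2"
      proof (rule norm_poly_op_le[OF sa])
        fix t assume "t \<in> real_spectrum P"
        with N that have "\<bar>poly (r m) t - f t\<bar> < e / 4" "\<bar>poly (r n) t - f t\<bar> < e / 4"
          by (auto simp: dist_real_def)
        then show "\<bar>poly (r m - r n) t\<bar> \<le> e / 2" unfolding poly_diff by linarith
      qed (use e in simp)
      then show ?thesis using e by (simp add: poly_op_diff dist_norm)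
    qed
    then show "\<exists>M. \<forall>m\<ge>M. \<forall>n\<ge>M. dist (poly_op (r m) P) (poly_op (r n) P) < e" by blast
  qed
  then obtain T where T: "(\<lambda>m. poly_op (r m) P) \<longlonglongrightarrow> T"
    using Cauchy_convergent convergent_def by blast
  have "cfc f P = T"
    unfolding cfc_def real_spectrum_def[symmetric]
  proof (rule the_equality, intro allI impI)
    fix s assume "uniform_limit (real_spectrum P) (\<lambda>m. poly (s m)) f sequentially"
    from tendsto_add[OF close[OF this] T] show "(\<lambda>m. poly_op (s m) P) \<longlonglongrightarrow> T" by simp
  next
    fix T' assume "\<forall>s. uniform_limit (real_spectrum P) (\<lambda>m. poly (s m)) f sequentially
      \<longrightarrow> (\<lambda>m. poly_op (s m) P) \<longlonglongrightarrow> T'"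
    then show "T' = T" using r T LIMSEQ_unique by blast
  qed
  then show ?thesis using T by simp
qed

text \<open>Approximating on an interval instead of the spectrum allows one polynomial sequence to
  serve several operators at once, as in \<open>intertwine_cfc\<close> and
  \<open>cfc_block_diag\<close>.\<close>

lemma cfc_tendsto:
  fixes P :: "'a::chilbert_space \<Rightarrow>\<^sub>L 'a"
  assumes "positive_op P" and "norm P \<le> b"
    and "uniform_limit {0..b} (\<lambda>m. poly (r m)) f sequentially"
  shows "(\<lambda>m. poly_op (r m) P) \<longlonglongrightarrow> cfc f P"
proof (rule cfc_tendsto_spectrum[OF assms(1) uniform_limit_on_subset[OF assms(3)]])
  show "real_spectrum P \<subseteq> {0..b}"
    using real_spectrum_positive_op[OF assms(1)] assms(2) by force
qed

lemma cfc_cong: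
  fixes P :: "'a::chilbert_space \<Rightarrow>\<^sub>L 'a"
  assumes "positive_op P" and "\<And>t. 0 \<le> t \<Longrightarrow> t \<le> norm P \<Longrightarrow> f t = g t"
  shows "cfc f P = cfc g P"
proof -
  have "uniform_limit (real_spectrum P) (\<lambda>m. poly (r m)) f sequentially
      = uniform_limit (real_spectrum P) (\<lambda>m. poly (r m)) g sequentially" for r :: "nat \<Rightarrow> real poly"
    using real_spectrum_positive_op[OF assms(1)]
    by (intro uniform_limit_cong' refl assms(2)) auto
  then show ?thesis unfolding cfc_def real_spectrum_def[symmetric] by simp
qed

lemma cfc_poly:
  fixes P :: "'a::chilbert_space \<Rightarrow>\<^sub>L 'a"
  assumes "positive_op P"
  shows "cfc (poly r) P = poly_op r P"
proof -
  have "(\<lambda>m::nat. poly_op r P) \<longlonglongrightarrow> cfc (poly r) P"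
    by (rule cfc_tendsto[OF assms order_refl]) (simp add: uniform_limit_const)
  then show ?thesis using LIMSEQ_unique tendsto_const by blast
qed

lemma cfc_const: "positive_op P \<Longrightarrow> cfc (\<lambda>t. c) P = c *\<^sub>R (id_blinfun :: 'a::chilbert_space \<Rightarrow>\<^sub>L 'a)"
  using cfc_poly[of P "[:c:]"] by (simp add: compose_simps poly_pCons[abs_def])

lemma cfc_ident: "positive_op P \<Longrightarrow> cfc (\<lambda>t. t) P = (P :: 'a::chilbert_space \<Rightarrow>\<^sub>L 'a)"
  using cfc_poly[of P "[:0, 1:]"] by (simp add: compose_simps poly_pCons[abs_def])

lemma cfc_add:
  fixes P :: "'a::chilbert_space \<Rightarrow>\<^sub>L 'a"
  assumes P: "positive_op P" and "continuous_on {0..norm P} f" "continuous_on {0..norm P} g"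
  shows "cfc (\<lambda>t. f t + g t) P = cfc f P + cfc g P"
proof -
  obtain r s where r: "uniform_limit {0..norm P} (\<lambda>m. poly (r m)) f sequentially"
    and s: "uniform_limit {0..norm P} (\<lambda>m. poly (s m)) g sequentially"
    using polynomial_uniform_limit assms(2,3) by meson
  have "uniform_limit {0..norm P} (\<lambda>m. poly (r m + s m)) (\<lambda>t. f t + g t) sequentially"
    using uniform_limit_add[OF r s] by (simp add: poly_add[abs_def])
  from cfc_tendsto[OF P order_refl this]
  have "(\<lambda>m. poly_op (r m) P + poly_op (s m) P) \<longlonglongrightarrow> cfc (\<lambda>t. f t + g t) P"
    by (simp add: poly_op_add)
  moreover have "(\<lambda>m. poly_op (r m) P + poly_op (s m) P) \<longlonglongrightarrow> cfc f P + cfc g P"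
    by (intro tendsto_add cfc_tendsto[OF P order_refl] r s)
  ultimately show ?thesis by (rule LIMSEQ_unique)
qed

lemma cfc_mult:
  fixes P :: "'a::chilbert_space \<Rightarrow>\<^sub>L 'a"
  assumes P: "positive_op P" and "continuous_on {0..norm P} f" "continuous_on {0..norm P} g"
  shows "cfc (\<lambda>t. f t * g t) P = cfc f P o\<^sub>L cfc g P"
proof -
  obtain r s where r: "uniform_limit {0..norm P} (\<lambda>m. poly (r m)) f sequentially"
    and s: "uniform_limit {0..norm P} (\<lambda>m. poly (s m)) g sequentially"
    using polynomial_uniform_limit assms(2,3) by meson
  have "bounded (f ` {0..norm P})" "bounded (g ` {0..norm P})"
    by (intro compact_imp_bounded compact_continuous_image compact_Icc assms(2,3))+
  from uniform_lim_mult[OF r s this]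
  have "uniform_limit {0..norm P} (\<lambda>m. poly (r m * s m)) (\<lambda>t. f t * g t) sequentially"
    by (simp add: poly_mult[abs_def])
  from cfc_tendsto[OF P order_refl this]
  have "(\<lambda>m. poly_op (r m) P o\<^sub>L poly_op (s m) P) \<longlonglongrightarrow> cfc (\<lambda>t. f t * g t) P"
    by (simp add: poly_op_mult)
  moreover have "(\<lambda>m. poly_op (r m) P o\<^sub>L poly_op (s m) P) \<longlonglongrightarrow> (cfc f P o\<^sub>L cfc g P)"
    by (intro bounded_bilinear.tendsto[OF bounded_bilinear_blinfun_compose]
        cfc_tendsto[OF P order_refl] r s)
  ultimately show ?thesis by (rule LIMSEQ_unique)
qed

lemma cfc_scaleR:
  fixes P :: "'a::chilbert_space \<Rightarrow>\<^sub>L 'a"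
  assumes "positive_op P" and "continuous_on {0..norm P} f"
  shows "cfc (\<lambda>t. c * f t) P = c *\<^sub>R cfc f P"
  using cfc_mult[OF assms(1) continuous_on_const assms(2)] assms(1)
  by (simp add: cfc_const compose_simps)

lemma cfc_diff:
  fixes P :: "'a::chilbert_space \<Rightarrow>\<^sub>L 'a"
  assumes "positive_op P" and "continuous_on {0..norm P} f" "continuous_on {0..norm P} g"
  shows "cfc (\<lambda>t. f t - g t) P = cfc f P - cfc g P"
  using cfc_add[OF assms(1,2), of "\<lambda>t. (-1) * g t"] cfc_scaleR[OF assms(1,3), of "-1"] assms(3)
  by (simp add: continuous_on_minus)

section \<open>Self-adjointness, order and composition in the calculus\<close>

lemma self_adjoint_limit:
  fixes A :: "nat \<Rightarrow> 'a::complex_inner \<Rightarrow>\<^sub>L 'a"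
  assumes "A \<longlonglongrightarrow> B" and "\<And>n. self_adjoint (A n)"
  shows "self_adjoint B"
proof -
  have lim: "(\<lambda>n. A n x) \<longlonglongrightarrow> B x" for x
    by (intro blinfun.tendsto assms(1) tendsto_const)
  have "B (c *\<^sub>C x) = c *\<^sub>C B x" for c x
  proof (rule LIMSEQ_unique[OF lim])
    have "(\<lambda>n. c *\<^sub>C A n x) \<longlonglongrightarrow> c *\<^sub>C B x"
      by (intro bounded_linear.tendsto[OF bounded_linear_scaleC] lim)
    then show "(\<lambda>n. A n (c *\<^sub>C x)) \<longlonglongrightarrow> c *\<^sub>C B x"
      using assms(2) by (simp add: self_adjoint_bounded bounded_operators_scaleC)
  qed
  moreover have "cinner (B x) y = cinner x (B y)" for x y
  proof (rule LIMSEQ_unique)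
    show "(\<lambda>n. cinner (A n x) y) \<longlonglongrightarrow> cinner (B x) y"
      by (intro bounded_bilinear.tendsto[OF bounded_bilinear_cinner] lim tendsto_const)
    have "(\<lambda>n. cinner x (A n y)) \<longlonglongrightarrow> cinner x (B y)"
      by (intro bounded_bilinear.tendsto[OF bounded_bilinear_cinner] lim tendsto_const)
    then show "(\<lambda>n. cinner (A n x) y) \<longlonglongrightarrow> cinner x (B y)"
      using assms(2) by (simp add: self_adjointD)
  qed
  ultimately show ?thesis by (simp add: self_adjoint_def bounded_operators_def)
qed

lemma self_adjoint_cfc:
  fixes P :: "'a::chilbert_space \<Rightarrow>\<^sub>L 'a"
  assumes P: "positive_op P" and f: "continuous_on {0..norm P} f"
  shows "self_adjoint (cfc f P)"
proof -
  obtain r where "uniform_limit {0..norm P} (\<lambda>m. poly (r m)) f sequentially"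
    using polynomial_uniform_limit f by meson
  from cfc_tendsto[OF P order_refl this] show ?thesis
    by (rule self_adjoint_limit) (intro self_adjoint_poly_op positive_op_self_adjoint P)
qed

lemma positive_op_cfc:
  fixes P :: "'a::chilbert_space \<Rightarrow>\<^sub>L 'a"
  assumes P: "positive_op P" and f: "continuous_on {0..norm P} f"
    and nonneg: "\<And>t. 0 \<le> t \<Longrightarrow> t \<le> norm P \<Longrightarrow> 0 \<le> f t"
  shows "positive_op (cfc f P)"
proof -
  have c: "continuous_on {0..norm P} (\<lambda>t. sqrt (f t))" by (intro continuous_intros f)
  have "cfc f P = cfc (\<lambda>t. sqrt (f t) * sqrt (f t)) P"
    by (rule cfc_cong[OF P]) (simp add: nonneg)
  also have "\<dots> = cfc (\<lambda>t. sqrt (f t)) P o\<^sub>L cfc (\<lambda>t. sqrt (f t)) P"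
    by (rule cfc_mult[OF P c c])
  finally show ?thesis by (simp add: positive_op_square self_adjoint_cfc[OF P c])
qed

lemma cfc_mono:
  fixes P :: "'a::chilbert_space \<Rightarrow>\<^sub>L 'a"
  assumes P: "positive_op P" and "continuous_on {0..norm P} f" "continuous_on {0..norm P} g"
    and le: "\<And>t. 0 \<le> t \<Longrightarrow> t \<le> norm P \<Longrightarrow> f t \<le> g t"
  shows "Re (cinner (cfc f P x) x) \<le> Re (cinner (cfc g P x) x)"
proof -
  have "positive_op (cfc (\<lambda>t. g t - f t) P)"
    by (rule positive_op_cfc[OF P]) (auto intro!: continuous_intros assms simp: le)
  from positive_opD[OF this, of x] show ?thesis
    by (simp add: cfc_diff assms minus_blinfun.rep_eq cinner_simps)
qed

lemma norm_cfc_le: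
  fixes P :: "'a::chilbert_space \<Rightarrow>\<^sub>L 'a"
  assumes P: "positive_op P" and f: "continuous_on {0..norm P} f"
    and le: "\<And>t. 0 \<le> t \<Longrightarrow> t \<le> norm P \<Longrightarrow> \<bar>f t\<bar> \<le> c"
  shows "norm (cfc f P) \<le> c"
proof -
  obtain r where r: "uniform_limit {0..norm P} (\<lambda>m. poly (r m)) f sequentially"
    using polynomial_uniform_limit f by meson
  have lim: "(\<lambda>m. norm (poly_op (r m) P)) \<longlonglongrightarrow> norm (cfc f P)"
    by (intro tendsto_norm cfc_tendsto[OF P order_refl r])
  have c: "0 \<le> c" using le[of 0] by (meson abs_ge_zero norm_ge_zero order_refl order_trans)
  show ?thesis
  proof (rule field_le_epsilon)
    fix e :: real assume e: "0 < e"
    have "\<forall>\<^sub>F m in sequentially. norm (poly_op (r m) P) \<le> c + e"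
      using uniform_limitD[OF r e]
    proof eventually_elim
      case (elim m)
      show ?case
      proof (rule norm_poly_op_le[OF positive_op_self_adjoint[OF P]])
        fix t assume "t \<in> real_spectrum P"
        then have t: "0 \<le> t" "t \<le> norm P" using real_spectrum_positive_op[OF P] by auto
        with elim have "\<bar>poly (r m) t - f t\<bar> < e" by (auto simp: dist_real_def)
        then show "\<bar>poly (r m) t\<bar> \<le> c + e" using le[OF t] by linarith
      qed (use c e in simp)
    qed
    from tendsto_upperbound[OF lim this] show "norm (cfc f P) \<le> c + e" by simp
  qed
qed

lemma intertwine_cfc:
  fixes A B S :: "'a::chilbert_space \<Rightarrow>\<^sub>L 'a"
  assumes A: "positive_op A" and B: "positive_op B" and S: "S o\<^sub>L A = B o\<^sub>L S"
    and f: "continuous_on {0..max (norm A) (norm B)} f"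
  shows "S o\<^sub>L cfc f A = cfc f B o\<^sub>L S"
proof -
  obtain r where r: "uniform_limit {0..max (norm A) (norm B)} (\<lambda>m. poly (r m)) f sequentially"
    using polynomial_uniform_limit f by meson
  have "(\<lambda>m. S o\<^sub>L poly_op (r m) A) \<longlonglongrightarrow> (S o\<^sub>L cfc f A)"
    by (intro bounded_bilinear.tendsto[OF bounded_bilinear_blinfun_compose] tendsto_const
        cfc_tendsto[OF A _ r]) simp
  moreover have "(\<lambda>m. poly_op (r m) B o\<^sub>L S) \<longlonglongrightarrow> (cfc f B o\<^sub>L S)"
    by (intro bounded_bilinear.tendsto[OF bounded_bilinear_blinfun_compose] tendsto_const
        cfc_tendsto[OF B _ r]) simp
  ultimately show ?thesis by (simp add: intertwine_poly_op[OF S] LIMSEQ_unique)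
qed

text \<open>For polynomial h the identity is algebra. In general h is approximated on an interval
  [0, b] that contains both the range of f, where \<open>norm_cfc_le\<close> compares, and the
  spectrum of f(P), where the left side converges.\<close>

lemma cfc_compose:
  fixes P :: "'a::chilbert_space \<Rightarrow>\<^sub>L 'a"
  assumes P: "positive_op P" and f: "continuous_on {0..norm P} f"
    and nonneg: "\<And>t. 0 \<le> t \<Longrightarrow> t \<le> norm P \<Longrightarrow> 0 \<le> f t"
    and h: "continuous_on {0..} h"
  shows "cfc h (cfc f P) = cfc (\<lambda>t. h (f t)) P"
proof -
  define Q where "Q = cfc f P"
  have Q: "positive_op Q" unfolding Q_def by (rule positive_op_cfc[OF P f nonneg])
  have "bounded (f ` {0..norm P})"
    by (intro compact_imp_bounded compact_continuous_image f compact_Icc)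
  then obtain b0 where b0: "\<And>t. 0 \<le> t \<Longrightarrow> t \<le> norm P \<Longrightarrow> \<bar>f t\<bar> \<le> b0"
    by (force simp: bounded_iff)
  define b where "b = max b0 (norm Q)"
  have fb: "f t \<in> {0..b}" if "0 \<le> t" "t \<le> norm P" for t
    using nonneg[OF that] b0[OF that] by (auto simp: b_def)
  have fb': "f ` {0..norm P} \<subseteq> {0..b}" using fb by auto
  have hb: "continuous_on {0..b} h" by (rule continuous_on_subset[OF h]) auto
  have hf: "continuous_on {0..norm P} (\<lambda>t. h (f t))"
    by (rule continuous_on_compose2[OF hb f fb'])
  have poly_eq: "poly_op r Q = cfc (\<lambda>t. poly r (f t)) P" for r
  proof (induction r)
    case (pCons a r)
    have c: "continuous_on {0..norm P} (\<lambda>t. poly r (f t))" by (intro continuous_intros f)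
    then show ?case
      using P f pCons.IH by (simp add: cfc_add cfc_mult cfc_const continuous_intros Q_def)
  qed (use P in \<open>simp add: cfc_const\<close>)
  obtain r where r: "uniform_limit {0..b} (\<lambda>m. poly (r m)) h sequentially"
    using polynomial_uniform_limit hb by meson
  have lim: "(\<lambda>m. poly_op (r m) Q) \<longlonglongrightarrow> cfc h Q"
    by (rule cfc_tendsto[OF Q _ r]) (simp add: b_def)
  have "(\<lambda>m. poly_op (r m) Q - cfc (\<lambda>t. h (f t)) P) \<longlonglongrightarrow> 0"
  proof (rule tendstoI)
    fix e :: real assume e: "0 < e"
    have "\<forall>\<^sub>F m in sequentially. \<forall>t\<in>{0..b}. dist (poly (r m) t) (h t) < e / 2"
      using uniform_limitD[OF r, of "e / 2"] e by simp
    then show "\<forall>\<^sub>F m in sequentially. dist (poly_op (r m) Q - cfc (\<lambda>t. h (f t)) P) 0 < e"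
    proof eventually_elim
      case (elim m)
      have c: "continuous_on {0..norm P} (\<lambda>t. poly (r m) (f t))" by (intro continuous_intros f)
      have "norm (cfc (\<lambda>t. poly (r m) (f t) - h (f t)) P) \<le> e / 2"
      proof (rule norm_cfc_le[OF P continuous_on_diff[OF c hf]])
        fix t assume "0 \<le> t" "t \<le> norm P"
        then have "dist (poly (r m) (f t)) (h (f t)) < e / 2" using elim fb by blast
        then show "\<bar>poly (r m) (f t) - h (f t)\<bar> \<le> e / 2" by (simp add: dist_real_def)
      qed
      then show ?case using e by (simp add: poly_eq cfc_diff[OF P c hf])
    qed
  qed
  from LIMSEQ_unique[OF tendsto_diff[OF lim tendsto_const] this] show ?thesis by (simp add: Q_def)
qed

text \<open>With a polar decomposition S = U sqrt(A) one would write S = G(B) U F(A), since F G =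
  sqrt and S intertwines A with B. Here U is replaced by the contraction S k(A) with a regularised
  inverse root k, and the error tends to 0 with e.\<close>

lemma mixed_Schwarz:
  fixes S :: "'a::chilbert_space \<Rightarrow>\<^sub>L 'a"
  assumes S: "S \<in> bounded_operators"
    and F: "continuous_on {0..} F" and G: "continuous_on {0..} G"
    and FG: "\<And>t. 0 \<le> t \<Longrightarrow> F t * G t = sqrt t"
  shows "cmod (cinner (S x) y) \<le> norm (cfc F (adj S o\<^sub>L S) x) * norm (cfc G (S o\<^sub>L adj S) y)"
proof -
  define A B where "A = adj S o\<^sub>L S" and "B = S o\<^sub>L adj S"
  have A: "positive_op A" unfolding A_def by (rule positive_op_adj_compose[OF S])
  have B: "positive_op B" unfolding B_def by (rule positive_op_compose_adj[OF S])
  have SA: "S o\<^sub>L A = B o\<^sub>L S" by (simp add: A_def B_def compose_assoc)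
  have F': "continuous_on {0..b} F" and G': "continuous_on {0..b} G" for b
    by (rule continuous_on_subset[OF F], auto) (rule continuous_on_subset[OF G], auto)
  have id: "continuous_on {0..b} (\<lambda>t. t)" for b :: real by (rule continuous_on_id)
  \<comment> \<open>This holds because the squared norm is the form of t h(t)^2 at z. It is used
    once to make the error small and once to see that S k(A) is a contraction.\<close>
  have S_cfc: "norm (S (cfc h A z)) \<le> c * norm z"
    if h: "continuous_on {0..norm A} h" and c: "0 \<le> c" and le: "\<And>t. 0 \<le> t \<Longrightarrow> t * (h t)\<^sup>2 \<le> c\<^sup>2" for h c z
  proof -
    have sa: "self_adjoint (cfc h A)" by (rule self_adjoint_cfc[OF A h])
    have "(norm (S (cfc h A z)))\<^sup>2 = Re (cinner (A (cfc h A z)) (cfc h A z))"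
      by (simp add: A_def cinner_adj_left[OF S] norm_power2_cinner)
    also have "\<dots> = Re (cinner (cfc h A (A (cfc h A z))) z)"
      by (simp add: self_adjointD[OF sa])
    also have "cfc h A (A (cfc h A z)) = cfc (\<lambda>t. h t * (t * h t)) A z"
      using cfc_mult[OF A h continuous_on_mult[OF id h]] cfc_mult[OF A id h]
      by (simp add: cfc_ident[OF A])
    also have "Re (cinner \<dots> z) \<le> Re (cinner (cfc (\<lambda>t. c\<^sup>2) A z) z)"
      using le by (intro cfc_mono A continuous_on_mult h id continuous_on_const)
        (simp add: power2_eq_square mult_ac)
    also have "\<dots> = (c * norm z)\<^sup>2"
      by (simp add: cfc_const[OF A] scaleR_blinfun.rep_eq cinner_simps cinner_self power_mult_distrib)
    finally show ?thesis by (rule power2_le_imp_le) (simp add: c)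
  qed
  have approx: "cmod (cinner (S x) y) \<le> e * norm x * norm y + norm (cfc F A x) * norm (cfc G B y)"
    if e: "0 < e" for e
  proof -
    \<comment> \<open>k regularises 1 / sqrt t. The part 1 - sqrt t * k t = e / (sqrt t + e) does
      not become uniformly small near 0, but its product with sqrt t is at most e, and that product
      is what S sees.\<close>
    define k where "k t = 1 / (sqrt t + e)" for t
    have pos: "0 < sqrt t + e" if "0 \<le> t" for t using e that by (simp add: add_nonneg_pos)
    have k: "continuous_on {0..b} k" for b
      unfolding k_def by (intro continuous_intros) (use pos in force)
    have sk: "continuous_on {0..b} (\<lambda>t. sqrt t * k t)" for b by (intro continuous_intros k)
    have small: "norm (S (cfc (\<lambda>t. 1 - sqrt t * k t) A x)) \<le> e * norm x"
    proof (rule S_cfc)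
      fix t :: real assume t: "0 \<le> t"
      have eq: "1 - sqrt t * k t = e / (sqrt t + e)" using pos[OF t] by (simp add: k_def field_simps)
      have "t = (sqrt t)\<^sup>2" using t by simp
      then have "t * (1 - sqrt t * k t)\<^sup>2 = e\<^sup>2 * (sqrt t / (sqrt t + e))\<^sup>2"
        unfolding eq by (simp add: power_divide)
      also have "\<dots> \<le> e\<^sup>2 * 1"
        using pos[OF t] t e by (intro mult_left_mono power_le_one) auto
      finally show "t * (1 - sqrt t * k t)\<^sup>2 \<le> e\<^sup>2" by simp
    qed (use e in \<open>auto intro!: continuous_intros sk\<close>)
    have contr: "norm (S (cfc k A z)) \<le> 1 * norm z" for z
    proof (rule S_cfc[OF k])
      fix t :: real assume t: "0 \<le> t"
      have "t * (k t)\<^sup>2 = (sqrt t / (sqrt t + e))\<^sup>2" using t by (simp add: k_def power_divide)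
      also have "\<dots> \<le> 1" using pos[OF t] t e by (intro power_le_one) auto
      finally show "t * (k t)\<^sup>2 \<le> 1\<^sup>2" by simp
    qed simp
    have "cfc (\<lambda>t. sqrt t * k t) A = cfc (\<lambda>t. G t * (k t * F t)) A"
      by (rule cfc_cong[OF A]) (simp flip: FG)
    also have "\<dots> = cfc G A o\<^sub>L (cfc k A o\<^sub>L cfc F A)"
      by (simp add: cfc_mult A F' G' k continuous_on_mult)
    finally have factor: "cfc (\<lambda>t. sqrt t * k t) A = cfc G A o\<^sub>L (cfc k A o\<^sub>L cfc F A)" .
    \<comment> \<open>The identity is split into the error part and G k F. Applying S and moving
      G(A) across to G(B) puts G on the side of y.\<close>
    have "id_blinfun = cfc (\<lambda>t. 1 - sqrt t * k t) A + cfc (\<lambda>t. sqrt t * k t) A"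
      by (simp add: cfc_diff A sk cfc_const)
    then have "x = cfc (\<lambda>t. 1 - sqrt t * k t) A x + cfc G A (cfc k A (cfc F A x))"
      by (metis factor blinfun_apply_blinfun_compose blinfun.add_left id_blinfun.rep_eq id_apply)
    then have "S x = S (cfc (\<lambda>t. 1 - sqrt t * k t) A x) + S (cfc G A (cfc k A (cfc F A x)))"
      by (metis blinfun.add_right)
    also have "S (cfc G A (cfc k A (cfc F A x))) = cfc G B (S (cfc k A (cfc F A x)))"
      using intertwine_cfc[OF A B SA G'] by (metis blinfun_apply_blinfun_compose)
    finally have "cinner (S x) y = cinner (S (cfc (\<lambda>t. 1 - sqrt t * k t) A x)) y
        + cinner (S (cfc k A (cfc F A x))) (cfc G B y)"
      by (simp add: cinner_simps self_adjointD[OF self_adjoint_cfc[OF B G']])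
    also have "cmod \<dots> \<le> norm (S (cfc (\<lambda>t. 1 - sqrt t * k t) A x)) * norm y
        + norm (S (cfc k A (cfc F A x))) * norm (cfc G B y)"
      by (intro order_trans[OF norm_triangle_ineq] add_mono cinner_Cauchy_Schwarz)
    also have "\<dots> \<le> e * norm x * norm y + norm (cfc F A x) * norm (cfc G B y)"
      using small contr[of "cfc F A x"] by (intro add_mono mult_right_mono) auto
    finally show ?thesis .
  qed
  show ?thesis
  proof (rule field_le_epsilon)
    fix d :: real assume d: "0 < d"
    define c where "c = norm x * norm y"
    have c: "0 \<le> c" by (simp add: c_def)
    \<comment> \<open>The denominator c + 1 instead of c covers the case that x or y is
      zero.\<close>
    have "d / (c + 1) * c \<le> d" using c d by (simp add: field_simps)
    moreover have "0 < d / (c + 1)" using c d by simp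
    ultimately show "cmod (cinner (S x) y)
        \<le> norm (cfc F (adj S o\<^sub>L S) x) * norm (cfc G (S o\<^sub>L adj S) y) + d"
      using approx[of "d / (c + 1)"] by (simp add: c_def A_def B_def mult.assoc)
  qed
qed

section \<open>Scalar inequalities\<close>

lemma Young_powr:
  fixes a b s t :: real
  assumes "0 \<le> a" "0 \<le> b" "0 < s" "0 < t" "s + t = 1"
  shows "a powr s * b powr t \<le> s * a + t * b"
proof (cases "a = 0 \<or> b = 0")
  case True
  then show ?thesis using assms by auto
next
  case False
  then show ?thesis using assms Youngs_inequality_0[of s t a b] by simp
qed

text \<open>After rearrangement this is the tangent line of t^(n/2) at t = c^2, evaluated at t =
  s^2. It is Young's inequality with weights 2/n and 1 - 2/n; for n = 2 the second weight vanishes,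
  hence the case split.\<close>

lemma power_tangent_bound:
  fixes s c :: real
  assumes "2 \<le> n" "0 \<le> s" "0 \<le> c"
  shows "real n * c ^ (n - 2) * s\<^sup>2 \<le> 2 * s ^ n + (real n - 2) * c ^ n"
proof (cases "n = 2")
  case False
  define \<theta> where "\<theta> = 2 / real n"
  have n: "2 < real n" using assms(1) False by simp
  have "(s ^ n) powr \<theta> = s\<^sup>2"
  proof (cases "s = 0")
    case False
    then have "(s ^ n) powr \<theta> = s powr (real n * \<theta>)"
      using assms by (simp add: powr_realpow[symmetric] powr_powr)
    then show ?thesis using n False assms by (simp add: \<theta>_def powr_numeral)
  qed (use assms in simp)
  moreover have "(c ^ n) powr (1 - \<theta>) = c ^ (n - 2)"
  proof (cases "c = 0")
    case False
    then have "(c ^ n) powr (1 - \<theta>) = c powr (real n * (1 - \<theta>))"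
      using assms by (simp add: powr_realpow[symmetric] powr_powr)
    also have "real n * (1 - \<theta>) = real (n - 2)" using n by (simp add: \<theta>_def field_simps of_nat_diff)
    also have "c powr real (n - 2) = c ^ (n - 2)"
      by (rule powr_realpow) (use False assms in simp)
    finally show ?thesis .
  qed (use assms \<open>n \<noteq> 2\<close> in \<open>simp add: power_0_left\<close>)
  moreover have "(s ^ n) powr \<theta> * (c ^ n) powr (1 - \<theta>) \<le> \<theta> * s ^ n + (1 - \<theta>) * c ^ n"
    using assms n by (intro Young_powr) (auto simp: \<theta>_def)
  ultimately have "s\<^sup>2 * c ^ (n - 2) \<le> \<theta> * s ^ n + (1 - \<theta>) * c ^ n" by simp
  then have "real n * (s\<^sup>2 * c ^ (n - 2)) \<le> real n * (\<theta> * s ^ n + (1 - \<theta>) * c ^ n)"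
    using n by (intro mult_left_mono) auto
  also have "\<dots> = 2 * s ^ n + (real n - 2) * c ^ n" using n by (simp add: \<theta>_def field_simps)
  finally show ?thesis by (simp add: mult_ac)
qed simp

text \<open>Weighted AM-GM for a^(1-r) * (a^2)^r. It is exact at a = 1, the point around which
  \<open>first_order_bound_aux\<close> expands.\<close>

lemma powr_le_interpolation:
  fixes a r :: real
  assumes "0 \<le> a" "0 \<le> r" "r < 1"
  shows "a powr (1 + r) \<le> (1 - r) * a + r * a\<^sup>2"
proof (cases "a = 0 \<or> r = 0")
  case False
  then have "0 < a" "0 < r" using assms by auto
  have "a powr (1 - r) * (a\<^sup>2) powr r \<le> (1 - r) * a + r * a\<^sup>2"
    using assms \<open>0 < r\<close> by (intro Young_powr) auto
  moreover have "(a\<^sup>2) powr r = a powr (2 * r)"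
    using \<open>0 < a\<close> by (simp add: powr_powr flip: powr_numeral)
  ultimately show ?thesis by (simp add: powr_add[symmetric] add.commute)
qed (use assms in auto)

text \<open>The difference of the two sides is convex and then concave, with a critical point at \<open>1\<close>;
  the quadratic coefficient is chosen so that it is still nonnegative at the right end \<open>q\<close>.\<close>

lemma powr_le_quadratic:
  fixes q y :: real
  assumes q: "2 \<le> q" and y: "0 \<le> y" "y \<le> q"
  defines "r \<equiv> 1 - 2 / q"
  shows "y powr (2 / q) \<le> 1 + 2 / q * (y - 1) - (r / (q - 1))\<^sup>2 * (y - 1)\<^sup>2"
proof -
  define \<sigma> k where "\<sigma> = 2 / q" and "k = (r / (q - 1))\<^sup>2"
  have \<sigma>: "0 < \<sigma>" "\<sigma> \<le> 1" and r: "r = 1 - \<sigma>" "0 \<le> r" "r < 1" and q_eq: "q = 2 / \<sigma>"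
    using q by (auto simp: \<sigma>_def r_def field_simps)
  have "r / (q - 1) \<le> r / 1" using q r by (intro divide_left_mono) auto
  then have k_le: "k \<le> r\<^sup>2" unfolding k_def using q r by (intro power_mono) auto
  \<comment> \<open>This says \<omega> 1 \<ge> 0: the difference \<phi> is convex at its critical
    point 1.\<close>
  have k2: "2 * k \<le> \<sigma> * r"
  proof -
    have "r / (q - 1) = r * \<sigma> / (1 + r)" using \<sigma> q by (simp add: q_eq r field_simps)
    then have k: "k = (r * \<sigma>) * ((r * \<sigma>) / (1 + r)\<^sup>2)"
      by (simp add: k_def power2_eq_square)
    have "\<sigma> = 1 - r" "0 \<le> 1 + 3 * r\<^sup>2" using r by simp_all
    then have "2 * (r * \<sigma>) \<le> (1 + r)\<^sup>2"
      unfolding \<open>\<sigma> = 1 - r\<close> by (simp add: power2_eq_square algebra_simps)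
    then have "(r * \<sigma>) / (1 + r)\<^sup>2 \<le> 1 / 2" using r by (simp add: divide_le_eq)
    then have "k \<le> (r * \<sigma>) * (1 / 2)" unfolding k using r \<sigma> by (intro mult_left_mono) auto
    then show ?thesis by (simp add: mult.commute)
  qed
  define \<phi> where "\<phi> t = 1 + \<sigma> * (t - 1) - k * (t - 1)\<^sup>2 - t powr \<sigma>" for t
  define \<psi> where "\<psi> t = \<sigma> - 2 * k * (t - 1) - \<sigma> * t powr (\<sigma> - 1)" for t
  define \<omega> where "\<omega> t = \<sigma> * r * t powr (\<sigma> - 2) - 2 * k" for t
  have d\<phi>: "(\<phi> has_real_derivative \<psi> t) (at t)" if "0 < t" for t
    unfolding \<phi>_def \<psi>_def using that
    by (auto intro!: derivative_eq_intros simp: power2_eq_square)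
  have d\<psi>: "(\<psi> has_real_derivative \<omega> t) (at t)" if "0 < t" for t
    unfolding \<psi>_def \<omega>_def using that
    by (auto intro!: derivative_eq_intros simp: r algebra_simps)
  have \<omega>_mono: "\<omega> t \<le> \<omega> s" if "0 < s" "s \<le> t" for s t
    unfolding \<omega>_def using that \<sigma> r by (intro diff_right_mono mult_left_mono powr_mono2') auto
  have one: "\<phi> 1 = 0" "\<psi> 1 = 0" by (simp_all add: \<phi>_def \<psi>_def)
  \<comment> \<open>The choice of k gives k (q - 1)^2 = r^2, so the quadratic takes the value (1 +
    \<sigma>)(2 - \<sigma>) at q = 2 / \<sigma>. Young's inequality bounds the two factors of
    q^\<sigma> = 2^\<sigma> (1 / \<sigma>)^\<sigma> by exactly these numbers.\<close>
  have \<phi>q: "0 \<le> \<phi> q"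
  proof -
    have "(2 powr \<sigma>) \<le> 1 + \<sigma>"
    proof (cases "\<sigma> = 1")
      case False
      then show ?thesis using \<sigma> Young_powr[of 2 1 \<sigma> "1 - \<sigma>"] by simp
    qed simp
    moreover have "(1 / \<sigma>) powr \<sigma> \<le> 2 - \<sigma>"
    proof (cases "\<sigma> = 1")
      case False
      then show ?thesis using \<sigma> Young_powr[of "1 / \<sigma>" 1 \<sigma> "1 - \<sigma>"] by simp
    qed simp
    ultimately have "2 powr \<sigma> * (1 / \<sigma>) powr \<sigma> \<le> (1 + \<sigma>) * (2 - \<sigma>)"
      using \<sigma> by (intro mult_mono) auto
    moreover have "q powr \<sigma> = 2 powr \<sigma> * (1 / \<sigma>) powr \<sigma>"
      using \<sigma> by (simp add: q_eq flip: powr_mult)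
    moreover have "k * (q - 1)\<^sup>2 = r\<^sup>2" using q by (simp add: k_def power_divide)
    moreover have "\<sigma> * (q - 1) = 2 - \<sigma>" using \<sigma> by (simp add: q_eq field_simps)
    ultimately show ?thesis by (simp add: \<phi>_def r power2_eq_square algebra_simps)
  qed
  have "0 \<le> \<phi> y"
  proof (cases "y = 0")
    case True
    have "k \<le> r" using k_le r by (simp add: power2_eq_square mult_left_le order_trans)
    then show ?thesis using True by (simp add: \<phi>_def r)
  next
    case y0: False
    show ?thesis
    proof (rule ccontr)
      assume neg: "\<not> 0 \<le> \<phi> y"
      then consider "y < 1" | "1 < y" using one by (cases y "1::real" rule: linorder_cases) auto
      then show False
      proof cases
        case 1
        \<comment> \<open>Left of 1, a negative value of \<phi> forces \<psi> > 0 somewhere and then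
          \<omega> < 0 before 1, although \<omega> decreases to \<omega> 1 \<ge> 0.\<close>
        obtain a where a: "y < a" "a < 1" "\<phi> 1 - \<phi> y = (1 - y) * \<psi> a"
          using MVT2[OF 1, of \<phi> \<psi>] d\<phi> y0 y by fastforce
        then have "0 < (1 - y) * \<psi> a" using neg one by simp
        then have "0 < \<psi> a" using 1 by (simp add: zero_less_mult_iff)
        obtain c where c: "a < c" "c < 1" "\<psi> 1 - \<psi> a = (1 - a) * \<omega> c"
          using MVT2[OF a(2), of \<psi> \<omega>] d\<psi> y0 y a by fastforce
        have "\<omega> 1 \<le> \<omega> c" using c a y y0 by (intro \<omega>_mono) auto
        then have "0 \<le> \<omega> c" using k2 by (simp add: \<omega>_def)
        then have "0 \<le> (1 - a) * \<omega> c" using a by simp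
        then show False using c one \<open>0 < \<psi> a\<close> by simp
      next
        case 2
        \<comment> \<open>Right of 1, \<phi> would fall from 0 to a negative value and return to
          \<phi> q \<ge> 0. Then \<omega> would be negative first and positive later, contrary to
          its monotonicity.\<close>
        have "y < q" using neg \<phi>q y by (cases "y = q") auto
        obtain a where a: "1 < a" "a < y" "\<phi> y - \<phi> 1 = (y - 1) * \<psi> a"
          using MVT2[OF 2, of \<phi> \<psi>] d\<phi> by fastforce
        then have "\<psi> a < 0" using neg one 2 by (simp add: mult_less_0_iff not_le)
        obtain b where b: "y < b" "b < q" "\<phi> q - \<phi> y = (q - y) * \<psi> b"
          using MVT2[OF \<open>y < q\<close>, of \<phi> \<psi>] d\<phi> 2 by fastforce
        then have "0 < (q - y) * \<psi> b" using neg \<phi>q by simp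
        then have "0 < \<psi> b" using \<open>y < q\<close> by (simp add: zero_less_mult_iff)
        obtain c where c: "1 < c" "c < a" "\<psi> a - \<psi> 1 = (a - 1) * \<omega> c"
          using MVT2[OF a(1), of \<psi> \<omega>] d\<psi> by fastforce
        then have "\<omega> c < 0" using \<open>\<psi> a < 0\<close> one a by (simp add: mult_less_0_iff)
        obtain d where d: "a < d" "d < b" "\<psi> b - \<psi> a = (b - a) * \<omega> d"
          using MVT2[of a b \<psi> \<omega>] d\<psi> a b by fastforce
        then have "0 < (b - a) * \<omega> d" using \<open>\<psi> a < 0\<close> \<open>0 < \<psi> b\<close> by simp
        then have "0 < \<omega> d" using d by (simp add: zero_less_mult_iff)
        moreover have "\<omega> d \<le> \<omega> c" using c d by (intro \<omega>_mono) auto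
        ultimately show False using \<open>\<omega> c < 0\<close> by simp
      qed
    qed
  qed
  then show ?thesis by (simp add: \<phi>_def \<sigma>_def k_def)
qed

text \<open>This is the estimate behind the constant 10, with a and b standing for norm g and norm z
  in \<open>first_order_bound_aux\<close>. Setting c = 2 b / (1 + r), Cauchy-Schwarz gives (a + c)^2
  <= (1/A + 1/B)(A a^2 + B c^2), so it remains to check (9 r - 1)(A + B) <= A B. Multiplied by 1 -
  r, this is a polynomial inequality of degree 5 in r.\<close>

lemma quadratic_form_bound:
  fixes r a b :: real
  assumes r: "0 \<le> r" "r < 1" and ab: "0 \<le> a" "0 \<le> b"
  shows "(9 * r - 1) * (a + 2 / (1 + r) * b)\<^sup>2
    \<le> 16 * b\<^sup>2 + (10 * r\<^sup>2 + (1 + r)\<^sup>2 / (1 - r)) * a\<^sup>2"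
proof (cases "9 * r - 1 \<le> 0")
  case True
  then have "(9 * r - 1) * (a + 2 / (1 + r) * b)\<^sup>2 \<le> 0" by (simp add: mult_le_0_iff)
  moreover have "0 \<le> (10 * r\<^sup>2 + (1 + r)\<^sup>2 / (1 - r)) * a\<^sup>2" using r by simp
  ultimately show ?thesis using zero_le_power2[of b] by linarith
next
  case False
  define c where "c = 2 / (1 + r) * b"
  define B where "B = 4 * (1 + r)\<^sup>2"
  define D where "D = 10 * r\<^sup>2 * (1 - r) + (1 + r)\<^sup>2"
  define A where "A = D / (1 - r)"
  have A_eq: "10 * r\<^sup>2 + (1 + r)\<^sup>2 / (1 - r) = A" using r by (simp add: A_def D_def field_simps)
  have "0 < D" using r by (auto simp: D_def intro!: add_nonneg_pos)
  then have pos: "0 < B" "0 < D" "0 < A" using r by (auto simp: B_def A_def)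
  have "16 * b\<^sup>2 = B * c\<^sup>2" using r by (simp add: B_def c_def power_mult_distrib power_divide)
  moreover have "(9 * r - 1) * (a + c)\<^sup>2 \<le> B * c\<^sup>2 + A * a\<^sup>2"
  proof -
    \<comment> \<open>Of the 90 r^4, 50 absorb the cubic term and 40 absorb r^5. Completing squares
      with 441/200 = 21^2 / (4 * 50) and 529/36 = 23^2 / (4 * 9) uses up slightly less than the
      available 17 r^2.\<close>
    have "21 * r ^ 3 \<le> 50 * r ^ 4 + 441 / 200 * r\<^sup>2"
      using zero_le_power2[of "r * (r - 21 / 100)"]
      by (simp add: power2_eq_square power3_eq_cube power4_eq_xxxx algebra_simps)
    moreover have "23 * r \<le> 9 + 529 / 36 * r\<^sup>2"
      using zero_le_power2[of "1 - 23 / 18 * r"] by (simp add: power2_eq_square algebra_simps)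
    moreover have "r ^ 5 \<le> r ^ 4" using r by (intro power_decreasing) auto
    moreover have "0 \<le> r\<^sup>2" by simp
    ultimately have "0 \<le> 9 - 23 * r + 17 * r\<^sup>2 - 21 * r ^ 3 + 90 * r ^ 4 - 40 * r ^ 5"
      by linarith
    also have "\<dots> = B * D - (9 * r - 1) * (B * (1 - r) + D)"
      by (simp add: B_def D_def power2_eq_square power3_eq_cube power4_eq_xxxx
          power_numeral_odd algebra_simps)
    finally have le: "(9 * r - 1) * (B * (1 - r) + D) \<le> B * D" by simp
    have "D = A * (1 - r)" using r by (simp add: A_def)
    with le have "((9 * r - 1) * (B + A)) * (1 - r) \<le> (A * B) * (1 - r)"
      by (simp add: algebra_simps)
    then have "(9 * r - 1) * (B + A) \<le> A * B" by (rule mult_right_le_imp_le) (use r in simp)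
    then have "(9 * r - 1) * (B + A) / (A * B) \<le> 1" using pos by simp
    then have le: "(9 * r - 1) * (1 / A + 1 / B) \<le> 1" using pos by (simp add: field_simps)
    have "0 \<le> (A * a - B * c)\<^sup>2 / (A * B)" using pos by simp
    then have "(a + c)\<^sup>2 \<le> (1 / A + 1 / B) * (A * a\<^sup>2 + B * c\<^sup>2)"
      using pos by (simp add: power2_eq_square field_simps)
    then have "(9 * r - 1) * (a + c)\<^sup>2 \<le> (9 * r - 1) * ((1 / A + 1 / B) * (A * a\<^sup>2 + B * c\<^sup>2))"
      using False by (intro mult_left_mono) auto
    also have "\<dots> = ((9 * r - 1) * (1 / A + 1 / B)) * (A * a\<^sup>2 + B * c\<^sup>2)" by simp
    also have "\<dots> \<le> 1 * (A * a\<^sup>2 + B * c\<^sup>2)" using pos by (intro mult_right_mono le) auto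
    finally show ?thesis by simp
  qed
  ultimately show ?thesis by (simp add: A_eq c_def)
qed

text \<open>The threshold a = 7/2 N1 is where the surplus 7 N1 e stops covering 2 e a. Below it each
  family pays its own defect. Above it the bound 2 (a - N1)^2 <= M2 takes over, one third of the
  surplus of M2 paying for d b and two thirds for the rest of e a.\<close>

lemma first_order_defect_bound:
  fixes a b M1 M2 N1 N2 :: real
  assumes b: "0 \<le> b" "b \<le> a" "b \<le> 2 * N1" and a: "a \<le> 2 * M1"
    and M2: "a\<^sup>2 \<le> M2" "10 * M1 * a \<le> M2 + 9 * M1\<^sup>2" "N1 \<le> a \<Longrightarrow> 2 * (a - N1)\<^sup>2 \<le> M2"
    and N2: "b\<^sup>2 \<le> N2" "10 * N1 * b \<le> N2 + 9 * N1\<^sup>2"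
  shows "2 * max 0 (a - M1) * b + 2 * max 0 (b - N1) * a \<le> (M2 - a\<^sup>2) + (N2 - b\<^sup>2)"
proof -
  define d e where "d = max 0 (a - M1)" and "e = max 0 (b - N1)"
  have N1: "0 \<le> N1" using b by simp
  have d0: "0 \<le> d" and e0: "0 \<le> e" and e_le: "e \<le> N1"
    using b by (auto simp: d_def e_def)
  \<comment> \<open>From M2 - a^2 >= d (9 M1 - a) with M1 = a - d; the leftover d (9/2 a - 9 d) is
    nonnegative because a <= 2 M1 means 2 d <= a.\<close>
  have m: "7 / 2 * a * d \<le> M2 - a\<^sup>2"
  proof (cases "d = 0")
    case False
    then have d: "M1 = a - d" "0 < d" by (auto simp: d_def max_def split: if_splits)
    have "0 \<le> d * (9 / 2 * a - 9 * d)" using a d by (intro mult_nonneg_nonneg) auto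
    then show ?thesis using M2(2) unfolding d(1) by (simp add: power2_eq_square algebra_simps)
  qed (use M2 in simp)
  have l: "7 * N1 * e \<le> N2 - b\<^sup>2"
  proof (cases "e = 0")
    case False
    then have e: "b = N1 + e" "0 < e" by (auto simp: e_def max_def split: if_splits)
    have "0 \<le> e * (N1 - e)" using e e_le by (intro mult_nonneg_nonneg) auto
    then show ?thesis using N2(2) unfolding e(1) by (simp add: power2_eq_square algebra_simps)
  qed (use N2 in simp)
  have "2 * d * b + 2 * e * a \<le> (M2 - a\<^sup>2) + (N2 - b\<^sup>2)"
  proof (cases "a \<le> 7 / 2 * N1")
    case True
    have "e * a \<le> e * (7 / 2 * N1)" by (intro mult_left_mono True e0)
    moreover have "d * b \<le> d * a" by (intro mult_left_mono b d0)
    moreover have "0 \<le> a * d" using b d0 by simp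
    ultimately show ?thesis using m l by (simp add: mult_ac)
  next
    case False
    then have m': "a\<^sup>2 - 4 * a * N1 + 2 * N1\<^sup>2 \<le> M2 - a\<^sup>2"
      using M2(3) N1 by (simp add: power2_eq_square algebra_simps)
    have "d * b \<le> d * (2 * N1)" by (intro mult_left_mono b d0)
    moreover have "d * N1 \<le> d * (2 / 7 * a)" using False by (intro mult_left_mono d0) simp
    moreover have "0 \<le> (2 * a - 7 * N1) * (N1 - e)"
      using False e_le by (intro mult_nonneg_nonneg) auto
    \<comment> \<open>Bounding e by N1 in e (2 a - 7 N1), the two thirds of m' exceed it by exactly
      this sum of squares. The other third suffices for d b since 2 d b <= 8/7 a d <= 7/6 a
      d.\<close>
    moreover have "0 \<le> 2 / 3 * (a - 7 / 2 * N1)\<^sup>2 + 1 / 6 * N1\<^sup>2" by simp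
    moreover have "0 \<le> a * d" using b d0 by simp
    ultimately show ?thesis using m m' l by (simp add: power2_eq_square algebra_simps)
  qed
  then show ?thesis by (simp add: d_def e_def)
qed

text \<open>Only the summands k = 1 and k = n - 1 have defects, n d b^(n-1) and n e a^(n-1). They
  are charged to the surplus n/2 a^(n-2) (M 2 - a^2) inside M n and to the surplus of N 2 in the
  summand k = n - 2. The surplus of N n would not do: it carries b^(n-2), which may be far smaller
  than a^(n-2).\<close>

lemma binomial_defect_bound:
  fixes M N :: "nat \<Rightarrow> real" and a b :: real
  assumes n: "2 \<le> n" and ab: "0 \<le> b" "b \<le> a" and pos: "0 \<le> M 1" "0 \<le> N 1" "a \<le> 2 * M 1"
    and M2: "a\<^sup>2 \<le> M 2" and N2: "b\<^sup>2 \<le> N 2"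
    and M: "\<And>k. 2 \<le> k \<Longrightarrow> a ^ k + real k / 2 * a ^ (k - 2) * (M 2 - a\<^sup>2) \<le> M k"
    and N: "\<And>k. 2 \<le> k \<Longrightarrow> b ^ k \<le> N k"
    and defect: "2 * max 0 (a - M 1) * b + 2 * max 0 (b - N 1) * a \<le> (M 2 - a\<^sup>2) + (N 2 - b\<^sup>2)"
  shows "(a + b) ^ n \<le> M n + N n + (\<Sum>k = 1..n - 1. real (n choose k) * M k * N (n - k))"
proof -
  define d e where "d = max 0 (a - M 1)" and "e = max 0 (b - N 1)"
  define m l where "m = M 2 - a\<^sup>2" and "l = N 2 - b\<^sup>2"
  have a0: "0 \<le> a" using ab by simp
  have de: "0 \<le> d" "0 \<le> e" "0 \<le> a - d" "a - d \<le> M 1" "0 \<le> b - e" "b - e \<le> N 1" "a / 2 \<le> a - d"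
    using ab pos by (auto simp: d_def e_def max_def)
  have ml: "0 \<le> m" "0 \<le> l" using M2 N2 by (auto simp: m_def l_def)
  have defect': "2 * d * b + 2 * e * a \<le> m + l" using defect by (simp add: d_def e_def m_def l_def)
  have N20: "0 \<le> N 2" using N2 zero_le_power2[of b] by linarith
  have Mk: "a ^ k \<le> M k" if "2 \<le> k" for k
  proof -
    have "0 \<le> real k / 2 * a ^ (k - 2) * (M 2 - a\<^sup>2)" using a0 M2 by simp
    then show ?thesis using M[OF that] by linarith
  qed
  have Mk0: "0 \<le> M k" if "2 \<le> k" for k using Mk[OF that] zero_le_power[OF a0, of k] by linarith
  have expand: "(a + b) ^ n = a ^ n + b ^ n + (\<Sum>k = 1..n - 1. real (n choose k) * a ^ k * b ^ (n - k))"
  proof -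
    have "{..n} = insert 0 (insert n {1..n - 1})" using n by auto
    then show ?thesis using n by (simp add: binomial_ring mult.assoc)
  qed
  show ?thesis
  proof (cases "n = 2")
    case True
    have "(a - d) * (b - e) \<le> M 1 * N 1" using de by (intro mult_mono) auto
    moreover have "0 \<le> d * e" using de by simp
    ultimately have "a * b - d * b - e * a \<le> M 1 * N 1" by (simp add: algebra_simps)
    then show ?thesis using defect' unfolding True
      by (simp add: power2_sum m_def l_def numeral_2_eq_2 [symmetric] algebra_simps)
  next
    case False
    then have n3: "3 \<le> n" using n by simp
    \<comment> \<open>\<delta> k is the guaranteed gain of the summand k. Only half of l a^(n-2) is
      booked because for n = 3 the index n - 2 equals 1, where M 1 is known to be at least a / 2 but
      not a. Gain and loss then meet in one summand.\<close>
    define \<delta> where "\<delta> k = (if k = n - 2 then l * a ^ (n - 2) / 2 else 0)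
      - (if k = 1 then d * b ^ (n - 1) else 0) - (if k = n - 1 then e * a ^ (n - 1) else 0)" for k
    have summand: "a ^ k * b ^ (n - k) + \<delta> k \<le> M k * N (n - k)" if k: "1 \<le> k" "k \<le> n - 1" for k
    proof -
      consider "k = n - 1" | "k = n - 2" "2 \<le> k" | "k = n - 2" "k = 1" | "k = 1" "k \<noteq> n - 2" "k \<noteq> n - 1"
        | "2 \<le> k" "k < n - 2" using k n3 by linarith
      then show ?thesis
      proof cases
        case 1
        have "a ^ (n - 1) * (b - e) \<le> M (n - 1) * N 1"
          using n3 de a0 Mk[of "n - 1"] Mk0[of "n - 1"] by (intro mult_mono) auto
        moreover have "\<delta> k = - (e * a ^ (n - 1))" "n - k = 1" using 1 n3 by (auto simp: \<delta>_def)
        ultimately show ?thesis using 1 by (simp add: algebra_simps)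
      next
        case 2
        have "a ^ (n - 2) * (b\<^sup>2 + l) \<le> M (n - 2) * N 2"
          using 2 Mk[of "n - 2"] Mk0[of "n - 2"] a0 ml N20 by (intro mult_mono) (auto simp: l_def)
        moreover have "0 \<le> l * a ^ (n - 2)" using ml a0 by simp
        moreover have "\<delta> k = l * a ^ (n - 2) / 2" "n - k = 2" using 2 n3 by (auto simp: \<delta>_def)
        ultimately show ?thesis using 2 by (simp add: algebra_simps)
      next
        case 3
        then have n: "n = 3" using n3 by simp
        have "(a - d) * (b\<^sup>2 + l) \<le> M 1 * N 2"
          using de ml pos N20 by (intro mult_mono) (auto simp: l_def)
        moreover have "a / 2 * l \<le> (a - d) * l" using de ml by (intro mult_right_mono) auto
        ultimately have "a ^ 1 * b\<^sup>2 + (l * a / 2 - d * b\<^sup>2) \<le> M 1 * N 2"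
          by (simp add: algebra_simps)
        moreover have "\<delta> k = l * a / 2 - d * b\<^sup>2" "n - k = 2" using 3 n by (auto simp: \<delta>_def)
        ultimately show ?thesis using 3(2) by (simp only:)
      next
        case 4
        have "(a - d) * b ^ (n - 1) \<le> M 1 * N (n - 1)"
          using de ab pos N[of "n - 1"] n3 by (intro mult_mono) auto
        moreover have "\<delta> k = - (d * b ^ (n - 1))" using 4 by (simp add: \<delta>_def)
        ultimately show ?thesis using 4 by (simp add: algebra_simps)
      next
        case 5
        have "a ^ k * b ^ (n - k) \<le> M k * N (n - k)"
          using 5 a0 ab Mk[of k] Mk0[of k] N[of "n - k"] by (intro mult_mono) auto
        moreover have "\<delta> k = 0" using 5 by (auto simp: \<delta>_def)
        ultimately show ?thesis by simp
      qed
    qed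
    have "(\<Sum>k = 1..n - 1. real (n choose k) * a ^ k * b ^ (n - k))
        + (\<Sum>k = 1..n - 1. real (n choose k) * \<delta> k)
        \<le> (\<Sum>k = 1..n - 1. real (n choose k) * M k * N (n - k))"
      unfolding sum.distrib[symmetric]
    proof (rule sum_mono)
      fix k assume "k \<in> {1..n - 1}"
      then have "real (n choose k) * (a ^ k * b ^ (n - k) + \<delta> k) \<le> real (n choose k) * (M k * N (n - k))"
        by (intro mult_left_mono summand) auto
      then show "real (n choose k) * a ^ k * b ^ (n - k) + real (n choose k) * \<delta> k
          \<le> real (n choose k) * M k * N (n - k)"
        by (simp add: algebra_simps)
    qed
    moreover have "(\<Sum>k = 1..n - 1. real (n choose k) * \<delta> k)
        = real (n choose (n - 2)) * (l * a ^ (n - 2) / 2) - real n * (d * b ^ (n - 1))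
          - real (n choose (n - 1)) * (e * a ^ (n - 1))"
    proof -
      have "real (n choose k) * \<delta> k
          = (if k = n - 2 then real (n choose (n - 2)) * (l * a ^ (n - 2) / 2) else 0)
          - (if k = 1 then real n * (d * b ^ (n - 1)) else 0)
          - (if k = n - 1 then real (n choose (n - 1)) * (e * a ^ (n - 1)) else 0)" for k
        using n3 by (cases "n = 3") (auto simp: \<delta>_def right_diff_distrib)
      moreover have "n - 2 \<in> {1..n - 1}" "1 \<in> {1..n - 1}" "n - 1 \<in> {1..n - 1}" using n3 by auto
      ultimately show ?thesis by (simp only: sum_subtractf sum.delta finite_atLeastAtMost if_True)
    qed
    moreover have "n choose (n - 1) = n" using n3 binomial_symmetric[of "n - 1" n] by simp
    moreover have "real n / 2 * a ^ (n - 2) * l \<le> real (n choose (n - 2)) * (l * a ^ (n - 2) / 2)"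
    proof -
      have "2 dvd n * (n - 1)" by (cases "even n") auto
      then have choose: "real (n choose (n - 2)) = real n * real (n - 1) / 2"
        using n3 binomial_symmetric[of "n - 2" n] real_of_nat_div[of 2 "n * (n - 1)"]
        by (simp add: choose_two)
      \<comment> \<open>The binomial weight n (n - 1) / 2 makes up for the half given away in
        \<delta>; this is where n >= 3 enters.\<close>
      have "0 \<le> real n / 2 * a ^ (n - 2) * l * (real (n - 1) / 2 - 1)"
        using n3 a0 ml by (intro mult_nonneg_nonneg) auto
      then show ?thesis unfolding choose by (simp add: algebra_simps)
    qed
    moreover have "real n * (d * b ^ (n - 1)) + real n * (e * a ^ (n - 1))
        \<le> real n / 2 * a ^ (n - 2) * m + real n / 2 * a ^ (n - 2) * l"
    proof -
      have "n - 1 = Suc (n - 2)" using n3 by simp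
      then have "b ^ (n - 1) = b * b ^ (n - 2)" "a ^ (n - 1) = a * a ^ (n - 2)"
        by (simp_all only: power_Suc)
      moreover have "d * (b * b ^ (n - 2)) \<le> d * (b * a ^ (n - 2))"
        using de ab by (intro mult_left_mono power_mono) auto
      ultimately have "d * b ^ (n - 1) + e * a ^ (n - 1) \<le> a ^ (n - 2) / 2 * (2 * d * b + 2 * e * a)"
        by (simp add: algebra_simps)
      also have "\<dots> \<le> a ^ (n - 2) / 2 * (m + l)" using a0 by (intro mult_left_mono defect') auto
      finally have "real n * (d * b ^ (n - 1) + e * a ^ (n - 1)) \<le> real n * (a ^ (n - 2) / 2 * (m + l))"
        by (intro mult_left_mono) auto
      then show ?thesis by (simp add: algebra_simps)
    qed
    moreover have "a ^ n + real n / 2 * a ^ (n - 2) * m \<le> M n" unfolding m_def by (rule M[OF n])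
    moreover have "b ^ n \<le> N n" by (rule N[OF n])
    ultimately show ?thesis unfolding expand by (simp only:)
  qed
qed

section \<open>Powers and absolute values of operators\<close>

lemma continuous_on_powr_nonneg: "0 < s \<Longrightarrow> continuous_on {0..} (\<lambda>t :: real. t powr s)"
  by (intro continuous_on_powr' continuous_on_id continuous_on_const) auto

lemma continuous_on_powr_Icc: "0 < s \<Longrightarrow> continuous_on {0..b} (\<lambda>t :: real. t powr s)"
  by (rule continuous_on_subset[OF continuous_on_powr_nonneg]) auto

lemma positive_op_op_powr:
  "positive_op P \<Longrightarrow> 0 < s \<Longrightarrow> positive_op (op_powr P s :: 'a::chilbert_space \<Rightarrow>\<^sub>L 'a)"
  unfolding op_powr_def by (rule positive_op_cfc[OF _ continuous_on_powr_Icc]) auto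

lemma op_powr_cfc:
  fixes P :: "'a::chilbert_space \<Rightarrow>\<^sub>L 'a"
  assumes "positive_op P" "continuous_on {0..norm P} f"
    and "\<And>t. 0 \<le> t \<Longrightarrow> t \<le> norm P \<Longrightarrow> 0 \<le> f t" and "0 < s"
  shows "op_powr (cfc f P) s = cfc (\<lambda>t. f t powr s) P"
  unfolding op_powr_def by (rule cfc_compose) (use assms continuous_on_powr_nonneg in auto)

lemma op_powr_op_powr:
  fixes P :: "'a::chilbert_space \<Rightarrow>\<^sub>L 'a"
  assumes "positive_op P" "0 < s" "0 < u"
  shows "op_powr (op_powr P s) u = op_powr P (s * u)"
  using op_powr_cfc[OF assms(1) continuous_on_powr_Icc[OF assms(2)] _ assms(3)]
  by (simp add: op_powr_def powr_powr)

lemma op_powr_one: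
  fixes P :: "'a::chilbert_space \<Rightarrow>\<^sub>L 'a"
  assumes "positive_op P"
  shows "op_powr P 1 = P"
proof -
  have "op_powr P 1 = cfc (\<lambda>t. t) P" unfolding op_powr_def by (rule cfc_cong[OF assms]) simp
  then show ?thesis by (simp add: cfc_ident[OF assms])
qed

lemma op_powr_add:
  fixes P :: "'a::chilbert_space \<Rightarrow>\<^sub>L 'a"
  assumes "positive_op P" "0 < s" "0 < u"
  shows "op_powr P (s + u) = op_powr P s o\<^sub>L op_powr P u"
  using cfc_mult[OF assms(1) continuous_on_powr_Icc continuous_on_powr_Icc, OF assms(2,3)]
  by (simp add: op_powr_def powr_add)

lemma cinner_op_powr_double:
  fixes P :: "'a::chilbert_space \<Rightarrow>\<^sub>L 'a"
  assumes "positive_op P" "0 < s"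
  shows "Re (cinner (op_powr P (2 * s) x) x) = (norm (op_powr P s x))\<^sup>2"
  unfolding mult_2 op_powr_add[OF assms assms(2)] using positive_op_op_powr[OF assms]
  by (simp add: self_adjointD positive_op_self_adjoint norm_power2_cinner)

text \<open>Applied to P = (P^s)^(1/s), the upper bound \<open>norm_cfc_le\<close> turns into a
  lower bound for norm (P^s), without knowing that norm P lies in the spectrum.\<close>

lemma norm_op_powr_ge:
  fixes P :: "'a::chilbert_space \<Rightarrow>\<^sub>L 'a"
  assumes P: "positive_op P" and s: "0 < s"
  shows "norm P powr s \<le> norm (op_powr P s)"
proof -
  define L where "L = norm (op_powr P s)"
  have Q: "positive_op (op_powr P s)" by (rule positive_op_op_powr[OF P s])
  have "norm (op_powr (op_powr P s) (1 / s)) \<le> L powr (1 / s)"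
    unfolding op_powr_def[of "op_powr P s"]
    by (rule norm_cfc_le[OF Q continuous_on_powr_Icc]) (use s in \<open>auto simp: L_def intro: powr_mono2\<close>)
  then have "norm P \<le> L powr (1 / s)" using P s by (simp add: op_powr_op_powr op_powr_one)
  then have "norm P powr s \<le> (L powr (1 / s)) powr s" using s by (intro powr_mono2) auto
  then show ?thesis using s by (simp add: powr_powr L_def)
qed

lemma positive_op_abs_op: "A \<in> bounded_operators \<Longrightarrow> positive_op (abs_op A)"
  unfolding abs_op_def by (intro positive_op_op_powr positive_op_adj_compose) auto

lemma norm_abs_op_apply:
  assumes A: "A \<in> bounded_operators"
  shows "norm (abs_op A x) = norm (blinfun_apply A x)"
proof -
  have pos: "positive_op (adj A o\<^sub>L A)" by (rule positive_op_adj_compose[OF A])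
  have "(norm (abs_op A x))\<^sup>2 = Re (cinner (op_powr (adj A o\<^sub>L A) 1 x) x)"
    using cinner_op_powr_double[OF pos, of "1/2" x] by (simp add: abs_op_def)
  also have "\<dots> = (norm (A x))\<^sup>2" by (simp only: op_powr_one[OF pos] Re_cinner_adj_compose[OF A])
  finally show ?thesis by (rule power2_eq_imp_eq) auto
qed

lemma norm_abs_op_ge:
  assumes A: "A \<in> bounded_operators"
  shows "norm A \<le> norm (abs_op A)"
  by (rule norm_blinfun_bound) (simp_all add: norm_blinfun flip: norm_abs_op_apply[OF A])

text \<open>Every scalar majorant below is a polynomial of degree at most 2 in one function w.
  Simpler ones are padded with zero coefficients so that this single evaluation rule matches
  them.\<close>

lemma cinner_cfc_quadratic:
  fixes P :: "'a::chilbert_space \<Rightarrow>\<^sub>L 'a"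
  assumes P: "positive_op P" and w: "continuous_on {0..norm P} w"
  shows "Re (cinner (cfc (\<lambda>t. a0 + a1 * w t + a2 * (w t)\<^sup>2) P x) x)
    = a0 * (norm x)\<^sup>2 + a1 * Re (cinner (cfc w P x) x) + a2 * (norm (cfc w P x))\<^sup>2"
proof -
  have "cfc (\<lambda>t. a0 + a1 * w t + a2 * (w t)\<^sup>2) P
      = a0 *\<^sub>R id_blinfun + a1 *\<^sub>R cfc w P + a2 *\<^sub>R (cfc w P o\<^sub>L cfc w P)"
  proof -
    have c1: "continuous_on {0..norm P} (\<lambda>t. a1 * w t)"
      and c2: "continuous_on {0..norm P} (\<lambda>t. w t * w t)"
      and c3: "continuous_on {0..norm P} (\<lambda>t. a2 * (w t * w t))"
      by (intro continuous_on_mult continuous_on_const w)+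
    show ?thesis
      unfolding power2_eq_square
        cfc_add[OF P continuous_on_add[OF continuous_on_const c1] c3]
        cfc_add[OF P continuous_on_const c1] cfc_const[OF P]
        cfc_scaleR[OF P w] cfc_scaleR[OF P c2] cfc_mult[OF P w w] ..
  qed
  moreover have "cinner (cfc w P (cfc w P x)) x = cinner (cfc w P x) (cfc w P x)"
    by (rule self_adjointD[OF self_adjoint_cfc[OF P w]])
  ultimately show ?thesis
    by (simp add: plus_blinfun.rep_eq scaleR_blinfun.rep_eq cinner_simps cinner_self)
qed

text \<open>The concave function t^\<theta> lies below its tangent at every c > 0, and the calculus
  preserves that affine bound. Taking c = E gives the claim if E > 0.\<close>

lemma cfc_powr_Jensen:
  fixes P :: "'a::chilbert_space \<Rightarrow>\<^sub>L 'a"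
  assumes P: "positive_op P" and w: "continuous_on {0..norm P} w"
    and nonneg: "\<And>t. 0 \<le> t \<Longrightarrow> t \<le> norm P \<Longrightarrow> 0 \<le> w t"
    and \<theta>: "0 < \<theta>" "\<theta> < 1" and x: "norm x = 1"
  shows "Re (cinner (cfc (\<lambda>t. w t powr \<theta>) P x) x) \<le> Re (cinner (cfc w P x) x) powr \<theta>"
proof -
  define E F where "E = Re (cinner (cfc w P x) x)"
    and "F = Re (cinner (cfc (\<lambda>t. w t powr \<theta>) P x) x)"
  have E0: "0 \<le> E" unfolding E_def by (rule positive_opD[OF positive_op_cfc[OF P w nonneg]])
  have wt: "continuous_on {0..norm P} (\<lambda>t. w t powr \<theta>)"
    by (rule continuous_on_powr'[OF w continuous_on_const]) (use nonneg \<theta> in auto)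
  have bound: "F \<le> \<theta> * (c powr (\<theta> - 1) * E) + (1 - \<theta>) * c powr \<theta>" if c: "0 < c" for c
  proof -
    have "F \<le> Re (cinner (cfc (\<lambda>t. c powr (\<theta> - 1) * (1 - \<theta>) * c
        + c powr (\<theta> - 1) * \<theta> * w t + 0 * (w t)\<^sup>2) P x) x)"
      unfolding F_def
    proof (rule cfc_mono[OF P wt])
      fix t assume t: "0 \<le> t" "t \<le> norm P"
      have "w t powr \<theta> * c powr (1 - \<theta>) \<le> \<theta> * w t + (1 - \<theta>) * c"
        using nonneg[OF t] c \<theta> by (intro Young_powr) auto
      then have le: "c powr (\<theta> - 1) * (w t powr \<theta> * c powr (1 - \<theta>)) \<le> c powr (\<theta> - 1) * (\<theta> * w t + (1 - \<theta>) * c)"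
        by (intro mult_left_mono) auto
      have "c powr (\<theta> - 1) * c powr (1 - \<theta>) = 1" using c by (simp flip: powr_add)
      then have "w t powr \<theta> = c powr (\<theta> - 1) * (w t powr \<theta> * c powr (1 - \<theta>))"
        by (metis mult.assoc mult.commute mult_1)
      also note le
      also have "c powr (\<theta> - 1) * (\<theta> * w t + (1 - \<theta>) * c)
          = c powr (\<theta> - 1) * (1 - \<theta>) * c + c powr (\<theta> - 1) * \<theta> * w t + 0 * (w t)\<^sup>2"
        by (simp add: algebra_simps)
      finally show "w t powr \<theta> \<le> c powr (\<theta> - 1) * (1 - \<theta>) * c
          + c powr (\<theta> - 1) * \<theta> * w t + 0 * (w t)\<^sup>2" .
    qed (intro continuous_intros w)
    also have "\<dots> = \<theta> * (c powr (\<theta> - 1) * E) + (1 - \<theta>) * (c powr (\<theta> - 1) * c)"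
      unfolding cinner_cfc_quadratic[OF P w] by (simp add: x E_def algebra_simps)
    also have "c powr (\<theta> - 1) * c = c powr \<theta>" using c by (simp add: powr_diff)
    finally show ?thesis .
  qed
  have "F \<le> E powr \<theta>"
  proof (cases "E = 0")
    case True
    show ?thesis
    proof (rule ccontr)
      assume "\<not> F \<le> E powr \<theta>"
      then have F: "0 < F" using True by simp
      \<comment> \<open>For E = 0 the tangent at c leaves F <= (1 - \<theta>) c^\<theta>. This c
        makes c^\<theta> = F / 2, which contradicts F > 0.\<close>
      define c where "c = (F / 2) powr (1 / \<theta>)"
      have c: "0 < c" using F by (simp add: c_def)
      have "F \<le> (1 - \<theta>) * c powr \<theta>" using bound[OF c] True by simp
      also have "c powr \<theta> = F / 2" using F \<theta> by (simp add: c_def powr_powr)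
      finally have "F \<le> (1 - \<theta>) * (F / 2)" .
      moreover have "0 < \<theta> * F" using \<theta> F by simp
      ultimately show False using F by (simp add: algebra_simps)
    qed
  next
    case False
    then have E: "0 < E" using E0 by simp
    have "E powr (\<theta> - 1) * E = E powr \<theta>" using E by (simp add: powr_diff)
    then show ?thesis using bound[OF E] by (simp only:) (simp add: algebra_simps)
  qed
  then show ?thesis by (simp add: E_def F_def)
qed

section \<open>Young sums of powers of two positive operators\<close>

text \<open>Used for the pair \<open>abs_op T\<close>, \<open>abs_op (adj T)\<close> and again for
  the pair f(|S|), g(|adj S|). Interchanging (P, p) with (Q, q) leaves M unchanged, so one-sided
  facts transfer through \<open>swap\<close>.\<close>

locale young_pair =
  fixes P Q :: "'a::chilbert_space \<Rightarrow>\<^sub>L 'a" and p q :: real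
  assumes P: "positive_op P" and Q: "positive_op Q"
    and p: "1 < p" and q: "1 < q" and pq: "1 / p + 1 / q = 1"
begin

definition young_sum :: "nat \<Rightarrow> 'a \<Rightarrow>\<^sub>L 'a" where
  "young_sum k = (1 / p) *\<^sub>R op_powr P (real k * p) + (1 / q) *\<^sub>R op_powr Q (real k * q)"

definition M :: "nat \<Rightarrow> real" where
  "M k = norm (young_sum k)"

lemma M_nonneg: "0 \<le> M k"
  by (simp add: M_def)

lemma positive_op_young_sum: "1 \<le> k \<Longrightarrow> positive_op (young_sum k)"
  unfolding young_sum_def using p q P Q
  by (intro positive_op_add positive_op_scaleR positive_op_op_powr) auto

lemma cinner_young_sum:
  "Re (cinner (young_sum k x) x)
    = Re (cinner (op_powr P (real k * p) x) x) / p + Re (cinner (op_powr Q (real k * q) x) x) / q"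
  by (simp add: young_sum_def plus_blinfun.rep_eq scaleR_blinfun.rep_eq cinner_simps)

lemma young_sum_le:
  "Re (cinner (op_powr P (real k * p) x) x) / p + Re (cinner (op_powr Q (real k * q) x) x) / q
    \<le> M k * (norm x)\<^sup>2"
  using Re_cinner_blinfun_le[of "young_sum k" x] by (simp add: cinner_young_sum M_def)

lemma swap: "young_pair Q P q p"
  using P Q p q pq by unfold_locales (auto simp: add.commute)

lemma M_swap: "young_pair.M Q P q p k = M k"
  unfolding young_pair.M_def[OF swap] young_pair.young_sum_def[OF swap] M_def young_sum_def
  by (simp add: add.commute)

lemma norm_powr_le_M:
  assumes k: "1 \<le> k"
  shows "norm P powr (real k * p) \<le> p * M k"
proof -
  have kp: "0 < real k * p" "0 < real k * q" using k p q by auto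
  have "norm (op_powr P (real k * p)) \<le> p * M k"
  proof (rule positive_op_norm_le[OF positive_op_op_powr[OF P kp(1)]])
    fix y
    have "0 \<le> Re (cinner (op_powr Q (real k * q) y) y) / q"
      using positive_opD[OF positive_op_op_powr[OF Q kp(2)]] q by simp
    then have "Re (cinner (op_powr P (real k * p) y) y) / p \<le> M k * (norm y)\<^sup>2"
      using young_sum_le[of k y] by linarith
    then show "Re (cinner (op_powr P (real k * p) y) y) \<le> p * M k * (norm y)\<^sup>2"
      using p by (simp add: field_simps)
  qed (use p M_nonneg in simp)
  then show ?thesis using norm_op_powr_ge[OF P kp(1)] by simp
qed

text \<open>Each weighted summand of the Young sum is dominated by the whole, so Young's inequality
  costs only the factor 2. The cases k = 1 and k = 2 bound the norms of T and S by M 1, M 2 and N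
  1.\<close>

lemma norm_mult_power_le:
  assumes k: "1 \<le> k"
  shows "(norm P * norm Q) ^ k \<le> 2 * M k"
proof -
  have powr_eq: "(a powr (real k * s)) powr (1 / s) = a ^ k" if "0 \<le> a" "1 < s" for a s :: real
    using that k by (cases "a = 0") (simp_all add: powr_powr powr_realpow)
  have "(norm P powr (real k * p)) powr (1 / p) * (norm Q powr (real k * q)) powr (1 / q)
      \<le> 1 / p * norm P powr (real k * p) + 1 / q * norm Q powr (real k * q)"
    using p q pq by (intro Young_powr) auto
  also have "\<dots> \<le> 1 / p * (p * M k) + 1 / q * (q * M k)"
    using p q norm_powr_le_M[OF k] young_pair.norm_powr_le_M[OF swap k]
    by (intro add_mono mult_left_mono) (auto simp: M_swap)
  also have "\<dots> = 2 * M k" using p q by simp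
  finally show ?thesis using p q by (simp add: powr_eq power_mult_distrib)
qed

lemma norm_apply_power2_le:
  assumes x: "norm x = 1"
  shows "(norm (P x))\<^sup>2 \<le> Re (cinner (op_powr P (2 * p) x) x) powr (1 / p)"
proof -
  have "(norm (P x))\<^sup>2 = Re (cinner (op_powr P 2 x) x)"
    using cinner_op_powr_double[OF P, of 1 x] by (simp add: op_powr_one[OF P])
  also have "op_powr P 2 = cfc (\<lambda>t. (t powr (2 * p)) powr (1 / p)) P"
    using p by (simp add: op_powr_def powr_powr)
  also have "Re (cinner (\<dots> x) x) \<le> Re (cinner (op_powr P (2 * p) x) x) powr (1 / p)"
    unfolding op_powr_def using p x
    by (intro cfc_powr_Jensen[OF P continuous_on_powr_Icc]) auto
  finally show ?thesis .
qed

text \<open>At index 2 the exponents 1/p and 1/q are both below 1, so Jensen's inequality points the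
  right way for both operators whatever p is.\<close>

lemma M2_ge:
  assumes x: "norm x = 1"
  shows "(norm (P x) * norm (Q x))\<^sup>2 \<le> M 2"
proof -
  define E F where "E = Re (cinner (op_powr P (2 * p) x) x)" and "F = Re (cinner (op_powr Q (2 * q) x) x)"
  have EF: "0 \<le> E" "0 \<le> F"
    using p q by (auto simp: E_def F_def intro!: positive_opD positive_op_op_powr P Q)
  have "(norm (P x) * norm (Q x))\<^sup>2 \<le> E powr (1 / p) * F powr (1 / q)"
    unfolding power_mult_distrib E_def F_def
    using norm_apply_power2_le[OF x] young_pair.norm_apply_power2_le[OF swap x]
    by (intro mult_mono) auto
  also have "\<dots> \<le> 1 / p * E + 1 / q * F" using EF p q pq by (intro Young_powr) auto
  also have "\<dots> \<le> M 2" using young_sum_le[of 2 x] x by (simp add: E_def F_def)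
  finally show ?thesis .
qed

lemma op_powr_tangent_bound:
  assumes n: "2 \<le> n" and c: "0 \<le> c"
  shows "real n * c ^ (n - 2) * Re (cinner (op_powr P (real 2 * p) x) x)
    \<le> 2 * Re (cinner (op_powr P (real n * p) x) x) + (real n - 2) * c ^ n * (norm x)\<^sup>2"
proof -
  have np: "0 < real n * p" "0 < 2 * p" using n p by auto
  have cont: "continuous_on {0..norm P} (\<lambda>t. t powr (real n * p))"
    "continuous_on {0..norm P} (\<lambda>t. t powr (2 * p))"
    using np by (auto intro!: continuous_on_powr_Icc)
  have "Re (cinner (cfc (\<lambda>t. 0 + real n * c ^ (n - 2) * t powr (2 * p) + 0 * (t powr (2 * p))\<^sup>2) P x) x)
      \<le> Re (cinner (cfc (\<lambda>t. (real n - 2) * c ^ n + 2 * t powr (real n * p)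
        + 0 * (t powr (real n * p))\<^sup>2) P x) x)"
  proof (rule cfc_mono[OF P])
    fix t :: real assume t: "0 \<le> t"
    have pw: "t powr (real k * p) = (t powr p) ^ k" if "0 < k" for k
      using that t by (cases "t = 0") (simp_all add: powr_realpow[symmetric] powr_powr mult.commute)
    show "0 + real n * c ^ (n - 2) * t powr (2 * p) + 0 * (t powr (2 * p))\<^sup>2
      \<le> (real n - 2) * c ^ n + 2 * t powr (real n * p) + 0 * (t powr (real n * p))\<^sup>2"
      using power_tangent_bound[OF n _ c, of "t powr p"] pw[of 2] pw[of n] n by simp
  qed (intro continuous_intros cont)+
  then show ?thesis
    unfolding cinner_cfc_quadratic[OF P cont(1)] cinner_cfc_quadratic[OF P cont(2)]
    by (simp add: op_powr_def algebra_simps)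
qed

text \<open>The tangent bounds for P^p and Q^q share the scalar c, so their average with weights 1/p
  and 1/q bounds K times \<open>young_sum 2\<close> by twice \<open>young_sum n\<close> plus a
  multiple of the identity. Taking norms carries a surplus at index 2 to index n.\<close>

lemma M_tangent_bound:
  assumes n: "2 \<le> n" and c: "0 \<le> c"
  shows "c ^ n + real n / 2 * c ^ (n - 2) * (M 2 - c\<^sup>2) \<le> M n"
proof -
  define K L where "K = real n * c ^ (n - 2)" and "L = 2 * M n + (real n - 2) * c ^ n"
  have K0: "0 \<le> K" and L0: "0 \<le> L" using n c M_nonneg by (auto simp: K_def L_def)
  have bound: "K * Re (cinner (young_sum 2 x) x) \<le> L * (norm x)\<^sup>2" for x
  proof -
    define a b a' b' where "a = Re (cinner (op_powr P (real n * p) x) x)"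
      and "b = Re (cinner (op_powr Q (real n * q) x) x)"
      and "a' = Re (cinner (op_powr P (real 2 * p) x) x)"
      and "b' = Re (cinner (op_powr Q (real 2 * q) x) x)"
    define R where "R = (real n - 2) * c ^ n * (norm x)\<^sup>2"
    have "K * a' \<le> 2 * a + R" "K * b' \<le> 2 * b + R"
      using op_powr_tangent_bound[OF n c] young_pair.op_powr_tangent_bound[OF swap n c]
      by (auto simp: K_def R_def a_def b_def a'_def b'_def)
    then have "1 / p * (K * a') + 1 / q * (K * b') \<le> 1 / p * (2 * a + R) + 1 / q * (2 * b + R)"
      using p q by (intro add_mono mult_left_mono) auto
    also have "\<dots> = 2 * (a / p + b / q) + (1 / p + 1 / q) * R" by (simp add: algebra_simps add_divide_distrib)
    also have "\<dots> \<le> 2 * (M n * (norm x)\<^sup>2) + R"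
      using young_sum_le[of n x] unfolding pq by (simp add: a_def b_def)
    finally show ?thesis
      by (simp add: cinner_young_sum L_def R_def a'_def b'_def algebra_simps)
  qed
  have "K * M 2 \<le> L"
  \<comment> \<open>K vanishes exactly when c = 0 and n > 2; the bound then only says 0 <=
    L.\<close>
  proof (cases "K = 0")
    case False
    have "M 2 \<le> L / K" unfolding M_def
    proof (rule positive_op_norm_le[OF positive_op_young_sum])
      show "Re (cinner (young_sum 2 y) y) \<le> L / K * (norm y)\<^sup>2" for y
        using bound[of y] False K0 by (simp add: field_simps)
    qed (use K0 L0 in auto)
    then show ?thesis using False K0 by (simp add: field_simps)
  qed (use L0 in simp)
  moreover have "c ^ n = c ^ (n - 2 + 2)" by (simp only: le_add_diff_inverse2[OF n])
  then have "c ^ n = c ^ (n - 2) * c\<^sup>2" by (simp only: power_add)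
  ultimately show ?thesis by (simp add: K_def L_def algebra_simps diff_divide_distrib)
qed

text \<open>The term \<open>M 2\<close> is needed since \<open>\<parallel>P x\<parallel> \<parallel>Q x\<parallel> \<le> M 1\<close> fails in general for \<open>p < 2\<close>.
  After scaling to \<open>M 1 = 1\<close> the defect operator
  \<open>Z = 1 - X / p - Y / q\<close> with \<open>X = P\<^sup>p\<close> and \<open>Y = Q\<^sup>q\<close> satisfies \<open>0 \<le> Z \<le> 1\<close>, and all quantities are
  quadratic in \<open>h = X x - x\<close> and \<open>z = Z x\<close>.\<close>

lemma first_order_bound_aux:
  assumes p2: "p \<le> 2" and x: "norm x = 1"
  shows "10 * M 1 * (norm (P x) * norm (Q x)) \<le> M 2 + 9 * (M 1)\<^sup>2"
proof (cases "M 1 = 0")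
  case True
  then have "norm P powr p \<le> 0" using norm_powr_le_M[of 1] by simp
  then have "P = 0" by simp
  then show ?thesis using True M_nonneg by simp
next
  case False
  define c where "c = M 1"
  have c: "0 < c" using False M_nonneg[of 1] by (simp add: c_def)
  \<comment> \<open>The exponents become 2/p = 1 + r and 2/q = 1 - r. In terms of X and Y one power
    is above 1 and the other below, so both need quadratic majorants touching at 1.\<close>
  define r where "r = 2 / p - 1"
  have r: "0 \<le> r" "r < 1" using p p2 by (auto simp: r_def field_simps)
  have p_eq: "p = 2 / (1 + r)" using p by (simp add: r_def)
  have "1 / q = (1 - r) / 2" using pq by (simp add: r_def)
  then have q_eq: "q = 2 / (1 - r)" using q r by (simp add: field_simps)
  have q2: "2 \<le> q" and r_q: "r = 1 - 2 / q" and q1: "q - 1 = (1 + r) / (1 - r)"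
    using r by (auto simp: q_eq field_simps)
  define X Y where "X = (1 / c) *\<^sub>R op_powr P p" and "Y = (1 / c) *\<^sub>R op_powr Q q"
  define Z where "Z = id_blinfun - (1 / p) *\<^sub>R X - (1 / q) *\<^sub>R Y"
  have X: "positive_op X" and Y: "positive_op Y"
    unfolding X_def Y_def using P Q p q c by (auto intro!: positive_op_scaleR positive_op_op_powr)
  have quadZ: "Re (cinner (Z y) y) = (norm y)\<^sup>2 - Re (cinner (X y) y) / p - Re (cinner (Y y) y) / q" for y
    by (simp add: Z_def minus_blinfun.rep_eq scaleR_blinfun.rep_eq cinner_simps cinner_self)
  have Z: "positive_op Z" unfolding positive_op_def
  proof (intro conjI allI)
    show "self_adjoint Z" unfolding Z_def
      by (intro self_adjoint_diff self_adjoint_scaleR self_adjoint_id positive_op_self_adjoint X Y)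
    fix y
    have "(Re (cinner (op_powr P p y) y) / p + Re (cinner (op_powr Q q y) y) / q) / c \<le> (norm y)\<^sup>2"
      using young_sum_le[of 1 y] c by (simp add: c_def divide_le_eq mult.commute)
    then show "0 \<le> Re (cinner (Z y) y)"
      unfolding quadZ X_def Y_def scaleR_blinfun.rep_eq cinner_scaleR_left
      by (simp add: add_divide_distrib mult.commute)
  qed
  \<comment> \<open>g is chosen so that Y x = x - (q - 1) g. Thus h and g measure how far X x and Y
    x are from x.\<close>
  define h z g where "h = X x - x" and "z = Z x" and "g = h + p *\<^sub>R z"
  define \<zeta> H W where "\<zeta> = Re (cinner z x)" and "H = (norm h)\<^sup>2" and "W = (norm g)\<^sup>2"
  define hx where "hx = Re (cinner h x)"
  have "(norm z)\<^sup>2 \<le> 1 * \<zeta>" unfolding z_def \<zeta>_def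
  proof (rule positive_op_norm_apply[OF Z])
    fix y
    have "0 \<le> Re (cinner (X y) y) / p" "0 \<le> Re (cinner (Y y) y) / q"
      using positive_opD[OF X] positive_opD[OF Y] p q by simp_all
    then show "Re (cinner (Z y) y) \<le> 1 * (norm y)\<^sup>2" by (simp add: quadZ)
  qed
  then have \<zeta>: "(norm z)\<^sup>2 \<le> \<zeta>" by simp
  have Xx: "X x = x + h" by (simp add: h_def)
  have Yx: "Y x = x - (q - 1) *\<^sub>R g"
  proof -
    have "z = x - (1 / p) *\<^sub>R X x - (1 / q) *\<^sub>R Y x"
      by (simp add: z_def Z_def minus_blinfun.rep_eq scaleR_blinfun.rep_eq)
    then have "q *\<^sub>R z = q *\<^sub>R x - (q / p) *\<^sub>R (x + h) - Y x"
      using q by (simp add: scaleR_diff_right Xx)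
    moreover have "q / p = q - 1" "(q - 1) * p = q" using pq p q by (auto simp: field_simps)
    ultimately show ?thesis
      by (simp add: g_def scaleR_add_right scaleR_diff_left algebra_simps)
  qed
  have gx: "Re (cinner g x) = hx + p * \<zeta>" by (simp add: g_def hx_def \<zeta>_def cinner_simps)
  have Xq: "Re (cinner (X x) x) = 1 + hx" "(norm (X x))\<^sup>2 = 1 + 2 * hx + H"
    using Re_cinner_commute[of x h]
    by (simp_all add: Xx cinner_simps cinner_self x norm_add_power2 H_def hx_def)
  have Yq: "Re (cinner (Y x) x) = 1 - (q - 1) * (hx + p * \<zeta>)"
    "(norm (Y x))\<^sup>2 = 1 - 2 * (q - 1) * (hx + p * \<zeta>) + (q - 1)\<^sup>2 * W"
    using Re_cinner_commute[of x g] gx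
    by (simp_all add: Yx cinner_simps cinner_self x norm_diff_power2 W_def power_mult_distrib)
  \<comment> \<open>These are the scalar majorants of y^(2/p) and y^(2/q), with y replaced by X and
    Y and evaluated at x; the square of y - 1 turns into the last bracket of V.\<close>
  define U V where "U = (1 - r) * Re (cinner (X x) x) + r * (norm (X x))\<^sup>2"
    and "V = 1 + 2 / q * (Re (cinner (Y x) x) - 1)
      - (r / (q - 1))\<^sup>2 * ((norm (Y x))\<^sup>2 - 2 * Re (cinner (Y x) x) + 1)"
  have scale: "t\<^sup>2 = c powr (2 / s) * (t powr s / c) powr (2 / s)" if "0 \<le> t" "1 < s" for t s :: real
  proof -
    have "(t powr s / c) powr (2 / s) = (t powr s) powr (2 / s) / c powr (2 / s)"
      by (rule powr_divide)
    also have "(t powr s) powr (2 / s) = t\<^sup>2" using that by (simp add: powr_powr)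
    finally show ?thesis using c by simp
  qed
  define i where "i = 1 / c"
  have PU: "(norm (P x))\<^sup>2 \<le> c powr (2 / p) * U"
  proof -
    define C where "C = c powr (2 / p)"
    have wc: "continuous_on {0..norm P} (\<lambda>t. t powr p)" using p by (intro continuous_on_powr_Icc) simp
    have "(norm (P x))\<^sup>2 = Re (cinner (cfc (\<lambda>t. 0 + 0 * t + 1 * t\<^sup>2) P x) x)"
      unfolding cinner_cfc_quadratic[OF P continuous_on_id] by (simp add: cfc_ident[OF P])
    also have "\<dots> \<le> Re (cinner (cfc (\<lambda>t. 0 + C * (1 - r) * i * t powr p
        + C * r * i\<^sup>2 * (t powr p)\<^sup>2) P x) x)"
    proof (rule cfc_mono[OF P])
      fix t :: real assume t: "0 \<le> t"
      have "(t powr p / c) powr (1 + r) \<le> (1 - r) * (t powr p / c) + r * (t powr p / c)\<^sup>2"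
        using r c by (intro powr_le_interpolation) auto
      moreover have "t\<^sup>2 = C * (t powr p / c) powr (1 + r)"
        using scale[OF t p] by (simp add: C_def r_def)
      ultimately have "t\<^sup>2 \<le> C * ((1 - r) * (t powr p / c) + r * (t powr p / c)\<^sup>2)"
        by (simp add: C_def mult_left_mono)
      also have "t powr p / c = i * t powr p" by (simp add: i_def)
      finally show "0 + 0 * t + 1 * t\<^sup>2
          \<le> 0 + C * (1 - r) * i * t powr p + C * r * i\<^sup>2 * (t powr p)\<^sup>2"
        by (simp add: power_mult_distrib algebra_simps)
    qed (intro continuous_intros wc)+
    also have "\<dots> = C * U"
      unfolding cinner_cfc_quadratic[OF P wc] U_def X_def scaleR_blinfun.rep_eq cinner_scaleR_left
        i_def[symmetric] op_powr_def
      by (simp add: power_mult_distrib algebra_simps)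
    finally show ?thesis by (simp only: C_def)
  qed
  have QV: "(norm (Q x))\<^sup>2 \<le> c powr (2 / q) * V"
  proof -
    define C \<sigma> k where "C = c powr (2 / q)" and "\<sigma> = 2 / q" and "k = (r / (q - 1))\<^sup>2"
    have wc: "continuous_on {0..norm Q} (\<lambda>t. t powr q)" using q by (intro continuous_on_powr_Icc) simp
    have "(norm (Q x))\<^sup>2 = Re (cinner (cfc (\<lambda>t. 0 + 0 * t + 1 * t\<^sup>2) Q x) x)"
      unfolding cinner_cfc_quadratic[OF Q continuous_on_id] by (simp add: cfc_ident[OF Q])
    also have "\<dots> \<le> Re (cinner (cfc (\<lambda>t. C * (1 - \<sigma> - k)
        + C * (\<sigma> + 2 * k) * i * t powr q + C * (- k) * i\<^sup>2 * (t powr q)\<^sup>2) Q x) x)"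
    proof (rule cfc_mono[OF Q])
      fix t :: real assume t: "0 \<le> t" "t \<le> norm Q"
      \<comment> \<open>\<open>powr_le_quadratic\<close> is valid only up to q. Since the Q-summand
        alone is dominated by the Young sum, Y <= q holds and this range suffices.\<close>
      have "t powr q \<le> norm Q powr q" using t q by (intro powr_mono2) auto
      also have "\<dots> \<le> q * c"
        using young_pair.norm_powr_le_M[OF swap, of 1] by (simp add: M_swap c_def)
      finally have "t powr q / c \<le> q" using c by (simp add: divide_le_eq)
      then have "(t powr q / c) powr \<sigma> \<le> 1 + \<sigma> * (t powr q / c - 1) - k * (t powr q / c - 1)\<^sup>2"
        unfolding k_def r_q \<sigma>_def using q2 c by (intro powr_le_quadratic) auto
      moreover have "t\<^sup>2 = C * (t powr q / c) powr \<sigma>"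
        using scale[OF t(1) q] by (simp add: C_def \<sigma>_def)
      ultimately have "t\<^sup>2 \<le> C * (1 + \<sigma> * (t powr q / c - 1) - k * (t powr q / c - 1)\<^sup>2)"
        by (simp only: C_def mult_left_mono powr_ge_zero)
      also have "t powr q / c = i * t powr q" by (simp add: i_def)
      finally show "0 + 0 * t + 1 * t\<^sup>2 \<le> C * (1 - \<sigma> - k)
          + C * (\<sigma> + 2 * k) * i * t powr q + C * (- k) * i\<^sup>2 * (t powr q)\<^sup>2"
        by (simp add: power2_eq_square algebra_simps)
    qed (intro continuous_intros wc)+
    also have "\<dots> = C * V"
      unfolding cinner_cfc_quadratic[OF Q wc] V_def Y_def scaleR_blinfun.rep_eq cinner_scaleR_left
        i_def[symmetric] op_powr_def k_def[symmetric] \<sigma>_def[symmetric]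
      by (simp add: x power_mult_distrib algebra_simps)
    finally show ?thesis by (simp only: C_def)
  qed
  have UV0: "0 \<le> U" "0 \<le> V"
    using order_trans[OF zero_le_power2 PU] order_trans[OF zero_le_power2 QV] c
    by (auto simp: zero_le_mult_iff)
  have "(norm (P x) * norm (Q x))\<^sup>2 \<le> (c powr (2 / p) * U) * (c powr (2 / q) * V)"
    unfolding power_mult_distrib using PU QV UV0 by (intro mult_mono) auto
  also have "\<dots> = (c powr (2 / p) * c powr (2 / q)) * (U * V)" by simp
  also have "c powr (2 / p) * c powr (2 / q) = c\<^sup>2"
  proof -
    have "2 / p + 2 / q = 2" using pq by (simp add: field_simps)
    then show ?thesis using c by (simp flip: powr_add)
  qed
  also have "c\<^sup>2 * (U * V) \<le> c\<^sup>2 * ((U + V) / 2)\<^sup>2"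
  proof (intro mult_left_mono)
    have "0 \<le> (U - V)\<^sup>2 / 4" by simp
    then show "U * V \<le> ((U + V) / 2)\<^sup>2" by (simp add: power2_eq_square field_simps)
  qed simp
  also have "\<dots> = (c * ((U + V) / 2))\<^sup>2" by (simp only: power_mult_distrib)
  finally have \<gamma>: "norm (P x) * norm (Q x) \<le> c * ((U + V) / 2)"
    by (rule power2_le_imp_le) (use UV0 c in simp)
  define ip iq K where "ip = 1 / p" and "iq = 1 / q" and "K = (1 + r)\<^sup>2 / (1 - r)"
  have ip: "ip = (1 + r) / 2" "ip * p = 1" "ip + iq = 1" "iq * (q - 1) = ip"
    using p q pq by (auto simp: ip_def iq_def r_def field_simps)
  have "iq * (q - 1)\<^sup>2 = (iq * (q - 1)) * (q - 1)" by (simp add: power2_eq_square)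
  also have "\<dots> = ip * (q - 1)" by (simp only: ip(4))
  also have "\<dots> = (1 + r) / 2 * ((1 + r) / (1 - r))" by (simp only: ip(1) q1)
  also have "\<dots> = K / 2" by (simp add: K_def power2_eq_square)
  finally have iqK: "iq * (q - 1)\<^sup>2 = K / 2" .
  define e where "e = hx + p * \<zeta>"
  have ipe: "ip * e = ip * hx + \<zeta>" using ip(2) by (simp add: e_def algebra_simps)
  \<comment> \<open>The terms linear in h cancel: they have coefficient (1 - r) + 2 r = 2/p in U and
    (2/q)(q - 1) = 2/p, with the opposite sign, in V. The same happens in T, so the comparison is
    purely second order apart from \<zeta>.\<close>
  have sumUV: "U + V = 2 + r * H - 2 * \<zeta> - r\<^sup>2 * W"
  proof -
    have "(r / (q - 1))\<^sup>2 * (q - 1)\<^sup>2 = r\<^sup>2" using q by (simp add: power_divide)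
    moreover have "V = 1 - 2 * ((iq * (q - 1)) * e) - ((r / (q - 1))\<^sup>2 * (q - 1)\<^sup>2) * W"
    proof -
      have "2 / q = 2 * iq" by (simp add: iq_def)
      then show ?thesis unfolding V_def Yq e_def[symmetric] by (simp only:) (simp add: algebra_simps)
    qed
    ultimately have "V = 1 - 2 * (ip * e) - r\<^sup>2 * W" by (simp only: ip(4))
    moreover have "U = 1 + 2 * (ip * hx) + r * H"
      unfolding U_def Xq ip(1) by (simp add: algebra_simps)
    ultimately show ?thesis by (simp add: ipe)
  qed
  define T where "T = 1 + (1 + r) / 2 * H - 2 * \<zeta> + K / 2 * W"
  have M2: "c\<^sup>2 * T \<le> M 2"
  proof -
    have "Re (cinner (op_powr P (real 2 * p) x) x) = c\<^sup>2 * (norm (X x))\<^sup>2"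
      "Re (cinner (op_powr Q (real 2 * q) x) x) = c\<^sup>2 * (norm (Y x))\<^sup>2"
      using cinner_op_powr_double[OF P, of p x] cinner_op_powr_double[OF Q, of q x] p q c
      by (simp_all add: X_def Y_def scaleR_blinfun.rep_eq power_mult_distrib power_divide)
    then have "c\<^sup>2 * (norm (X x))\<^sup>2 / p + c\<^sup>2 * (norm (Y x))\<^sup>2 / q \<le> M 2"
      using young_sum_le[of 2 x] x by simp
    moreover have eq: "(norm (X x))\<^sup>2 / p + (norm (Y x))\<^sup>2 / q = T"
    proof -
      have "(norm (Y x))\<^sup>2 / q = iq * (1 - 2 * (q - 1) * e + (q - 1)\<^sup>2 * W)"
        unfolding Yq(2) e_def iq_def by simp
      also have "\<dots> = iq - 2 * ((iq * (q - 1)) * e) + (iq * (q - 1)\<^sup>2) * W"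
        by (simp add: algebra_simps)
      also have "\<dots> = iq - 2 * (ip * hx + \<zeta>) + K / 2 * W" by (simp only: ip(4) ipe iqK)
      finally have "(norm (Y x))\<^sup>2 / q = iq - 2 * (ip * hx + \<zeta>) + K / 2 * W" .
      moreover have "(norm (X x))\<^sup>2 / p = ip + 2 * (ip * hx) + ip * H"
        unfolding Xq(2) by (simp add: ip_def add_divide_distrib)
      ultimately show ?thesis using ip(3) unfolding T_def ip(1)[symmetric] by simp
    qed
    ultimately show ?thesis unfolding eq[symmetric] by (simp add: distrib_left)
  qed
  \<comment> \<open>With \<zeta> in place of (norm z)^2 this is exactly 5 (U + V) <= T + 9 after
    doubling, 9 r - 1 being 10 r - (1 + r). The lower bound \<zeta> >= (norm z)^2 then closes the
    gap.\<close>
  have "(9 * r - 1) * H \<le> 16 * (norm z)\<^sup>2 + (10 * r\<^sup>2 + K) * W"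
  proof (cases "9 * r - 1 \<le> 0")
    case True
    then have "(9 * r - 1) * H \<le> 0" by (simp add: H_def mult_le_0_iff)
    also have "0 \<le> 16 * (norm z)\<^sup>2 + (10 * r\<^sup>2 + K) * W" using r by (simp add: W_def K_def)
    finally show ?thesis .
  next
    case False
    have "norm h \<le> norm g + norm (p *\<^sub>R z)" using norm_triangle_ineq4[of g "p *\<^sub>R z"] by (simp add: g_def)
    then have "H \<le> (norm g + 2 / (1 + r) * norm z)\<^sup>2"
      unfolding H_def using p r by (intro power_mono) (auto simp: p_eq)
    then have "(9 * r - 1) * H \<le> (9 * r - 1) * (norm g + 2 / (1 + r) * norm z)\<^sup>2"
      using False by (intro mult_left_mono) auto
    also have "\<dots> \<le> 16 * (norm z)\<^sup>2 + (10 * r\<^sup>2 + K) * W"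
      unfolding W_def K_def by (rule quadratic_form_bound[OF r]) auto
    finally show ?thesis .
  qed
  then have "5 * (U + V) \<le> T + 9"
    using \<zeta> unfolding sumUV T_def by (simp add: algebra_simps add_divide_distrib)
  then have "c\<^sup>2 * (5 * (U + V)) \<le> c\<^sup>2 * (T + 9)" by (intro mult_left_mono) auto
  moreover have "10 * c * (norm (P x) * norm (Q x)) \<le> 10 * c * (c * ((U + V) / 2))"
    using c by (intro mult_left_mono \<gamma>) auto
  ultimately show ?thesis
    using M2 unfolding c_def[symmetric] by (simp add: power2_eq_square algebra_simps)
qed

lemma first_order_bound:
  assumes x: "norm x = 1"
  shows "10 * M 1 * (norm (P x) * norm (Q x)) \<le> M 2 + 9 * (M 1)\<^sup>2"
proof (cases "p \<le> 2")
  case True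
  then show ?thesis using x by (rule first_order_bound_aux)
next
  case False
  have "q \<le> 2"
  proof (rule ccontr)
    assume "\<not> q \<le> 2"
    then have "1 / p + 1 / q < 1 / 2 + 1 / 2"
      using False by (intro add_strict_mono divide_strict_left_mono) auto
    then show False using pq by simp
  qed
  from young_pair.first_order_bound_aux[OF swap this x] show ?thesis
    by (simp add: M_swap mult.commute)
qed

end

section \<open>The numerical radius\<close>

text \<open>The vector w is the reflection of u in the line of x, so it has the norm of u, and 2 <u,
  x> <x, v> = <w, v> + <u, v>.\<close>

lemma Buzano:
  fixes u v x :: "'a::complex_inner"
  assumes x: "norm x = 1"
  shows "cmod (cinner u x) * cmod (cinner x v) \<le> (norm u * norm v + cmod (cinner u v)) / 2"
proof -
  define c where "c = cinner u x"
  define w where "w = (2 * c) *\<^sub>C x - u"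
  have "cinner x u = cnj c" unfolding c_def by (rule cinner_commute)
  then have "cinner ((2 * c) *\<^sub>C x) u = 2 * complex_of_real ((cmod c)\<^sup>2)"
    unfolding complex_norm_square by (simp add: cinner_scaleC_left)
  then have "Re (cinner ((2 * c) *\<^sub>C x) u) = 2 * (cmod c)\<^sup>2" by (simp del: of_real_power)
  then have "(norm w)\<^sup>2 = (norm u)\<^sup>2"
    by (simp add: w_def norm_diff_power2 norm_scaleC x norm_mult power_mult_distrib)
  then have "norm w = norm u" by (rule power2_eq_imp_eq) auto
  have "2 * (cmod (cinner u x) * cmod (cinner x v)) = cmod (2 * c * cinner x v)"
    by (simp add: norm_mult c_def)
  also have "2 * c * cinner x v = cinner w v + cinner u v"
    by (simp add: w_def cinner_simps)
  also have "cmod \<dots> \<le> norm u * norm v + cmod (cinner u v)"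
    using norm_triangle_ineq[of "cinner w v" "cinner u v"] cinner_Cauchy_Schwarz[of w v]
    unfolding \<open>norm w = norm u\<close> by linarith
  finally show ?thesis by simp
qed

text \<open>The left side is the form of (adj T) T + T (adj T) at x, hence at most norm y. In norm
  y^2 the cross term <adj T u, T v> equals <u, T (T v)>, which is how the norm of the square T o T
  enters in place of a second norm T squared.\<close>

lemma norm_power2_add_adj_le:
  assumes T: "T \<in> bounded_operators" and x: "norm x = 1"
  shows "(norm (blinfun_apply T x))\<^sup>2 + (norm (adj T x))\<^sup>2 \<le> (norm T)\<^sup>2 + norm (T o\<^sub>L T)"
proof -
  define u v where "u = T x" and "v = adj T x"
  define s y where "s = (norm u)\<^sup>2 + (norm v)\<^sup>2" and "y = adj T u + T v"
  have "s = Re (cinner x y)"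
    by (simp add: s_def y_def u_def v_def cinner_simps cinner_adj_right[OF T] norm_power2_cinner
        cinner_adj_left[OF T] Re_cinner_commute[of x])
  also have "\<dots> \<le> norm y" using Re_cinner_le[of x y] x by simp
  finally have "s\<^sup>2 \<le> (norm y)\<^sup>2" by (intro power_mono) (auto simp: s_def)
  also have "\<dots> = (norm (adj T u))\<^sup>2 + (norm (T v))\<^sup>2 + 2 * Re (cinner u ((T o\<^sub>L T) v))"
    by (simp add: y_def norm_add_power2 cinner_adj_left[OF T])
  also have "\<dots> \<le> (norm T * norm u)\<^sup>2 + (norm T * norm v)\<^sup>2 + 2 * (norm u * (norm (T o\<^sub>L T) * norm v))"
  proof (intro add_mono mult_left_mono power_mono)
    show "norm (adj T u) \<le> norm T * norm u"
      using norm_blinfun[of "adj T" u] norm_adj_le[OF T]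
      by (meson mult_right_mono norm_ge_zero order_trans)
    show "norm (T v) \<le> norm T * norm v" by (rule norm_blinfun)
    have "Re (cinner u ((T o\<^sub>L T) v)) \<le> norm u * norm ((T o\<^sub>L T) v)" by (rule Re_cinner_le)
    also have "\<dots> \<le> norm u * (norm (T o\<^sub>L T) * norm v)" by (intro mult_left_mono norm_blinfun) simp
    finally show "Re (cinner u ((T o\<^sub>L T) v)) \<le> norm u * (norm (T o\<^sub>L T) * norm v)" .
  qed auto
  also have "\<dots> = (norm T)\<^sup>2 * s + norm (T o\<^sub>L T) * (2 * norm u * norm v)"
    by (simp add: s_def power_mult_distrib algebra_simps)
  also have "\<dots> \<le> (norm T)\<^sup>2 * s + norm (T o\<^sub>L T) * s"
    unfolding s_def by (intro add_left_mono mult_left_mono sum_squares_bound) simp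
  finally have le: "s * s \<le> ((norm T)\<^sup>2 + norm (T o\<^sub>L T)) * s"
    by (simp add: power2_eq_square distrib_right)
  have "s \<le> (norm T)\<^sup>2 + norm (T o\<^sub>L T)"
  proof (cases "s = 0")
    case False
    then have "0 < s" by (simp add: s_def less_le)
    with le show ?thesis by (rule mult_right_le_imp_le)
  qed simp
  then show ?thesis by (simp add: s_def u_def v_def)
qed

lemma mixed_Schwarz_abs_op:
  fixes S :: "'a::chilbert_space \<Rightarrow>\<^sub>L 'a"
  assumes S: "S \<in> bounded_operators"
    and f: "continuous_on {0..} f" and g: "continuous_on {0..} g"
    and fg: "\<And>t. 0 \<le> t \<Longrightarrow> f t * g t = t"
  shows "cmod (cinner (S x) y) \<le> norm (cfc f (abs_op S) x) * norm (cfc g (abs_op (adj S)) y)"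
proof -
  have root: "continuous_on {0..b} (\<lambda>t. t powr (1 / 2))" for b :: real
    by (rule continuous_on_powr_Icc) simp
  have root': "continuous_on {0..} (\<lambda>t :: real. t powr (1 / 2))"
    by (rule continuous_on_powr_nonneg) simp
  have f_abs: "cfc f (abs_op S) = cfc (\<lambda>t. f (t powr (1 / 2))) (adj S o\<^sub>L S)"
    unfolding abs_op_def op_powr_def
    by (rule cfc_compose[OF positive_op_adj_compose[OF S] root _ f]) simp
  have g_abs: "cfc g (abs_op (adj S)) = cfc (\<lambda>t. g (t powr (1 / 2))) (S o\<^sub>L adj S)"
    unfolding abs_op_def op_powr_def adj_adj[OF S]
    by (rule cfc_compose[OF positive_op_compose_adj[OF S] root _ g]) simp
  show ?thesis
    unfolding f_abs g_abs
    by (rule mixed_Schwarz[OF S])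
      (auto intro!: continuous_on_compose2[OF f root'] continuous_on_compose2[OF g root']
        simp: fg powr_half_sqrt)
qed

lemma numerical_radius_power_le:
  fixes T :: "'a::chilbert_space \<Rightarrow>\<^sub>L 'a"
  assumes "\<And>x. norm x = 1 \<Longrightarrow> cmod (cinner (T x) x) ^ n \<le> K" and n: "0 < n" and K: "0 \<le> K"
  shows "numerical_radius T ^ n \<le> K"
proof -
  define A where "A = insert 0 {cmod (cinner (T x) x) | x. norm x = 1}"
  have le: "a \<le> root n K" if "a \<in> A" for a
  proof -
    have "0 \<le> a" "a ^ n \<le> K" using that assms by (auto simp: A_def power_0_left)
    then have "root n (a ^ n) \<le> root n K" using n by simp
    then show ?thesis using n \<open>0 \<le> a\<close> by (simp add: real_root_power_cancel)
  qed
  have "Sup A \<le> root n K" by (rule cSup_least) (use le in \<open>auto simp: A_def\<close>)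
  moreover have "0 \<le> Sup A"
    by (rule cSup_upper) (use le in \<open>auto simp: A_def intro!: bdd_aboveI\<close>)
  ultimately have "Sup A ^ n \<le> root n K ^ n" by (intro power_mono)
  then show ?thesis using n K by (simp add: numerical_radius_def A_def real_root_pow_pos2)
qed

text \<open>The estimate holds for an arbitrary operator T; the matrix structure is used only to
  compute M and N afterwards.\<close>

lemma numerical_radius_bound:
  fixes T :: "'a::chilbert_space \<Rightarrow>\<^sub>L 'a" and f g :: "real \<Rightarrow> real"
  assumes T: "T \<in> bounded_operators" and pq: "1 < p" "1 < q" "1 / p + 1 / q = 1"
    and f: "continuous_on {0..} f" "\<And>t. 0 \<le> t \<Longrightarrow> 0 \<le> f t"
    and g: "continuous_on {0..} g" "\<And>t. 0 \<le> t \<Longrightarrow> 0 \<le> g t"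
    and fg: "\<And>t. 0 \<le> t \<Longrightarrow> f t * g t = t" and n: "2 \<le> n"
  defines "S \<equiv> T o\<^sub>L T"
  defines "M \<equiv> young_pair.M (abs_op T) (abs_op (adj T)) p q"
    and "N \<equiv> young_pair.M (cfc f (abs_op S)) (cfc g (abs_op (adj S))) p q"
  shows "numerical_radius T ^ (2 * n)
    \<le> 1 / 2 ^ n * (M n + N n + (\<Sum>k = 1..n - 1. real (n choose k) * M k * N (n - k)))"
proof -
  have S: "S \<in> bounded_operators" using T by (simp add: S_def)
  have pos_cfc: "positive_op (cfc h (abs_op A))"
    if "A \<in> bounded_operators" "continuous_on {0..} h" "\<And>t. 0 \<le> t \<Longrightarrow> 0 \<le> h t"
    for A :: "'a \<Rightarrow>\<^sub>L 'a" and h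
    using that by (intro positive_op_cfc positive_op_abs_op continuous_on_subset[OF that(2)]) auto
  interpret TP: young_pair "abs_op T" "abs_op (adj T)" p q
    using T pq by unfold_locales (auto intro: positive_op_abs_op)
  interpret SP: young_pair "cfc f (abs_op S)" "cfc g (abs_op (adj S))" p q
    using S pq f g by unfold_locales (auto intro: pos_cfc)
  define R where "R = norm T"
  have R: "R \<le> norm (abs_op T)" "R \<le> norm (abs_op (adj T))"
    using norm_abs_op_ge[OF T] norm_abs_op_ge[of "adj T"] norm_adj_le[of "adj T"] T
    by (auto simp: R_def adj_adj)
  then have R2: "R\<^sup>2 \<le> norm (abs_op T) * norm (abs_op (adj T))"
    unfolding power2_eq_square by (intro mult_mono) (auto simp: R_def)
  have R_M1: "R\<^sup>2 \<le> 2 * M 1" using R2 TP.norm_mult_power_le[of 1] by (simp add: M_def)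
  have R_M2: "(R\<^sup>2)\<^sup>2 \<le> 2 * M 2"
    using power_mono[OF R2, of 2] TP.norm_mult_power_le[of 2] by (simp add: M_def)
  have mixed: "cmod (cinner (S x) y)
      \<le> norm (cfc f (abs_op S) x) * norm (cfc g (abs_op (adj S)) y)" for x y
    by (rule mixed_Schwarz_abs_op[OF S f(1) g(1) fg])
  have S_N1: "norm S \<le> 2 * N 1"
  proof -
    define L where "L = norm (cfc f (abs_op S)) * norm (cfc g (abs_op (adj S)))"
    have "norm S \<le> L"
    proof (rule norm_blinfun_bound)
      fix x
      \<comment> \<open>The mixed Schwarz inequality with y = S x turns into a bound for norm
        S.\<close>
      have "(norm (S x))\<^sup>2 = cmod (cinner (S x) (S x))" by (simp add: cinner_self norm_power)
      also have "\<dots> \<le> norm (cfc f (abs_op S) x) * norm (cfc g (abs_op (adj S)) (S x))" by (rule mixed)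
      also have "\<dots> \<le> (norm (cfc f (abs_op S)) * norm x) * (norm (cfc g (abs_op (adj S))) * norm (S x))"
        by (intro mult_mono norm_blinfun) auto
      finally have "norm (S x) * norm (S x) \<le> (L * norm x) * norm (S x)"
        by (simp add: L_def power2_eq_square mult_ac)
      then show "norm (S x) \<le> L * norm x"
        by (cases "S x = 0") (auto simp: L_def dest: mult_right_le_imp_le)
    qed (simp add: L_def)
    then show ?thesis using SP.norm_mult_power_le[of 1] by (simp add: L_def N_def)
  qed
  have nonneg: "0 \<le> M k" "0 \<le> N k" for k
    using TP.M_nonneg SP.M_nonneg by (simp_all add: M_def N_def)
  show ?thesis
  proof (rule numerical_radius_power_le)
    fix x :: 'a assume x: "norm x = 1"
    define a b where "a = norm (T x) * norm (adj T x)" and "b = cmod (cinner (S x) x)"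
    have a_eq: "a = norm (abs_op T x) * norm (abs_op (adj T) x)"
      using T by (simp add: a_def norm_abs_op_apply)
    have b0: "0 \<le> b" by (simp add: b_def)
    have ba: "b \<le> a"
      using cinner_Cauchy_Schwarz[of "T x" "adj T x"]
      by (simp add: a_def b_def S_def cinner_adj_right[OF T])
    define \<gamma> where "\<gamma> = norm (cfc f (abs_op S) x) * norm (cfc g (abs_op (adj S)) x)"
    have b\<gamma>: "b \<le> \<gamma>" unfolding b_def \<gamma>_def by (rule mixed)
    have b_N1: "b \<le> 2 * N 1"
    proof -
      have "b \<le> norm (S x) * norm x" unfolding b_def by (rule cinner_Cauchy_Schwarz)
      also have "\<dots> \<le> norm S" using norm_blinfun[of S x] x by simp
      finally show ?thesis using S_N1 by simp
    qed
    have aR: "a \<le> R\<^sup>2"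
    proof -
      have "norm (T x) \<le> R" using norm_blinfun[of T x] x by (simp add: R_def)
      moreover have "norm (adj T x) \<le> R"
        using norm_blinfun[of "adj T" x] norm_adj_le[OF T] x by (simp add: R_def)
      ultimately show ?thesis unfolding a_def power2_eq_square by (intro mult_mono) (auto simp: R_def)
    qed
    have aR': "2 * a \<le> R\<^sup>2 + norm S"
      using norm_power2_add_adj_le[OF T x] sum_squares_bound[of "norm (T x)" "norm (adj T x)"]
      by (simp add: a_def R_def S_def)
    have M2: "a\<^sup>2 \<le> M 2" using TP.M2_ge[OF x] by (simp add: a_eq M_def)
    have "b\<^sup>2 \<le> \<gamma>\<^sup>2" using b\<gamma> b0 by (intro power_mono)
    then have N2: "b\<^sup>2 \<le> N 2" using SP.M2_ge[OF x] by (simp add: \<gamma>_def N_def)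
    have M1: "10 * M 1 * a \<le> M 2 + 9 * (M 1)\<^sup>2"
      using TP.first_order_bound[OF x] by (simp add: a_eq M_def)
    have "10 * N 1 * b \<le> 10 * N 1 * \<gamma>"
      using b\<gamma> SP.M_nonneg by (intro mult_left_mono) (auto simp: N_def)
    then have N1: "10 * N 1 * b \<le> N 2 + 9 * (N 1)\<^sup>2"
      using SP.first_order_bound[OF x] by (simp add: \<gamma>_def N_def)
    have large: "2 * (a - N 1)\<^sup>2 \<le> M 2" if "N 1 \<le> a"
    proof -
      have "(2 * (a - N 1))\<^sup>2 \<le> (R\<^sup>2)\<^sup>2" using that aR' S_N1 by (intro power_mono) auto
      moreover have "(2 * (a - N 1))\<^sup>2 = 4 * (a - N 1)\<^sup>2" by (simp add: power2_eq_square algebra_simps)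
      ultimately show ?thesis using R_M2 by linarith
    qed
    have defect: "2 * max 0 (a - M 1) * b + 2 * max 0 (b - N 1) * a \<le> (M 2 - a\<^sup>2) + (N 2 - b\<^sup>2)"
      using aR R_M1 by (intro first_order_defect_bound b0 ba b_N1 M2 M1 large N2 N1) auto
    have "(a + b) ^ n \<le> M n + N n + (\<Sum>k = 1..n - 1. real (n choose k) * M k * N (n - k))"
    proof (rule binomial_defect_bound[OF n b0 ba _ _ _ M2 N2 _ _ defect])
      show "0 \<le> M 1" "0 \<le> N 1" "a \<le> 2 * M 1"
        using TP.M_nonneg SP.M_nonneg aR R_M1 by (auto simp: M_def N_def)
      show "a ^ k + real k / 2 * a ^ (k - 2) * (M 2 - a\<^sup>2) \<le> M k" if "2 \<le> k" for k
        using TP.M_tangent_bound[OF that, of a] b0 ba by (simp add: M_def)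
      show "b ^ k \<le> N k" if "2 \<le> k" for k
      proof -
        have "0 \<le> real k / 2 * b ^ (k - 2) * (N 2 - b\<^sup>2)" using b0 N2 by simp
        then show ?thesis using SP.M_tangent_bound[OF that b0] by (simp add: N_def)
      qed
    qed
    then have bound: "1 / 2 ^ n * (a + b) ^ n
        \<le> 1 / 2 ^ n * (M n + N n + (\<Sum>k = 1..n - 1. real (n choose k) * M k * N (n - k)))"
      by (intro mult_left_mono) auto
    have "(cmod (cinner (T x) x))\<^sup>2 \<le> (a + b) / 2"
      using Buzano[OF x, of "T x" "adj T x"]
      by (simp add: a_def b_def S_def cinner_adj_right[OF T] power2_eq_square)
    then have "((cmod (cinner (T x) x))\<^sup>2) ^ n \<le> ((a + b) / 2) ^ n" by (intro power_mono) auto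
    also have "\<dots> = 1 / 2 ^ n * (a + b) ^ n" by (simp add: power_divide)
    finally show "cmod (cinner (T x) x) ^ (2 * n)
        \<le> 1 / 2 ^ n * (M n + N n + (\<Sum>k = 1..n - 1. real (n choose k) * M k * N (n - k)))"
      using bound by (simp add: power_mult)
  next
    show "0 \<le> 1 / 2 ^ n * (M n + N n + (\<Sum>k = 1..n - 1. real (n choose k) * M k * N (n - k)))"
      by (intro mult_nonneg_nonneg add_nonneg_nonneg sum_nonneg nonneg) auto
  qed (use n in simp)
qed

section \<open>Operator matrices\<close>

lemma block_op_apply:
  "blinfun_apply (block_op A B C D) z = (A (fst z) + B (snd z), C (fst z) + D (snd z))"
  by (simp add: block_op.rep_eq)

lemma bounded_operators_zero [simp, intro]: "0 \<in> bounded_operators"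
  using bounded_operators_scaleR[OF bounded_operators_id, of 0] by simp

lemma bounded_operators_block_op [intro]:
  assumes "A \<in> bounded_operators" "B \<in> bounded_operators" "C \<in> bounded_operators"
    "D \<in> bounded_operators"
  shows "block_op A B C D \<in> bounded_operators"
  using assms by (simp add: bounded_operators_def block_op_apply scaleC_prod_def scaleC_add_right)

lemma block_diag_compose:
  "block_op A 0 0 D o\<^sub>L block_op A' 0 0 D' = block_op (A o\<^sub>L A') 0 0 (D o\<^sub>L D')"
  by (rule blinfun_eqI) (simp add: block_op_apply)

lemma block_antidiag_compose:
  "block_op 0 B C 0 o\<^sub>L block_op 0 B' C' 0 = block_op (B o\<^sub>L C') 0 0 (C o\<^sub>L B')"
  by (rule blinfun_eqI) (simp add: block_op_apply)

lemma block_diag_add: "block_op A 0 0 D + block_op A' 0 0 D' = block_op (A + A') 0 0 (D + D')"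
  by (rule blinfun_eqI) (simp add: block_op_apply plus_blinfun.rep_eq)

lemma block_diag_scaleR: "r *\<^sub>R block_op A 0 0 D = block_op (r *\<^sub>R A) 0 0 (r *\<^sub>R D)"
  by (rule blinfun_eqI) (simp add: block_op_apply scaleR_blinfun.rep_eq)

lemma block_diag_id: "block_op id_blinfun 0 0 id_blinfun = id_blinfun"
  by (rule blinfun_eqI) (simp add: block_op_apply)

lemma adj_block_op:
  assumes "A \<in> bounded_operators" "B \<in> bounded_operators" "C \<in> bounded_operators"
    "D \<in> bounded_operators"
  shows "adj (block_op A B C D) = block_op (adj A) (adj C) (adj B) (adj D)"
  by (rule adj_eqI) (simp add: block_op_apply cinner_prod_def cinner_simps cinner_adj_right assms)

lemma adj_zero [simp]: "adj 0 = 0"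
  by (rule adj_eqI) simp

lemma norm_block_diag_le: "norm (block_op A 0 0 D) \<le> max (norm A) (norm D)"
proof (rule norm_blinfun_bound)
  define m where "m = max (norm A) (norm D)"
  fix z :: "'a \<times> 'a"
  have "norm (A (fst z)) \<le> m * norm (fst z)" "norm (D (snd z)) \<le> m * norm (snd z)"
    unfolding m_def by (rule order_trans[OF norm_blinfun]; simp add: mult_right_mono)+
  then have "(norm (A (fst z)))\<^sup>2 + (norm (D (snd z)))\<^sup>2 \<le> (m * norm (fst z))\<^sup>2 + (m * norm (snd z))\<^sup>2"
    by (intro add_mono power_mono) auto
  also have "\<dots> = (m * norm z)\<^sup>2"
    by (simp add: norm_prod_def power_mult_distrib distrib_left)
  finally have "norm (block_op A 0 0 D z) \<le> sqrt ((m * norm z)\<^sup>2)"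
    by (simp add: block_op_apply norm_Pair del: real_sqrt_abs)
  then show "norm (block_op A 0 0 D z) \<le> max (norm A) (norm D) * norm z"
    by (simp add: m_def abs_mult max.coboundedI1)
qed (simp add: max.coboundedI1)

lemma positive_op_block_diag:
  assumes "positive_op A" "positive_op D"
  shows "positive_op (block_op A 0 0 D)"
  using assms unfolding positive_op_def self_adjoint_def
  by (auto simp: block_op_apply cinner_prod_def)

lemma poly_op_block_diag:
  "poly_op r (block_op A 0 0 D) = block_op (poly_op r A) 0 0 (poly_op r D)"
proof (induction r)
  case 0
  show ?case using block_diag_scaleR[of 0] by simp
next
  case (pCons a r)
  then show ?case
    by (simp add: block_diag_compose block_diag_add block_diag_scaleR flip: block_diag_id)
qed

text \<open>Polynomials act entrywise on block diagonal operators, and one sequence on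
  [0, max (norm A) (norm D)] approximates f for both entries and for the block operator.\<close>

lemma cfc_block_diag:
  fixes A D :: "'a::chilbert_space \<Rightarrow>\<^sub>L 'a"
  assumes A: "positive_op A" and D: "positive_op D" and f: "continuous_on {0..} f"
  shows "cfc f (block_op A 0 0 D) = block_op (cfc f A) 0 0 (cfc f D)"
proof -
  define b where "b = max (norm A) (norm D)"
  have "continuous_on {0..b} f" by (rule continuous_on_subset[OF f]) auto
  then obtain r where r: "uniform_limit {0..b} (\<lambda>m. poly (r m)) f sequentially"
    using polynomial_uniform_limit by meson
  have rA: "(\<lambda>m. poly_op (r m) A - cfc f A) \<longlonglongrightarrow> 0" and rD: "(\<lambda>m. poly_op (r m) D - cfc f D) \<longlonglongrightarrow> 0"
    by (intro LIM_zero cfc_tendsto[OF A _ r] cfc_tendsto[OF D _ r]; simp add: b_def)+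
  have "(\<lambda>m. poly_op (r m) (block_op A 0 0 D) - block_op (cfc f A) 0 0 (cfc f D)) \<longlonglongrightarrow> 0"
  proof (rule Lim_null_comparison)
    have "norm (poly_op (r m) (block_op A 0 0 D) - block_op (cfc f A) 0 0 (cfc f D))
        \<le> norm (poly_op (r m) A - cfc f A) + norm (poly_op (r m) D - cfc f D)" for m
    proof -
      have eq: "poly_op (r m) (block_op A 0 0 D) - block_op (cfc f A) 0 0 (cfc f D)
          = block_op (poly_op (r m) A - cfc f A) 0 0 (poly_op (r m) D - cfc f D)"
        unfolding poly_op_block_diag
        by (rule blinfun_eqI) (simp add: block_op_apply minus_blinfun.rep_eq)
      show ?thesis unfolding eq by (rule order_trans[OF norm_block_diag_le]) simp
    qed
    then show "\<forall>\<^sub>F m in sequentially. norm (poly_op (r m) (block_op A 0 0 D) - block_op (cfc f A) 0 0 (cfc f D))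
        \<le> norm (poly_op (r m) A - cfc f A) + norm (poly_op (r m) D - cfc f D)" by simp
    show "(\<lambda>m. norm (poly_op (r m) A - cfc f A) + norm (poly_op (r m) D - cfc f D)) \<longlonglongrightarrow> 0"
      using tendsto_add[OF tendsto_norm[OF rA] tendsto_norm[OF rD]] by simp
  qed
  then have "(\<lambda>m. poly_op (r m) (block_op A 0 0 D)) \<longlonglongrightarrow> block_op (cfc f A) 0 0 (cfc f D)"
    by (rule LIM_zero_cancel)
  moreover have "(\<lambda>m. poly_op (r m) (block_op A 0 0 D)) \<longlonglongrightarrow> cfc f (block_op A 0 0 D)"
    by (rule cfc_tendsto[OF positive_op_block_diag[OF A D] _ r]) (simp add: b_def norm_block_diag_le)
  ultimately show ?thesis using LIMSEQ_unique by blast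
qed

lemma op_powr_block_diag:
  fixes A D :: "'a::chilbert_space \<Rightarrow>\<^sub>L 'a"
  assumes "positive_op A" "positive_op D" "0 < s"
  shows "op_powr (block_op A 0 0 D) s = block_op (op_powr A s) 0 0 (op_powr D s)"
  unfolding op_powr_def by (intro cfc_block_diag assms continuous_on_powr_nonneg)

lemma abs_op_block_diag:
  fixes A D :: "'a::chilbert_space \<Rightarrow>\<^sub>L 'a"
  assumes "A \<in> bounded_operators" "D \<in> bounded_operators"
  shows "abs_op (block_op A 0 0 D) = block_op (abs_op A) 0 0 (abs_op D)"
  using assms
  by (simp add: abs_op_def adj_block_op block_diag_compose op_powr_block_diag positive_op_adj_compose)

lemma abs_op_block_antidiag:
  fixes B C :: "'a::chilbert_space \<Rightarrow>\<^sub>L 'a"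
  assumes "B \<in> bounded_operators" "C \<in> bounded_operators"
  shows "abs_op (block_op 0 B C 0) = block_op (abs_op C) 0 0 (abs_op B)"
  using assms
  by (simp add: abs_op_def adj_block_op block_antidiag_compose op_powr_block_diag positive_op_adj_compose)

lemma M_block_diag_le:
  fixes P\<^sub>1 P\<^sub>2 Q\<^sub>1 Q\<^sub>2 :: "'a::chilbert_space \<Rightarrow>\<^sub>L 'a"
  assumes pos: "positive_op P\<^sub>1" "positive_op P\<^sub>2" "positive_op Q\<^sub>1" "positive_op Q\<^sub>2"
    and pq: "1 < p" "1 < q" "1 / p + 1 / q = 1" and k: "1 \<le> k"
  shows "young_pair.M (block_op P\<^sub>1 0 0 P\<^sub>2) (block_op Q\<^sub>1 0 0 Q\<^sub>2) p q k
    \<le> max (norm ((1/p) *\<^sub>R op_powr P\<^sub>1 (real k * p) + (1/q) *\<^sub>R op_powr Q\<^sub>1 (real k * q)))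
          (norm ((1/p) *\<^sub>R op_powr P\<^sub>2 (real k * p) + (1/q) *\<^sub>R op_powr Q\<^sub>2 (real k * q)))"
proof -
  have "young_pair (block_op P\<^sub>1 0 0 P\<^sub>2) (block_op Q\<^sub>1 0 0 Q\<^sub>2) p q"
    using pos pq by unfold_locales (auto intro: positive_op_block_diag)
  moreover have "0 < real k * p" "0 < real k * q" using k pq by auto
  ultimately show ?thesis
    using pos by (simp add: young_pair.M_def young_pair.young_sum_def op_powr_block_diag
        block_diag_scaleR block_diag_add norm_block_diag_le)
qed

theorem theorem3p33:
  fixes B C :: "'a::chilbert_space \<Rightarrow>\<^sub>L 'a"
    and p q :: real
    and f g :: "real \<Rightarrow> real"
    and n :: nat
  assumes "B \<in> bounded_operators" and "C \<in> bounded_operators"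
    and "p \<ge> 1" and "q \<ge> 1" and "1/p + 1/q = 1"
    and "continuous_on {0..} f" and "continuous_on {0..} g"
    and "\<And>t. t \<ge> 0 \<Longrightarrow> f t \<ge> 0" and "\<And>t. t \<ge> 0 \<Longrightarrow> g t \<ge> 0"
    and "\<And>t. t \<ge> 0 \<Longrightarrow> f t * g t = t"
    and "n \<ge> 2"
  shows "numerical_radius (block_op 0 B C 0) ^ (2 * n) \<le>
      1 / 2 ^ n *
        max (norm ((1/p) *\<^sub>R op_powr (abs_op C) (real n * p)
                 + (1/q) *\<^sub>R op_powr (abs_op (adj B)) (real n * q)))
            (norm ((1/p) *\<^sub>R op_powr (abs_op B) (real n * p)
                 + (1/q) *\<^sub>R op_powr (abs_op (adj C)) (real n * q)))
    + 1 / 2 ^ n *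
        max (norm ((1/p) *\<^sub>R op_powr (cfc f (abs_op (B o\<^sub>L C))) (real n * p)
                 + (1/q) *\<^sub>R op_powr (cfc g (abs_op (adj (B o\<^sub>L C)))) (real n * q)))
            (norm ((1/p) *\<^sub>R op_powr (cfc f (abs_op (C o\<^sub>L B))) (real n * p)
                 + (1/q) *\<^sub>R op_powr (cfc g (abs_op (adj (C o\<^sub>L B)))) (real n * q)))
    + 1 / 2 ^ n *
        (\<Sum>k = 1..n - 1. real (n choose k) *
          max (norm ((1/p) *\<^sub>R op_powr (abs_op C) (real k * p)
                   + (1/q) *\<^sub>R op_powr (abs_op (adj B)) (real k * q)))
              (norm ((1/p) *\<^sub>R op_powr (abs_op B) (real k * p)
                   + (1/q) *\<^sub>R op_powr (abs_op (adj C)) (real k * q))) *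
          max (norm ((1/p) *\<^sub>R op_powr (cfc f (abs_op (B o\<^sub>L C))) (real (n - k) * p)
                   + (1/q) *\<^sub>R op_powr (cfc g (abs_op (adj (B o\<^sub>L C)))) (real (n - k) * q)))
              (norm ((1/p) *\<^sub>R op_powr (cfc f (abs_op (C o\<^sub>L B))) (real (n - k) * p)
                   + (1/q) *\<^sub>R op_powr (cfc g (abs_op (adj (C o\<^sub>L B)))) (real (n - k) * q))))"
proof -
  note B = assms(1) and C = assms(2)
  \<comment> \<open>p = 1 would give 1/q = 0, impossible for q >= 1, and symmetrically for q =
    1.\<close>
  have pq: "1 < p" "1 < q" using assms(3-5) by (auto simp: less_le)
  define T where "T = block_op 0 B C 0"
  have T: "T \<in> bounded_operators" unfolding T_def using B C by auto
  have BC: "B o\<^sub>L C \<in> bounded_operators" "C o\<^sub>L B \<in> bounded_operators" using B C by auto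
  have T2: "T o\<^sub>L T = block_op (B o\<^sub>L C) 0 0 (C o\<^sub>L B)"
    by (simp add: T_def block_antidiag_compose)
  have abs_T: "abs_op T = block_op (abs_op C) 0 0 (abs_op B)"
    using B C by (simp add: T_def abs_op_block_antidiag)
  have abs_adj_T: "abs_op (adj T) = block_op (abs_op (adj B)) 0 0 (abs_op (adj C))"
    using B C by (simp add: T_def adj_block_op abs_op_block_antidiag)
  have f_T2: "cfc f (abs_op (T o\<^sub>L T)) = block_op (cfc f (abs_op (B o\<^sub>L C))) 0 0 (cfc f (abs_op (C o\<^sub>L B)))"
    unfolding T2 using BC assms(6) by (simp add: abs_op_block_diag cfc_block_diag positive_op_abs_op)
  have g_T2: "cfc g (abs_op (adj (T o\<^sub>L T)))
      = block_op (cfc g (abs_op (adj (B o\<^sub>L C)))) 0 0 (cfc g (abs_op (adj (C o\<^sub>L B))))"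
    unfolding T2 using BC assms(7)
    by (simp add: adj_block_op abs_op_block_diag cfc_block_diag positive_op_abs_op)
  define M N where "M = young_pair.M (abs_op T) (abs_op (adj T)) p q"
    and "N = young_pair.M (cfc f (abs_op (T o\<^sub>L T))) (cfc g (abs_op (adj (T o\<^sub>L T)))) p q"
  define m where "m k = max
      (norm ((1/p) *\<^sub>R op_powr (abs_op C) (real k * p) + (1/q) *\<^sub>R op_powr (abs_op (adj B)) (real k * q)))
      (norm ((1/p) *\<^sub>R op_powr (abs_op B) (real k * p) + (1/q) *\<^sub>R op_powr (abs_op (adj C)) (real k * q)))"
    for k
  define l where "l k = max
      (norm ((1/p) *\<^sub>R op_powr (cfc f (abs_op (B o\<^sub>L C))) (real k * p)
        + (1/q) *\<^sub>R op_powr (cfc g (abs_op (adj (B o\<^sub>L C)))) (real k * q)))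
      (norm ((1/p) *\<^sub>R op_powr (cfc f (abs_op (C o\<^sub>L B))) (real k * p)
        + (1/q) *\<^sub>R op_powr (cfc g (abs_op (adj (C o\<^sub>L B)))) (real k * q)))" for k
  have pos_cfc: "positive_op (cfc h (abs_op A))"
    if "A \<in> bounded_operators" "continuous_on {0..} h" "\<And>t. 0 \<le> t \<Longrightarrow> 0 \<le> h t"
    for A :: "'a \<Rightarrow>\<^sub>L 'a" and h
    using that by (intro positive_op_cfc positive_op_abs_op continuous_on_subset[OF that(2)]) auto
  have M: "M k \<le> m k" if "1 \<le> k" for k
    unfolding M_def m_def abs_T abs_adj_T
    using B C by (intro M_block_diag_le pq assms(5) that positive_op_abs_op) auto
  have N: "N k \<le> l k" if "1 \<le> k" for k
    unfolding N_def l_def f_T2 g_T2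
    using BC assms(6-9) by (intro M_block_diag_le pq assms(5) that pos_cfc) auto
  have m0: "0 \<le> m k" for k by (auto simp: m_def max_def)
  have N0: "0 \<le> N k" for k
  proof -
    have "young_pair (cfc f (abs_op (T o\<^sub>L T))) (cfc g (abs_op (adj (T o\<^sub>L T)))) p q"
      unfolding f_T2 g_T2 using BC assms(5-9) pq
      by unfold_locales (auto intro!: positive_op_block_diag pos_cfc)
    then show ?thesis by (simp add: N_def young_pair.M_nonneg)
  qed
  have "numerical_radius T ^ (2 * n)
      \<le> 1 / 2 ^ n * (M n + N n + (\<Sum>k = 1..n - 1. real (n choose k) * M k * N (n - k)))"
    unfolding M_def N_def
    by (rule numerical_radius_bound[OF T pq assms(5,6,8,7,9,10,11)])
  \<comment> \<open>Both indices k and n - k are at least 1 in the sum, so the exponents of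
    \<open>op_powr\<close> stay positive and the block bounds apply termwise.\<close>
  also have "\<dots> \<le> 1 / 2 ^ n * (m n + l n + (\<Sum>k = 1..n - 1. real (n choose k) * m k * l (n - k)))"
    using assms(11) N0 m0 M N
    by (intro mult_left_mono add_mono sum_mono mult_mono) auto
  finally show ?thesis by (simp add: T_def m_def l_def distrib_left)
qed

end
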